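(* Let $G=(V,E)$, $c$, $m$, $\lambda$ be as in one of the two settings (infinite case or finite case) described in the context, with associated killed random walk $S^{\mathrm k}$, potential $V^{\mathrm k}$, total conductances $c^{\mathrm k}(x)=c(x)+m(x)$, and graphs $G^\rho$ and $G^o$. (1) If $G$ is finite, then $$Z_{\mathrm{RSF}}(G,c,m)=Z^{\rho}_{\mathrm{RST}}(G^\rho,c^{\mathrm k})=Z^{o}_{\mathrm{RST}}(G^o,\tilde c).$$ (2) In both cases, let $\mathbb P^{\mathrm k}_{\mathrm W}$ be Wilson's measure of $S^{\mathrm k}$ (on rooted spanning trees of $G^\rho$ rooted at $\rho$), and let $\widetilde{\mathbb P}_{\mathrm W}$ be Wilson's measure of the walk with conductances $\tilde c$ (killed on exiting $V$ when $G$ is finite), on rooted spanning trees of $G^o$ rooted at $o$ (on essential spanning forests of $G$ when $G$ is infinite). Then for every finite set $\{\vec e_1,\dots,\vec e_n\}$ of distinct directed edges of $G^\rho$, $$\mathbb P^{\mathrm k}_{\mathrm W}(\vec e_1,\dots,\vec e_n)=\det\big(H^{\mathrm k}_{\vec e_i,\vec e_j}\big)_{1\le i,j\le n}\prod_{i=1}^n c^{\mathrm k}_{\vec e_i},$$ and for every finite set $\{\vec e_1,\dots,\vec e_n\}$ of distinct directed edges of $G^o$, $$\widetilde{\mathbb P}_{\mathrm W}(\vec e_1,\dots,\vec e_n)=\det\big(\widetilde H_{\vec e_i,\vec e_j}\big)_{1\le i,j\le n}\prod_{i=1}^n \tilde c_{\vec e_i},$$ where, for $\vec e=(w,x)$ and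 $\vec f=(y,z)$, $$H^{\mathrm k}_{\vec e,\vec f}=\frac{V^{\mathrm k}(w,y)}{c^{\mathrm k}(y)}-\frac{V^{\mathrm k}(x,y)}{c^{\mathrm k}(y)},\qquad \widetilde H_{\vec e,\vec f}=\frac{\lambda(y)}{\lambda(w)}\frac{V^{\mathrm k}(w,y)}{c^{\mathrm k}(y)}-\frac{\lambda(y)}{\lambda(x)}\frac{V^{\mathrm k}(x,y)}{c^{\mathrm k}(y)},$$ with the convention that every term in which an argument of $V^{\mathrm k}$ equals $\rho$ or $o$ is $0$. Here $\mathbb P(\vec e_1,\dots,\vec e_n)$ denotes the probability that all of $\vec e_1,\dots,\vec e_n$ belong to the random forest/tree.
   Context: Graphs are connected, locally finite, countable, undirected (loops $xx$ allowed, no multiple edges); $\vec E$ is the set of directed edges $(x,y),(y,x)$ for $xy\in E$, and $x\sim y$ means $xy\in E$. A conductance function is $c:\vec E\to\mathbb R_{>0}$ (not necessarily symmetric), $c(x)=\sum_{y\sim x}c_{(x,y)}$, assumed uniformly bounded on infinite graphs; a mass function is $m:V\to\mathbb R_{\ge0}$. The massive Laplacian is $(\Delta^{\mathrm k}f)(x)=m(x)f(x)+\sum_{y\sim x}c_{(x,y)}(f(x)-f(y))$; $f$ is massive harmonic at $x$ if $(\Delta^{\mathrm k}f)(x)=0$. Put $c^{\mathrm k}(x)=c(x)+m(x)$. The killed random walk $S^{\mathrm k}$ on $V\cup\{\rho\}$ jumps from $x\in V$ to $y\sim x$ with probability $c_{(x,y)}/c^{\mathrm k}(x)$ and to the absorbing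 cemetery $\rho$ with probability $m(x)/c^{\mathrm k}(x)$. Its potential is $V^{\mathrm k}(x,y)=\sum_{n\ge0}\mathbb P_x(S^{\mathrm k}_n=y)$, $x,y\in V$. Infinite case: $G$ is infinite, $m\not\equiv0$, $S^{\mathrm k}$ reaches $\rho$ almost surely in finite time from every starting vertex, and $\lambda:V\to\mathbb R_{>0}$ is massive harmonic on $V$. Set $G^o=G$ and $\tilde c_{(x,y)}=\frac{\lambda(y)}{\lambda(x)}c_{(x,y)}$. Finite case: $G^\infty=(V^\infty,E^\infty)$ is a connected graph with conductances and masses $(c^\infty,m^\infty)$ and massive Laplacian $\Delta^{\mathrm k}$; $V\subsetneq V^\infty$ is a finite strict subset whose induced subgraph $G$ is connected; $c=c^\infty|_{\vec E}$ and $m(x)=m^\infty(x)+\sum_{y\sim x,\,y\in V^\infty\setminus V}c^\infty_{(x,y)}$ (wired boundary conditions); $\lambda:V^\infty\to\mathbb R_{>0}$ satisfies $(\Delta^{\mathrm k}\lambda)(x)=0$ for all $x\in V$. Set $\tilde c^\infty_{(x,y)}=\frac{\lambda(y)}{\lambda(x)}c^\infty_{(x,y)}$. $G^o$ is obtained from $G^\infty$ by identifying all vertices of $V^\infty\setminus V$ to a single vertex $o$ (keeping only $G$ and the edges from $V$ to $o$); its conductances are $\tilde c=\tilde c^\infty$ on $\vec E$ and $\tilde c_{(x,o)}=\sum_{y\sim x,\,y\in V^\infty\setminus V}\tilde c^\infty_{(x,y)}$. (Conductances of edges $(o,x)$ play no role.) $S^{\mathrm k}$ and $V^{\mathrm k}$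 are associated with $(G,c,m)$. $G^\rho$ is $G$ with an added vertex $\rho$ and an edge $x\rho$ for each $x$ with $m(x)>0$; its conductances are $c^{\mathrm k}_{(x,y)}=c_{(x,y)}$ on $\vec E$ and $c^{\mathrm k}_{(x,\rho)}=c^{\mathrm k}_{(\rho,x)}=m(x)$. A rooted spanning forest (RSF) of a graph is a set $F$ of directed edges without cycles such that each vertex has at most one outgoing edge in $F$; $R(F)$ is the set of vertices with no outgoing edge (roots). A rooted spanning tree (RST) rooted at $r$ is an RSF with $R(F)=\{r\}$; an RSF without roots is an essential spanning forest (so on infinite graphs these may have infinite unrooted components). For finite graphs, $Z_{\mathrm{RSF}}(G,c,m)=\sum_F\prod_{\vec e\in F}c_{\vec e}\prod_{x\in R(F)}m(x)$ and $Z^r_{\mathrm{RST}}(G,c)=\sum_{T\text{ rooted at }r}\prod_{\vec e\in T}c_{\vec e}$. Wilson's measure of a transient (killed) random walk: fix an enumeration of the vertices; start from the empty edge set; repeatedly, from the first vertex not yet covered, run the walk until it hits its cemetery ($\rho$, resp. $o$) or a vertex already covered, or forever if this never occurs, and add the chronological loop-erasure of this trajectory (as directed edges); the law of the resulting random set of directed edges is Wilson's measure. For a finite graph with killing it coincides with the Boltzmann measure $\mathbb P(T)=\prod_{\vec e\in T}c_{\vec e}/Z$ on spanning trees rooted at the cemetery. In the infinite case the walk with conductances $\tilde c$ has no killing (transition probabilities $\tilde c_{(x,y)}/\sum_z\tilde c_{(x,z)}$) and is transient; in the finite case its cemetery is $o$. *)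

theory Defs
  imports "HOL-Probability.Probability" "Jordan_Normal_Form.Determinant"
begin

section \<open>Graphs with conductances and masses\<close>

text \<open>
  An undirected graph, possibly with loops, is a vertex set \<open>V\<close> together with the symmetric set
  \<open>E\<close> of its directed edges; the neighbours of \<open>x\<close> are \<open>E `` {x}\<close>.  Conductances need not be
  symmetric, and only their values on \<open>E\<close> (and those of the masses on \<open>V\<close>) are meaningful.
\<close>

definition total_cond :: "('a \<times> 'a) set \<Rightarrow> ('a \<times> 'a \<Rightarrow> real) \<Rightarrow> 'a \<Rightarrow> real" where
  "total_cond E c x = (\<Sum>y\<in>E `` {x}. c (x, y))"

definition killed_cond :: "('a \<times> 'a) set \<Rightarrow> ('a \<times> 'a \<Rightarrow> real) \<Rightarrow> ('a \<Rightarrow> real) \<Rightarrow> 'a \<Rightarrow> real" where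
  "killed_cond E c m x = total_cond E c x + m x"

definition massive_laplacian ::
    "('a \<times> 'a) set \<Rightarrow> ('a \<times> 'a \<Rightarrow> real) \<Rightarrow> ('a \<Rightarrow> real) \<Rightarrow> ('a \<Rightarrow> real) \<Rightarrow> 'a \<Rightarrow> real" where
  "massive_laplacian E c m f x = m x * f x + (\<Sum>y\<in>E `` {x}. c (x, y) * (f x - f y))"

locale massive_graph =
  fixes V :: "'a set" and E :: "('a \<times> 'a) set"
    and c :: "'a \<times> 'a \<Rightarrow> real" and m :: "'a \<Rightarrow> real"
  assumes nonempty: "V \<noteq> {}"
    and countable_V: "countable V"
    and edges_in: "E \<subseteq> V \<times> V"
    and undirected: "sym E"
    and locally_finite: "\<And>x. x \<in> V \<Longrightarrow> finite (E `` {x})"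
    and connected: "\<And>x y. x \<in> V \<Longrightarrow> y \<in> V \<Longrightarrow> (x, y) \<in> E\<^sup>*"
    and cond_pos: "\<And>e. e \<in> E \<Longrightarrow> c e > 0"
    and mass_nonneg: "\<And>x. x \<in> V \<Longrightarrow> m x \<ge> 0"
    and cond_bounded: "infinite V \<Longrightarrow> \<exists>C. \<forall>x\<in>V. total_cond E c x \<le> C"


section \<open>Rooted spanning forests and partition functions\<close>

text \<open>
  When every vertex has at most one outgoing edge, every cycle is a directed one, so
  \<open>acyclic\<close> excludes all cycles (loops and back-and-forth pairs included).
\<close>

definition rsf :: "('a \<times> 'a) set \<Rightarrow> ('a \<times> 'a) set \<Rightarrow> bool" where
  "rsf E F \<longleftrightarrow> F \<subseteq> E \<and> acyclic F \<and> single_valued F"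

definition roots :: "'a set \<Rightarrow> ('a \<times> 'a) set \<Rightarrow> 'a set" where
  "roots V F = V - Domain F"

definition rst :: "'a set \<Rightarrow> ('a \<times> 'a) set \<Rightarrow> 'a \<Rightarrow> ('a \<times> 'a) set \<Rightarrow> bool" where
  "rst V E r T \<longleftrightarrow> rsf E T \<and> roots V T = {r}"

definition Z_RSF :: "'a set \<Rightarrow> ('a \<times> 'a) set \<Rightarrow> ('a \<times> 'a \<Rightarrow> real) \<Rightarrow> ('a \<Rightarrow> real) \<Rightarrow> real" where
  "Z_RSF V E c m = (\<Sum>F | rsf E F. (\<Prod>e\<in>F. c e) * (\<Prod>x\<in>roots V F. m x))"

definition Z_RST :: "'a set \<Rightarrow> ('a \<times> 'a) set \<Rightarrow> ('a \<times> 'a \<Rightarrow> real) \<Rightarrow> 'a \<Rightarrow> real" where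
  "Z_RST V E c r = (\<Sum>T | rst V E r T. \<Prod>e\<in>T. c e)"


section \<open>Adding a cemetery\<close>

text \<open>
  Vertices of the extended graphs have type \<^typ>\<open>'a option\<close>: \<open>Some x\<close> is the vertex \<open>x\<close> of the
  original graph and \<open>None\<close> is the added vertex (\<open>\<rho>\<close> or \<open>o\<close>).
\<close>

definition cone_edges :: "('a \<times> 'a) set \<Rightarrow> 'a set \<Rightarrow> ('a option \<times> 'a option) set" where
  "cone_edges E B =
     map_prod Some Some ` E \<union> (\<lambda>x. (Some x, None)) ` B \<union> (\<lambda>x. (None, Some x)) ` B"

definition V_rho :: "'a set \<Rightarrow> 'a option set" where
  "V_rho V = insert None (Some ` V)"

definition E_rho :: "'a set \<Rightarrow> ('a \<times> 'a) set \<Rightarrow> ('a \<Rightarrow> real) \<Rightarrow> ('a option \<times> 'a option) set" where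
  "E_rho V E m = cone_edges E {x \<in> V. m x > 0}"

fun c_rho :: "('a \<times> 'a \<Rightarrow> real) \<Rightarrow> ('a \<Rightarrow> real) \<Rightarrow> 'a option \<times> 'a option \<Rightarrow> real" where
  "c_rho c m (Some x, Some y) = c (x, y)"
| "c_rho c m (Some x, None) = m x"
| "c_rho c m (None, Some x) = m x"
| "c_rho c m (None, None) = 0"


section \<open>Random walks\<close>

text \<open>Transition probabilities of the killed random walk on \<open>V \<union> {\<rho>}\<close>.\<close>

fun killed_prob ::
    "('a \<times> 'a) set \<Rightarrow> ('a \<times> 'a \<Rightarrow> real) \<Rightarrow> ('a \<Rightarrow> real) \<Rightarrow> 'a option \<Rightarrow> 'a option \<Rightarrow> real" where
  "killed_prob E c m (Some x) (Some y) =
     (if (x, y) \<in> E then c (x, y) / killed_cond E c m x else 0)"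
| "killed_prob E c m (Some x) None = m x / killed_cond E c m x"
| "killed_prob E c m None t = (if t = None then 1 else 0)"

text \<open>
  Transition probabilities proportional to conductances, on a graph whose vertex \<open>None\<close>
  (if present) is an absorbing cemetery.
\<close>

definition conductance_prob ::
    "('a option \<times> 'a option) set \<Rightarrow> ('a option \<times> 'a option \<Rightarrow> real)
     \<Rightarrow> 'a option \<Rightarrow> 'a option \<Rightarrow> real" where
  "conductance_prob E c s t =
     (if s = None then (if t = None then 1 else 0)
      else if (s, t) \<in> E then c (s, t) / total_cond E c s else 0)"

text \<open>
  The law, on sequences of states, of the Markov chain on the countable set \<open>W\<close> with transition
  probabilities \<open>p\<close> started at \<open>s\<close>.  It is constructed from independent variables
  \<open>\<omega> (n, t)\<close>, where \<open>\<omega> (n, t)\<close> has law \<open>p t\<close> and is the state to which the chain jumps at time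
  \<open>n\<close> if it is then at \<open>t\<close>.
\<close>

primrec trajectory :: "'s \<Rightarrow> (nat \<times> 's \<Rightarrow> 's) \<Rightarrow> nat \<Rightarrow> 's" where
  "trajectory s \<omega> 0 = s"
| "trajectory s \<omega> (Suc n) = \<omega> (n, trajectory s \<omega> n)"

definition walk_law :: "'s set \<Rightarrow> ('s \<Rightarrow> 's \<Rightarrow> real) \<Rightarrow> 's \<Rightarrow> (nat \<Rightarrow> 's) measure" where
  "walk_law W p s =
     distr (\<Pi>\<^sub>M (n, t)\<in>UNIV \<times> W. point_measure W (\<lambda>u. ennreal (p t u)))
           (\<Pi>\<^sub>M n\<in>UNIV. count_space W) (trajectory s)"

lemma walk_law_cylinder:
  assumes W: "countable W" "s \<in> W" and p: "\<And>t u. t \<in> W \<Longrightarrow> u \<in> W \<Longrightarrow> p t u \<ge> 0"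
    and sum1: "\<And>t. t \<in> W \<Longrightarrow> (\<integral>\<^sup>+u. ennreal (p t u) \<partial>count_space W) = 1"
    and xs: "xs 0 = s" "\<And>i. xs i \<in> W"
  shows "emeasure (walk_law W p s) {S \<in> space (walk_law W p s). \<forall>i\<le>n. S i = xs i}
         = (\<Prod>i<n. ennreal (p (xs i) (xs (Suc i))))"
proof -
  define N where "N = (\<lambda>t. if t \<in> W then point_measure W (\<lambda>u. ennreal (p t u)) else return (count_space W) s)"
  have spN[simp]: "space (N t) = W" "sets (N t) = Pow W" for t
    by (auto simp: N_def space_point_measure sets_point_measure)
  have prN: "prob_space (N t)" for t
  proof (cases "t \<in> W")
    case True
    then show ?thesis unfolding N_def
      by (auto intro!: prob_spaceI simp: space_point_measure sum1 point_measure_def emeasure_density nn_integral_set_ennreal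
         cong: nn_integral_cong) 
        (simp add: nn_integral_indicator_singleton sum1 cong: nn_integral_cong_simp)
  next
    case False then show ?thesis using W by (auto simp: N_def intro!: prob_space_return)
  qed
  interpret product_prob_space "\<lambda>(n::nat, t). N t" "UNIV \<times> W"
    by (auto simp: product_prob_space_def product_prob_space_axioms_def product_sigma_finite_def prN
       prob_space_imp_sigma_finite split: prod.splits)
  define P where "P = (\<Pi>\<^sub>M (n::nat, t)\<in>UNIV \<times> W. N t)"
  have Peq: "(\<Pi>\<^sub>M (n::nat, t)\<in>UNIV \<times> W. point_measure W (\<lambda>u. ennreal (p t u))) = P"
    unfolding P_def by (intro PiM_cong) (auto simp: N_def)
  have spP: "space P = (UNIV \<times> W) \<rightarrow>\<^sub>E W" unfolding P_def space_PiM by (intro PiE_cong) auto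
  have tin: "trajectory s \<omega> k \<in> W" if "\<omega> \<in> space P" for \<omega> k
    using that W(2) by (induction k) (auto simp: spP)
  have comp: "(\<lambda>\<omega>. \<omega> (k, t)) \<in> measurable P (count_space W)" if "t \<in> W" for k t
  proof -
    have "(\<lambda>\<omega>. \<omega> (k, t)) \<in> measurable P ((\<lambda>(n, t). N t) (k,t))"
      unfolding P_def using that by (intro measurable_component_singleton) auto
    then show ?thesis by (simp add: measurable_def)
  qed
  have mt: "(\<lambda>\<omega>. trajectory s \<omega> k) \<in> measurable P (count_space W)" for k
  proof (induction k)
    case 0 then show ?case using W by simp
  next
    case (Suc k)
    show ?case
      by (simp, rule measurable_compose_countable'[OF comp Suc W(1)]) auto
  qed
  have m: "trajectory s \<in> measurable P (\<Pi>\<^sub>M n\<in>UNIV. count_space W)"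
    by (rule measurable_PiM_single') (auto simp: mt spP tin intro!: mt)
  have spL: "space (walk_law W p s) = UNIV \<rightarrow>\<^sub>E W"
    by (simp add: walk_law_def space_PiM)
  have setC: "{S \<in> space (walk_law W p s). \<forall>i\<le>n. S i = xs i} \<in> sets (\<Pi>\<^sub>M n\<in>(UNIV::nat set). count_space W)"
    unfolding walk_law_def space_distr using xs by measurable
  have cyl: "(\<forall>i\<le>n. trajectory s \<omega> i = xs i) \<longleftrightarrow> (\<forall>i<n. \<omega> (i, xs i) = xs (Suc i))" for \<omega>
    by (induction n) (auto simp: xs le_Suc_eq less_Suc_eq)
  define J where "J = (\<lambda>i. (i, xs i)) ` {..<n}"
  have inj: "inj_on (\<lambda>i. (i, xs i)) {..<n}" by (auto simp: inj_on_def)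
  have "emeasure (walk_law W p s) {S \<in> space (walk_law W p s). \<forall>i\<le>n. S i = xs i}
     = emeasure P (trajectory s -` {S \<in> space (walk_law W p s). \<forall>i\<le>n. S i = xs i} \<inter> space P)"
    unfolding walk_law_def[unfolded Peq] Peq using setC m by (subst emeasure_distr) (auto simp: walk_law_def Peq)
  also have "trajectory s -` {S \<in> space (walk_law W p s). \<forall>i\<le>n. S i = xs i} \<inter> space P
     = {\<omega>\<in>space P. \<forall>j\<in>J. \<omega> j \<in> {xs (Suc (fst j))}}"
    using tin by (auto simp: spL J_def cyl PiE_iff)
  also have "emeasure P \<dots> = (\<Prod>j\<in>J. emeasure ((\<lambda>(n, t). N t) j) {xs (Suc (fst j))})"
    unfolding P_def by (rule emeasure_PiM_Collect) (auto simp: J_def xs)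
  also have "\<dots> = (\<Prod>i<n. emeasure (N (xs i)) {xs (Suc i)})"
    unfolding J_def by (subst prod.reindex[OF inj]) simp
  also have "\<dots> = (\<Prod>i<n. ennreal (p (xs i) (xs (Suc i))))"
    by (intro prod.cong refl) (simp add: N_def xs emeasure_point_measure_finite2 p point_measure_def emeasure_density
       nn_integral_indicator_singleton[where f="\<lambda>u. ennreal (p _ u)"])
  finally show ?thesis .
qed

definition killed_walk ::
    "'a set \<Rightarrow> ('a \<times> 'a) set \<Rightarrow> ('a \<times> 'a \<Rightarrow> real) \<Rightarrow> ('a \<Rightarrow> real) \<Rightarrow> 'a
     \<Rightarrow> (nat \<Rightarrow> 'a option) measure" where
  "killed_walk V E c m x = walk_law (V_rho V) (killed_prob E c m) (Some x)"

text \<open>A real series; it converges in all the situations considered here.\<close>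

definition potential ::
    "'a set \<Rightarrow> ('a \<times> 'a) set \<Rightarrow> ('a \<times> 'a \<Rightarrow> real) \<Rightarrow> ('a \<Rightarrow> real) \<Rightarrow> 'a \<Rightarrow> 'a \<Rightarrow> real" where
  "potential V E c m x y =
     (\<Sum>n. measure (killed_walk V E c m x) {S \<in> space (killed_walk V E c m x). S n = Some y})"


section \<open>Wilson's measure\<close>

text \<open>
  Chronological loop-erasure of a finite path: when the path comes to \<open>y\<close>, the part of the
  loop-erased path built so far from its visit to \<open>y\<close> on (if any) is removed, then \<open>y\<close> is appended.
\<close>

definition loop_erase :: "'s list \<Rightarrow> 's list" where
  "loop_erase = foldl (\<lambda>q y. takeWhile (\<lambda>z. z \<noteq> y) q @ [y]) []"

definition path_edges :: "'s list \<Rightarrow> ('s \<times> 's) set" where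
  "path_edges q = set (zip q (tl q))"

text \<open>
  Edges of the loop-erasure of the trajectory \<open>S\<close> stopped when it first hits \<open>A\<close>.  If \<open>A\<close> is never
  hit, the loop-erasure of the infinite trajectory is the limit of the loop-erasures of its initial
  segments: when every state is visited finitely often, each edge eventually stays or
  eventually stays away.
\<close>

definition loop_erased_edges :: "'s set \<Rightarrow> (nat \<Rightarrow> 's) \<Rightarrow> ('s \<times> 's) set" where
  "loop_erased_edges A S =
     (if \<exists>n. S n \<in> A
      then path_edges (loop_erase (map S [0..<Suc (LEAST n. S n \<in> A)]))
      else {e. \<exists>N. \<forall>n\<ge>N. e \<in> path_edges (loop_erase (map S [0..<Suc n]))})"

text \<open>
  The first \<open>j\<close> rounds of Wilson's algorithm for the enumeration \<open>en\<close> of the vertices;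
  \<open>X x\<close> is the walk used when a round starts from \<open>x\<close>.  The covered vertices
  are the endpoints of the edges obtained so far.
\<close>

primrec wilson_rounds ::
    "(nat \<Rightarrow> 'a) \<Rightarrow> ('a \<Rightarrow> nat \<Rightarrow> 'a option) \<Rightarrow> nat \<Rightarrow> ('a option \<times> 'a option) set" where
  "wilson_rounds en X 0 = {}"
| "wilson_rounds en X (Suc j) =
     (let F = wilson_rounds en X j in
      if \<exists>i. Some (en i) \<notin> Field F
      then F \<union> loop_erased_edges (insert None (Field F)) (X (en (LEAST i. Some (en i) \<notin> Field F)))
      else F)"

definition wilson_edges ::
    "(nat \<Rightarrow> 'a) \<Rightarrow> ('a \<Rightarrow> nat \<Rightarrow> 'a option) \<Rightarrow> ('a option \<times> 'a option) set" where
  "wilson_edges en X = (\<Union>j. wilson_rounds en X j)"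

text \<open>
  The law of the random edge set, on the \<open>\<sigma>\<close>-algebra generated by the events \<open>e \<in> F\<close>.  At most one
  round starts from a given vertex, so one independent walk per vertex suffices.
\<close>

definition wilson_measure ::
    "'a option set \<Rightarrow> ('a option \<Rightarrow> 'a option \<Rightarrow> real) \<Rightarrow> (nat \<Rightarrow> 'a)
     \<Rightarrow> ('a option \<times> 'a option) set measure" where
  "wilson_measure W p en =
     distr (\<Pi>\<^sub>M x\<in>Some -` W. walk_law W p (Some x))
           (sigma UNIV (range (\<lambda>e. {F. e \<in> F}))) (wilson_edges en)"


section \<open>Transfer operators\<close>

fun green_rho ::
    "'a set \<Rightarrow> ('a \<times> 'a) set \<Rightarrow> ('a \<times> 'a \<Rightarrow> real) \<Rightarrow> ('a \<Rightarrow> real)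
     \<Rightarrow> 'a option \<Rightarrow> 'a option \<Rightarrow> real" where
  "green_rho V E c m (Some w) (Some y) = potential V E c m w y / killed_cond E c m y"
| "green_rho V E c m None t = 0"
| "green_rho V E c m s None = 0"

fun green_tilde ::
    "'a set \<Rightarrow> ('a \<times> 'a) set \<Rightarrow> ('a \<times> 'a \<Rightarrow> real) \<Rightarrow> ('a \<Rightarrow> real) \<Rightarrow> ('a \<Rightarrow> real)
     \<Rightarrow> 'a option \<Rightarrow> 'a option \<Rightarrow> real" where
  "green_tilde V E c m lam (Some w) (Some y) =
     lam y / lam w * (potential V E c m w y / killed_cond E c m y)"
| "green_tilde V E c m lam None t = 0"
| "green_tilde V E c m lam s None = 0"

definition H_rho ::
    "'a set \<Rightarrow> ('a \<times> 'a) set \<Rightarrow> ('a \<times> 'a \<Rightarrow> real) \<Rightarrow> ('a \<Rightarrow> real)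
     \<Rightarrow> 'a option \<times> 'a option \<Rightarrow> 'a option \<times> 'a option \<Rightarrow> real" where
  "H_rho V E c m = (\<lambda>(w, x) (y, z). green_rho V E c m w y - green_rho V E c m x y)"

definition H_tilde ::
    "'a set \<Rightarrow> ('a \<times> 'a) set \<Rightarrow> ('a \<times> 'a \<Rightarrow> real) \<Rightarrow> ('a \<Rightarrow> real) \<Rightarrow> ('a \<Rightarrow> real)
     \<Rightarrow> 'a option \<times> 'a option \<Rightarrow> 'a option \<times> 'a option \<Rightarrow> real" where
  "H_tilde V E c m lam =
     (\<lambda>(w, x) (y, z). green_tilde V E c m lam w y - green_tilde V E c m lam x y)"


section \<open>The two settings\<close>

text \<open>
  In both settings \<open>(Vo, Eo)\<close> is the graph \<open>G\<^sup>o\<close> and \<open>ct\<close> are the conductances \<open>c\<close>-tilde on it.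
  In the infinite setting \<open>G\<^sup>o\<close> is \<open>G\<close> itself, transported along \<open>Some\<close>.
\<close>

locale infinite_case = massive_graph V E c m
  for V :: "'a set" and E and c and m +
  fixes lam :: "'a \<Rightarrow> real"
    and Vo :: "'a option set" and Eo :: "('a option \<times> 'a option) set"
    and ct :: "'a option \<times> 'a option \<Rightarrow> real"
  assumes infinite_V: "infinite V"
    and mass_nonzero: "\<exists>x\<in>V. m x \<noteq> 0"
    and killed_as: "\<And>x. x \<in> V \<Longrightarrow> AE S in killed_walk V E c m x. \<exists>n. S n = None"
    and lam_pos: "\<And>x. x \<in> V \<Longrightarrow> lam x > 0"
    and lam_harmonic: "\<And>x. x \<in> V \<Longrightarrow> massive_laplacian E c m lam x = 0"
    and Vo_def: "Vo = Some ` V"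
    and Eo_def: "Eo = map_prod Some Some ` E"
    and ct_inner: "\<And>x y. (x, y) \<in> E \<Longrightarrow> ct (Some x, Some y) = lam y / lam x * c (x, y)"

text \<open>
  The graph \<open>(Vi, Ei)\<close> with \<open>ci\<close>, \<open>mi\<close> is \<open>G\<^sup>\<infinity>\<close>.  The values of \<open>ct\<close> on the edges out of \<open>o\<close>, which
  play no role, are left unconstrained.
\<close>

locale finite_case = massive_graph Vi Ei ci mi
  for Vi :: "'a set" and Ei and ci and mi +
  fixes V :: "'a set" and E :: "('a \<times> 'a) set"
    and c :: "'a \<times> 'a \<Rightarrow> real" and m :: "'a \<Rightarrow> real" and lam :: "'a \<Rightarrow> real"
    and Vo :: "'a option set" and Eo :: "('a option \<times> 'a option) set"
    and ct :: "'a option \<times> 'a option \<Rightarrow> real"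
  assumes finite_V: "finite V"
    and V_nonempty: "V \<noteq> {}"
    and V_strict: "V \<subset> Vi"
    and E_induced: "E = Ei \<inter> V \<times> V"
    and V_connected: "\<And>x y. x \<in> V \<Longrightarrow> y \<in> V \<Longrightarrow> (x, y) \<in> E\<^sup>*"
    and c_restrict: "\<And>e. e \<in> E \<Longrightarrow> c e = ci e"
    and m_wired: "\<And>x. x \<in> V \<Longrightarrow> m x = mi x + (\<Sum>y\<in>Ei `` {x} - V. ci (x, y))"
    and lam_pos: "\<And>x. x \<in> Vi \<Longrightarrow> lam x > 0"
    and lam_harmonic: "\<And>x. x \<in> V \<Longrightarrow> massive_laplacian Ei ci mi lam x = 0"
    and Vo_def: "Vo = insert None (Some ` V)"
    and Eo_def: "Eo = cone_edges E {x \<in> V. Ei `` {x} - V \<noteq> {}}"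
    and ct_inner: "\<And>x y. (x, y) \<in> E \<Longrightarrow> ct (Some x, Some y) = lam y / lam x * ci (x, y)"
    and ct_boundary: "\<And>x. x \<in> V \<Longrightarrow> Ei `` {x} - V \<noteq> {} \<Longrightarrow>
      ct (Some x, None) = (\<Sum>y\<in>Ei `` {x} - V. lam y / lam x * ci (x, y))"

end

(*
  A walk that is killed, or merely transient, has a finite Green function.  On a finite set R of
  states, with everything outside R absorbing, the probability that the loop-erasure of the walk is
  a given path g is the product of its transition probabilities and of Green functions on a
  decreasing sequence of sets; these are ratios of determinants of I - P, so the product telescopes
  to det (I - P on R - g) / det (I - P on R).  Over the rounds of Wilson's algorithm this
  telescopes again, and every tree T has probability at least (product of p over T) / det (I - P).
  By the matrix tree theorem these bounds add up to 1, so they are equalities.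

  Forcing given edges means replacing rows of I - P; multiplying by the Green function turns the
  remaining rows into unit vectors and leaves the transfer-current determinant.

  On an infinite vertex set, the algorithm is compared, with the same walks, with the algorithms in
  which all vertices outside a finite set are covered from the start.  Almost surely every edge is
  eventually in all or in none of these forests, in agreement with the full algorithm, because the
  walks are transient and the graph is locally finite; the Green functions converge as well.

  Both walks of the theorem are transient because the graph is connected and killing is possible
  somewhere.  The second one is the Doob transform of the first by lambda, which conjugates the
  Green function by lambda; harmonicity says that the total conductances agree.
*)

theory Submission
  imports Defs
begin

section \<open>Determinants over finite index sets and the matrix tree theorem\<close>

text \<open>Each loop-erasure removes an arbitrary set of vertices, so determinants are indexed by
  finite sets of states rather than by initial segments of the naturals. Lower bounds are within
  easy reach because, once the tree is prescribed, the starting vertices of all rounds are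
  determined: the outcome contains a product event for independent walks, and conditioning on random
  starting points or random times is avoided. That the outcomes exclude each other then does the
  rest. States outside a finite domain are not merged, so an edge means the same thing for every
  domain and outcomes can be compared edge by edge. The delicate case is a walk that runs forever;
  there an edge settles some time after the last visit to its source. On an infinite graph the walk
  with conductances \<open>ct\<close> is never killed, so its transience has to be inherited from
  the killed walk. Edges with a common source are a degenerate case: they never occur together, and
  they give equal columns.\<close>

definition det_on :: "'s set \<Rightarrow> ('s \<Rightarrow> 's \<Rightarrow> 'r::comm_ring_1) \<Rightarrow> 'r" where
  "det_on R M = (\<Sum>\<pi> | \<pi> permutes R. of_int (sign \<pi>) * (\<Prod>x\<in>R. M x (\<pi> x)))"

lemma det_on_cong:
  assumes "\<And>x y. x \<in> R \<Longrightarrow> y \<in> R \<Longrightarrow> M x y = N x y"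
  shows "det_on R M = det_on R N"
  unfolding det_on_def by (intro sum.cong refl arg_cong2[of _ _ _ _ "(*)"] prod.cong)
    (auto simp: assms permutes_in_image)

lemma det_on_empty [simp]: "det_on {} M = 1"
  by (simp add: det_on_def)

lemma det_on_singleton [simp]: "det_on {x} M = M x x"
  by (simp add: det_on_def permutes_sing)

text \<open>Conjugating permutations by \<open>h\<close> preserves signs. With \<open>S\<close> of
  the form \<open>{0..<n}\<close> this gives access to the results about matrices.\<close>

lemma det_on_bij:
  assumes h: "bij_betw h S R" and S: "finite S"
  shows "det_on R M = det_on S (\<lambda>x y. M (h x) (h y))"
proof -
  have inj: "inj_on h S" and R: "R = h ` S"
    using h by (auto simp: bij_betw_def)
  have b: "bij_betw (map_permutation S h) {\<pi>. \<pi> permutes S} {\<pi>. \<pi> permutes R}"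
    using bij_betw_permutations[OF h] by (simp add: map_permutation_def[abs_def] restrict_id_def R o_def)
  have "det_on R M = (\<Sum>\<pi> | \<pi> permutes S. of_int (sign (map_permutation S h \<pi>)) * (\<Prod>x\<in>R. M x (map_permutation S h \<pi> x)))"
    unfolding det_on_def by (rule sum.reindex_bij_betw[OF b, symmetric])
  also have "\<dots> = det_on S (\<lambda>x y. M (h x) (h y))"
    unfolding det_on_def
  proof (intro sum.cong refl arg_cong2[of _ _ _ _ "(*)"])
    fix \<pi> assume "\<pi> \<in> {\<pi>. \<pi> permutes S}"
    then have p: "\<pi> permutes S" by simp
    show "of_int (sign (map_permutation S h \<pi>)) = of_int (sign \<pi>)"
      using sign_map_permutation[OF inj p S] by simp
    show "(\<Prod>x\<in>R. M x (map_permutation S h \<pi> x)) = (\<Prod>x\<in>S. M (h x) (h (\<pi> x)))"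
      unfolding R prod.reindex[OF inj] o_def
      by (intro prod.cong refl) (simp add: map_permutation_def restrict_id_def inj)
  qed
  finally show ?thesis .
qed

lemma det_mat_eq_det_on:
  "Determinant.det (Matrix.mat n n (\<lambda>(i, j). M i j)) = det_on {0..<n} M"
proof -
  have "\<pi> i < n" if "\<pi> permutes {0..<n}" "i < n" for \<pi> i
    using permutes_in_image[OF that(1), of i] that(2) by simp
  then show ?thesis
    by (auto simp: Determinant.det_def det_on_def intro!: sum.cong prod.cong)
qed

lemma det_on_mult:
  fixes A B :: "'s \<Rightarrow> 's \<Rightarrow> 'r::comm_ring_1"
  assumes "finite R"
  shows "det_on R (\<lambda>x y. \<Sum>z\<in>R. A x z * B z y) = det_on R A * det_on R B"
proof -
  define n where "n = card R"
  obtain h where h: "bij_betw h {0..<n} R"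
    using ex_bij_betw_nat_finite[OF assms] n_def by blast
  have "det_on R (\<lambda>x y. \<Sum>z\<in>R. A x z * B z y) =
     det_on {0..<n} (\<lambda>i j. \<Sum>k = 0..<n. A (h i) (h k) * B (h k) (h j))"
    unfolding det_on_bij[OF h finite_atLeastLessThan]
    by (intro det_on_cong) (simp add: sum.reindex_bij_betw[OF h, symmetric])
  also have "\<dots> = Determinant.det
      (Matrix.mat n n (\<lambda>(i, j). A (h i) (h j)) * Matrix.mat n n (\<lambda>(i, j). B (h i) (h j)))"
    unfolding det_mat_eq_det_on[symmetric]
    by (intro arg_cong[of _ _ Determinant.det] eq_matI) (auto simp: scalar_prod_def)
  also have "\<dots> = det_on R A * det_on R B"
    by (subst Determinant.det_mult) (auto simp: det_mat_eq_det_on det_on_bij[OF h finite_atLeastLessThan])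
  finally show ?thesis .
qed

text \<open>A permutation with nonzero contribution must fix every element of \<open>R - S\<close>,
  because the rows there are unit vectors; only permutations of \<open>S\<close> remain. All later
  reductions to a smaller index set use this.\<close>

lemma det_on_identity_rows:
  assumes R: "finite R" and S: "S \<subseteq> R"
    and id: "\<And>x y. x \<in> R - S \<Longrightarrow> y \<in> R \<Longrightarrow> M x y = (if x = y then 1 else 0)"
  shows "det_on R M = det_on S M"
proof -
  have z: "(\<Prod>x\<in>R. M x (\<pi> x)) = 0" if \<pi>: "\<pi> permutes R" "\<not> \<pi> permutes S" for \<pi>
  proof -
    have "\<exists>x\<in>R - S. \<pi> x \<noteq> x"
      using \<pi> by (metis DiffI permutes_superset permutes_not_in)
    then show ?thesis
      using id \<pi>(1) R by (metis DiffD1 permutes_in_image prod_zero)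
  qed
  have "det_on R M = (\<Sum>\<pi> | \<pi> permutes S. of_int (sign \<pi>) * (\<Prod>x\<in>R. M x (\<pi> x)))"
    unfolding det_on_def
    by (rule sum.mono_neutral_right) (auto simp: finite_permutations R z intro: permutes_subset[OF _ S])
  also have "\<dots> = det_on S M"
    unfolding det_on_def
  proof (intro sum.cong refl arg_cong2[of _ _ _ _ "(*)"])
    fix \<pi> assume "\<pi> \<in> {\<pi>. \<pi> permutes S}"
    then have "\<And>x. x \<in> R - S \<Longrightarrow> M x (\<pi> x) = 1"
      by (simp add: id permutes_not_in)
    then show "(\<Prod>x\<in>R. M x (\<pi> x)) = (\<Prod>x\<in>S. M x (\<pi> x))"
      by (intro prod.mono_neutral_right) (auto simp: R S)
  qed
  finally show ?thesis .
qed

text \<open>Multilinearity in the rows: a function \<open>f\<close> picks one summand from each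
  row.\<close>

lemma det_on_expand_rows:
  assumes "finite R" "\<And>x. x \<in> R \<Longrightarrow> finite (N x)"
  shows "det_on R (\<lambda>x y. \<Sum>u\<in>N x. a x u * M x u y) =
    (\<Sum>f\<in>PiE R N. (\<Prod>x\<in>R. a x (f x)) * det_on R (\<lambda>x y. M x (f x) y))"
proof -
  have "det_on R (\<lambda>x y. \<Sum>u\<in>N x. a x u * M x u y) =
    (\<Sum>\<pi> | \<pi> permutes R. of_int (sign \<pi>) * (\<Sum>f\<in>PiE R N. \<Prod>x\<in>R. a x (f x) * M x (f x) (\<pi> x)))"
    unfolding det_on_def by (subst prod_sum_PiE) (auto simp: assms)
  also have "\<dots> = (\<Sum>f\<in>PiE R N. \<Sum>\<pi> | \<pi> permutes R.
      (\<Prod>x\<in>R. a x (f x)) * (of_int (sign \<pi>) * (\<Prod>x\<in>R. M x (f x) (\<pi> x))))"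
    unfolding sum_distrib_left by (subst sum.swap) (simp add: prod.distrib mult_ac)
  finally show ?thesis
    by (simp add: det_on_def sum_distrib_left)
qed

text \<open>Left multiplication by the identity matrix whose row \<open>z\<close> is replaced by the
  indicator of \<open>C\<close> keeps the determinant and turns row \<open>z\<close> into the
  vanishing sum.\<close>

lemma det_on_row_combination_zero:
  fixes M :: "'s \<Rightarrow> 's \<Rightarrow> 'r::comm_ring_1"
  assumes R: "finite R" and C: "C \<subseteq> R" "C \<noteq> {}"
    and 0: "\<And>y. y \<in> R \<Longrightarrow> (\<Sum>x\<in>C. M x y) = 0"
  shows "det_on R M = 0"
proof -
  obtain z where z: "z \<in> C" using C by blast
  define A :: "'s \<Rightarrow> 's \<Rightarrow> 'r" where "A = (\<lambda>x y. if x = z then of_bool (y \<in> C) else of_bool (x = y))"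
  have "det_on R A = det_on {z} A"
    using z C by (intro det_on_identity_rows R) (auto simp: A_def)
  then have A: "det_on R A = 1" using z by (simp add: A_def)
  have zero: "(\<Sum>u\<in>R. A z u * M u y) = 0" if "y \<in> R" for y
  proof -
    have "(\<Sum>u\<in>R. A z u * M u y) = (\<Sum>u\<in>C. M u y)"
      by (rule sum.mono_neutral_cong_right) (use R C in \<open>auto simp: A_def\<close>)
    then show ?thesis using 0 that by simp
  qed
  have "det_on R (\<lambda>x y. \<Sum>u\<in>R. A x u * M u y) = 0"
    unfolding det_on_def
  proof (intro sum.neutral ballI)
    fix \<pi> assume "\<pi> \<in> {\<pi>. \<pi> permutes R}"
    then have "\<pi> z \<in> R" using z C by (auto simp: permutes_in_image)
    then have "(\<Prod>x\<in>R. \<Sum>u\<in>R. A x u * M u (\<pi> x)) = 0"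
      using zero z C by (intro prod_zero R) auto
    then show "of_int (sign \<pi>) * (\<Prod>x\<in>R. \<Sum>u\<in>R. A x u * M u (\<pi> x)) = 0" by simp
  qed
  then show ?thesis using A det_on_mult[OF R, of A M] by simp
qed

lemma det_on_scale_rows:
  "det_on R (\<lambda>x y. a x * M x y) = (\<Prod>x\<in>R. a x) * det_on R M"
  by (simp add: det_on_def prod.distrib sum_distrib_left mult_ac)

text \<open>Conjugation by a diagonal matrix: along a permutation, numerators and denominators run
  over the same values of \<open>l\<close>.\<close>

lemma det_on_conjugate:
  fixes l :: "'s \<Rightarrow> 'r::field"
  assumes R: "finite R" and l: "\<And>x. x \<in> R \<Longrightarrow> l x \<noteq> 0"
  shows "det_on R (\<lambda>x y. l y / l x * M x y) = det_on R M"
  unfolding det_on_def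
proof (intro sum.cong refl arg_cong2[of _ _ _ _ "(*)"])
  fix \<pi> assume "\<pi> \<in> {\<pi>. \<pi> permutes R}"
  then have p: "\<pi> permutes R" by simp
  have "(\<Prod>x\<in>R. l (\<pi> x)) = (\<Prod>x\<in>R. l x)"
    using prod.reindex_bij_betw[OF permutes_imp_bij[OF p], of l] .
  moreover have "(\<Prod>x\<in>R. l x) \<noteq> 0" using R l by (simp add: prod_zero_iff)
  ultimately show "(\<Prod>x\<in>R. l (\<pi> x) / l x * M x (\<pi> x)) = (\<Prod>x\<in>R. M x (\<pi> x))"
    by (simp add: prod.distrib prod_dividef)
qed

lemma tendsto_det_on:
  fixes M :: "'t \<Rightarrow> 's \<Rightarrow> 's \<Rightarrow> real"
  assumes "\<And>x y. x \<in> R \<Longrightarrow> y \<in> R \<Longrightarrow> ((\<lambda>t. M t x y) \<longlongrightarrow> L x y) F"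
  shows "((\<lambda>t. det_on R (M t)) \<longlongrightarrow> det_on R L) F"
  unfolding det_on_def
  by (intro tendsto_sum tendsto_mult tendsto_const tendsto_prod) (auto simp: assms permutes_in_image)

section \<open>Functional graphs and the directed matrix tree theorem\<close>

definition fun_graph :: "'s set \<Rightarrow> ('s \<Rightarrow> 's) \<Rightarrow> ('s \<times> 's) set" where
  "fun_graph R f = (\<lambda>x. (x, f x)) ` R"

lemma in_fun_graph [simp]: "(x, y) \<in> fun_graph R f \<longleftrightarrow> x \<in> R \<and> y = f x"
  by (auto simp: fun_graph_def)

lemma finite_fun_graph [simp]: "finite R \<Longrightarrow> finite (fun_graph R f)"
  by (simp add: fun_graph_def)

text \<open>The matrix is the identity minus the adjacency matrix of \<open>f\<close>; targets
  outside \<open>R\<close> leave no entry. Without a cycle only the identity permutation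
  contributes, whereas the rows along a cycle add up to zero.\<close>

lemma det_on_fun_graph:
  fixes f :: "'s \<Rightarrow> 's"
  assumes R: "finite R"
  shows "det_on R (\<lambda>x y. of_bool (x = y) - of_bool (f x = y)) =
    (of_bool (acyclic (fun_graph R f)) :: 'r::comm_ring_1)"
proof (cases "acyclic (fun_graph R f)")
  case True
  have wf: "wf ((fun_graph R f)\<inverse>)"
    using R True by (intro finite_acyclic_wf_converse) auto
  have loop: "f x \<noteq> x" if "x \<in> R" for x
    using True that unfolding acyclic_def by (metis in_fun_graph r_into_trancl')
  have only_id: "(\<Prod>x\<in>R. of_bool (x = \<pi> x) - of_bool (f x = \<pi> x) :: 'r) = 0"
    if \<pi>: "\<pi> permutes R" "\<pi> \<noteq> id" for \<pi>
  proof (rule ccontr)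
    assume nz: "(\<Prod>x\<in>R. of_bool (x = \<pi> x) - of_bool (f x = \<pi> x) :: 'r) \<noteq> 0"
    have step: "\<pi> x = x \<or> \<pi> x = f x" if "x \<in> R" for x
    proof (rule ccontr)
      assume "\<not> ?thesis"
      then have "of_bool (x = \<pi> x) - of_bool (f x = \<pi> x) = (0 :: 'r)" by auto
      then have "(\<Prod>x\<in>R. of_bool (x = \<pi> x) - of_bool (f x = \<pi> x) :: 'r) = 0"
        using that by (intro prod_zero[OF R]) blast
      then show False using nz by contradiction
    qed
    \<comment> \<open>Induction along \<open>f\<close>: if \<open>\<pi>\<close> moves
      \<open>x\<close>, it moves it to \<open>f x\<close>, which is fixed by the induction
      hypothesis; injectivity then forces \<open>f x = x\<close>.\<close>
    have "x \<in> R \<Longrightarrow> \<pi> x = x" for x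
      using wf
    proof (induction x rule: wf_induct_rule)
      case (less x)
      show ?case
      proof (rule ccontr)
        assume ne: "\<pi> x \<noteq> x"
        then have fx: "\<pi> x = f x" using step less.prems by blast
        then have "f x \<in> R" using \<pi> less.prems by (metis permutes_in_image)
        then have "\<pi> (f x) = f x" using less by simp
        then have "\<pi> (f x) = \<pi> x" using fx by simp
        then have "f x = x" using permutes_inj[OF \<pi>(1)] by (rule injD[rotated])
        then show False using fx ne by simp
      qed
    qed
    then have "\<pi> x = x" for x using \<pi>(1) by (cases "x \<in> R") (auto simp: permutes_not_in)
    then show False using \<pi>(2) by auto
  qed
  have "det_on R (\<lambda>x y. of_bool (x = y) - of_bool (f x = y) :: 'r) =
    (\<Sum>\<pi>\<in>{id}. of_int (sign \<pi>) * (\<Prod>x\<in>R. of_bool (x = \<pi> x) - of_bool (f x = \<pi> x)))"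
    unfolding det_on_def
    by (rule sum.mono_neutral_right)
      (auto simp: finite_permutations R only_id permutes_id[unfolded id_def] id_def)
  also have "\<dots> = 1"
    using loop by (auto simp: sign_id intro!: prod.neutral)
  finally show ?thesis using True by simp
next
  case False
  define T where "T = fun_graph R f"
  obtain z where z: "(z, z) \<in> T\<^sup>+" using False unfolding acyclic_def T_def by blast
  have z_dom: "(z, z) \<in> T\<^sup>+ \<Longrightarrow> z \<in> R" for z
    by (metis T_def converse_tranclE in_fun_graph)
  \<comment> \<open>Out-degree one forces every path from \<open>z\<close> to stay on the cycle
    through \<open>z\<close>, hence to come back.\<close>
  have returns: "(y, z) \<in> T\<^sup>*" if "(z, y) \<in> T\<^sup>+" for y
    using that
  proof (induction rule: trancl_induct)
    case (base y)
    then have "y = f z" by (simp add: T_def)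
    moreover obtain w where "(z, w) \<in> T" "(w, z) \<in> T\<^sup>*" using z by (meson tranclD)
    ultimately show ?case by (simp add: T_def)
  next
    case (step y u)
    then obtain w where "(y, w) \<in> T" "(w, z) \<in> T\<^sup>*"
      using z by (metis converse_rtranclE tranclD)
    then show ?case using step by (simp add: T_def)
  qed
  \<comment> \<open>\<open>C\<close> is the cycle itself. Since \<open>f\<close> permutes it, the
    two sums over \<open>C\<close> cancel in every column.\<close>
  define C where "C = {y. (z, y) \<in> T\<^sup>+}"
  have CR: "C \<subseteq> R"
    using returns z_dom unfolding C_def by (metis mem_Collect_eq rtrancl_trancl_trancl subsetI trancl_rtrancl_trancl z)
  have zC: "z \<in> C" using z by (simp add: C_def)
  have fC: "f ` C = C"
  proof
    show "f ` C \<subseteq> C"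
    proof safe
      fix y assume y: "y \<in> C"
      then have "(y, f y) \<in> T" using CR by (auto simp: T_def)
      then show "f y \<in> C" using y unfolding C_def by (auto intro: trancl_into_trancl)
    qed
    show "C \<subseteq> f ` C"
    proof
      fix y assume "y \<in> C"
      then have "(z, y) \<in> T\<^sup>+" by (simp add: C_def)
      then obtain u where u: "(z, u) \<in> T\<^sup>*" "(u, y) \<in> T" by (metis tranclD2)
      then have "u \<in> C" using zC by (auto simp: C_def rtrancl_eq_or_trancl)
      then show "y \<in> f ` C" using u by (auto simp: T_def)
    qed
  qed
  have fin: "finite C" using CR R finite_subset by blast
  have inj: "inj_on f C" by (rule eq_card_imp_inj_on[OF fin]) (simp add: fC)
  have "(\<Sum>x\<in>C. of_bool (x = y) - of_bool (f x = y) :: 'r) = 0" for y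
  proof -
    have "(\<Sum>x\<in>C. of_bool (f x = y) :: 'r) = (\<Sum>x\<in>C. of_bool (x = y))"
      using sum.reindex[OF inj, of "\<lambda>x. of_bool (x = y) :: 'r"] by (simp add: fC)
    then show ?thesis by (simp add: sum_subtractf)
  qed
  then have "det_on R (\<lambda>x y. of_bool (x = y) - of_bool (f x = y)) = (0 :: 'r)"
    using zC by (intro det_on_row_combination_zero[OF R CR]) auto
  then show ?thesis using False by simp
qed

text \<open>Row \<open>x\<close> is a combination of rows belonging to single edges from
  \<open>x\<close> to \<open>u\<close>; after expansion each choice \<open>f\<close> contributes 1
  or 0 according to acyclicity. Targets \<open>u\<close> outside \<open>R\<close> act as roots,
  because no column \<open>y\<close> in \<open>R\<close> equals them.\<close>

theorem matrix_tree:
  fixes a :: "'s \<Rightarrow> 's \<Rightarrow> 'r::comm_ring_1"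
  assumes R: "finite R" and N: "\<And>x. x \<in> R \<Longrightarrow> finite (N x)"
  shows "(\<Sum>f | f \<in> PiE R N \<and> acyclic (fun_graph R f). \<Prod>x\<in>R. a x (f x)) =
    det_on R (\<lambda>x y. \<Sum>u\<in>N x. a x u * (of_bool (x = y) - of_bool (u = y)))"
proof -
  have "det_on R (\<lambda>x y. \<Sum>u\<in>N x. a x u * (of_bool (x = y) - of_bool (u = y))) =
    (\<Sum>f\<in>PiE R N. (\<Prod>x\<in>R. a x (f x)) * of_bool (acyclic (fun_graph R f)))"
    by (simp add: det_on_expand_rows[OF R N] det_on_fun_graph[OF R])
  also have "\<dots> = (\<Sum>f | f \<in> PiE R N \<and> acyclic (fun_graph R f). \<Prod>x\<in>R. a x (f x))"
    by (rule sum.mono_neutral_cong_right) (auto intro!: finite_PiE R N)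
  finally show ?thesis ..
qed

definition killed_matrix :: "('s \<Rightarrow> 's \<Rightarrow> real) \<Rightarrow> 's \<Rightarrow> 's \<Rightarrow> real" where
  "killed_matrix p x y = of_bool (x = y) - p x y"

abbreviation walk_det :: "('s \<Rightarrow> 's \<Rightarrow> real) \<Rightarrow> 's set \<Rightarrow> real" where
  "walk_det p R \<equiv> det_on R (killed_matrix p)"

lemma det_on_identity: "finite R \<Longrightarrow> det_on R (\<lambda>x y. of_bool (x = y)) = 1"
  by (subst det_on_identity_rows[where S = "{}"]) auto

lemma det_on_resolvent:
  assumes R: "finite R"
    and GM: "\<And>x y. x \<in> R \<Longrightarrow> y \<in> R \<Longrightarrow> (\<Sum>z\<in>R. G x z * killed_matrix p z y) = of_bool (x = y)"
  shows "det_on R G * walk_det p R = 1"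
proof -
  have "det_on R (\<lambda>x y. \<Sum>z\<in>R. G x z * killed_matrix p z y) = det_on R (\<lambda>x y. of_bool (x = y))"
    by (intro det_on_cong) (simp add: GM)
  then show ?thesis by (simp only: det_on_mult[OF R] det_on_identity[OF R])
qed

text \<open>Cramer's rule for a diagonal entry. \<open>A\<close> is the identity with row
  \<open>x\<close> taken from \<open>G\<close>: its determinant is \<open>G x x\<close>, and its
  product with the killed matrix has a unit vector as row \<open>x\<close>.\<close>

lemma resolvent_diagonal:
  assumes R: "finite R" and x: "x \<in> R"
    and GM: "\<And>x y. x \<in> R \<Longrightarrow> y \<in> R \<Longrightarrow> (\<Sum>z\<in>R. G x z * killed_matrix p z y) = of_bool (x = y)"
  shows "G x x * walk_det p R = walk_det p (R - {x})"
proof -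
  define A where "A = (\<lambda>u v. if u = x then G x v else of_bool (u = v))"
  have "det_on R A = det_on {x} A"
    using x by (intro det_on_identity_rows R) (auto simp: A_def)
  then have detA: "det_on R A = G x x" by (simp add: A_def)
  define B where "B = (\<lambda>u v. \<Sum>z\<in>R. A u z * killed_matrix p z v)"
  have "B u v = (if u = x then of_bool (x = v) else killed_matrix p u v)" if "u \<in> R" "v \<in> R" for u v
  proof (cases "u = x")
    case True then show ?thesis using GM[OF x that(2)] by (simp add: A_def B_def)
  next
    case False
    then have "B u v = (\<Sum>z\<in>R. if u = z then killed_matrix p z v else 0)"
      unfolding B_def A_def by (intro sum.cong refl) auto
    then show ?thesis using False that R by simp
  qed
  note B = this
  have "det_on R B = det_on (R - {x}) B"
    using x by (intro det_on_identity_rows R) (auto simp: B)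
  also have "\<dots> = walk_det p (R - {x})"
    by (intro det_on_cong) (auto simp: B)
  finally show ?thesis using det_on_mult[OF R, of A "killed_matrix p"] by (simp add: B_def detA)
qed

section \<open>Words, their weights, and the law of the walk on cylinder events\<close>

definition word_weight :: "('s \<Rightarrow> 's \<Rightarrow> real) \<Rightarrow> 's list \<Rightarrow> real" where
  "word_weight p l = (\<Prod>i<length l - 1. p (l ! i) (l ! Suc i))"

abbreviation word_mass :: "('s \<Rightarrow> 's \<Rightarrow> real) \<Rightarrow> 's list set \<Rightarrow> ennreal" where
  "word_mass p L \<equiv> \<integral>\<^sup>+l. ennreal (word_weight p l) \<partial>count_space L"

lemma word_weight_simps [simp]:
  "word_weight p [] = 1" "word_weight p [x] = 1"
  "word_weight p (x # y # l) = p x y * word_weight p (y # l)"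
  by (simp_all add: word_weight_def prod.lessThan_Suc_shift del: prod.lessThan_Suc)

lemma word_weight_append:
  assumes "l' \<noteq> []"
  shows "l \<noteq> [] \<Longrightarrow> word_weight p (l @ l') = word_weight p l * p (last l) (hd l') * word_weight p l'"
proof (induction l)
  case (Cons x l)
  then show ?case using assms by (cases l; cases l') (auto simp: mult_ac)
qed simp

lemma word_weight_nonneg:
  assumes "\<And>x y. x \<in> W \<Longrightarrow> y \<in> W \<Longrightarrow> p x y \<ge> 0" "set l \<subseteq> W"
  shows "word_weight p l \<ge> 0"
  unfolding word_weight_def
  by (intro prod_nonneg ballI assms(1) subsetD[OF assms(2)] nth_mem) auto

definition has_prefix :: "(nat \<Rightarrow> 's) \<Rightarrow> 's list \<Rightarrow> bool" where
  "has_prefix S l \<longleftrightarrow> map S [0..<length l] = l"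

lemma has_prefix_iff: "has_prefix S l \<longleftrightarrow> (\<forall>i<length l. S i = l ! i)"
  unfolding has_prefix_def by (subst list_eq_iff_nth_eq) simp

lemma has_prefix_same_length: "has_prefix S l \<Longrightarrow> has_prefix S l' \<Longrightarrow> length l = length l' \<Longrightarrow> l = l'"
  unfolding has_prefix_def by metis

text \<open>Killing is a transition to a state of \<open>W\<close>, so rows sum to 1 and mass is
  lost only by restriction to a smaller set of states. Finite support of the rows is what
  \<open>matrix_tree\<close> requires.\<close>

locale markov_kernel =
  fixes W :: "'s set" and p :: "'s \<Rightarrow> 's \<Rightarrow> real"
  assumes countable_W: "countable W"
    and p_nonneg: "\<And>s t. s \<in> W \<Longrightarrow> t \<in> W \<Longrightarrow> p s t \<ge> 0"
    and p_finite: "\<And>s. s \<in> W \<Longrightarrow> finite {t \<in> W. p s t \<noteq> 0}"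
    and p_sum: "\<And>s. s \<in> W \<Longrightarrow> (\<Sum>t | t \<in> W \<and> p s t \<noteq> 0. p s t) = 1"
begin

abbreviation walk :: "'s \<Rightarrow> (nat \<Rightarrow> 's) measure" where
  "walk s \<equiv> walk_law W p s"

abbreviation cylinder :: "'s \<Rightarrow> 's list \<Rightarrow> (nat \<Rightarrow> 's) set" where
  "cylinder s l \<equiv> {S \<in> space (walk s). has_prefix S l}"

abbreviation cylinders :: "'s \<Rightarrow> 's list set \<Rightarrow> (nat \<Rightarrow> 's) set" where
  "cylinders s L \<equiv> {S \<in> space (walk s). \<exists>l\<in>L. has_prefix S l}"

abbreviation stays :: "'s \<Rightarrow> nat \<Rightarrow> 's \<Rightarrow> 's set \<Rightarrow> (nat \<Rightarrow> 's) set" where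
  "stays x n y R \<equiv> {S \<in> space (walk x). S n = y \<and> (\<forall>i\<le>n. S i \<in> R)}"

text \<open>Meant for a self-avoiding path \<open>g\<close> that follows \<open>f\<close>; its steps
  can then be indexed by their sources.\<close>

abbreviation path_weight :: "('s \<Rightarrow> 's) \<Rightarrow> 's list \<Rightarrow> real" where
  "path_weight f g \<equiv> \<Prod>t\<in>set (butlast g). p t (f t)"

lemma nn_integral_p: "s \<in> W \<Longrightarrow> (\<integral>\<^sup>+t. ennreal (p s t) \<partial>count_space W) = 1"
  by (subst nn_integral_count_space'[OF p_finite[of s]], assumption)
    (use p_sum[of s] in \<open>auto simp: p_nonneg intro!: trans[OF sum_ennreal]\<close>)

lemma space_walk: "space (walk s) = (\<Pi>\<^sub>E n\<in>UNIV. W)"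
  by (simp add: walk_law_def space_PiM)

lemma sets_walk [measurable_cong]: "sets (walk s) = sets (\<Pi>\<^sub>M n\<in>UNIV. count_space W)"
  by (simp add: walk_law_def)

lemma in_space_walk: "S \<in> space (walk s) \<Longrightarrow> S n \<in> W"
  by (auto simp: space_walk PiE_iff)

lemma set_prefix_subset: "S \<in> space (walk s) \<Longrightarrow> set (map S [0..<n]) \<subseteq> W"
  by (auto simp: in_space_walk)

lemma measurable_step [measurable]: "(\<lambda>S. S n) \<in> measurable (walk s) (count_space W)"
  unfolding measurable_cong_sets[OF sets_walk refl]
  by (rule measurable_component_singleton) simp

lemma step_event [measurable]: "{S \<in> space (walk s). S n = t} \<in> sets (walk s)"
proof (cases "t \<in> W")
  case True
  have "(\<lambda>S. S n) -` {t} \<inter> space (walk s) \<in> sets (walk s)"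
    using True by (intro measurable_sets[OF measurable_step]) simp
  then show ?thesis by (simp add: vimage_def Collect_conj_eq Int_commute)
next
  case False
  then have "{S \<in> space (walk s). S n = t} = {}" using in_space_walk by blast
  then show ?thesis by (simp only: sets.empty_sets)
qed

lemma prefix_event [measurable]: "cylinder s l \<in> sets (walk s)"
proof -
  have "cylinder s l = {S \<in> space (walk s). \<forall>i\<in>{..<length l}. S i = l ! i}"
    by (auto simp: has_prefix_iff)
  also have "\<dots> \<in> sets (walk s)"
    by (intro sets.sets_Collect_finite_All step_event finite_lessThan)
  finally show ?thesis .
qed

lemma emeasure_prefix:
  assumes "s \<in> W" "set l \<subseteq> W" "l \<noteq> []" "hd l = s"
  shows "emeasure (walk s) (cylinder s l) = ennreal (word_weight p l)"
proof -
  define xs where "xs = (\<lambda>i. if i < length l then l ! i else s)"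
  have xs: "xs 0 = s" "\<And>i. xs i \<in> W"
    using assms by (auto simp: xs_def hd_conv_nth dest!: nth_mem)
  have "cylinder s l = {S \<in> space (walk s). \<forall>i\<le>length l - 1. S i = xs i}"
    using assms(3) by (auto simp: has_prefix_iff xs_def less_Suc_eq_le[symmetric])
  then have "emeasure (walk s) (cylinder s l)
      = (\<Prod>i<length l - 1. ennreal (p (xs i) (xs (Suc i))))"
    using walk_law_cylinder[where W = W and p = p and s = s and xs = xs and n = "length l - 1", OF countable_W assms(1) p_nonneg nn_integral_p xs] by simp
  also have "\<dots> = ennreal (\<Prod>i<length l - 1. p (xs i) (xs (Suc i)))"
    by (intro prod_ennreal p_nonneg xs)
  also have "\<dots> = ennreal (word_weight p l)"
    unfolding word_weight_def xs_def by (intro arg_cong[of _ _ ennreal] prod.cong) auto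
  finally show ?thesis .
qed

text \<open>The condition \<open>disj\<close> makes \<open>L\<close> a prefix-free code, so its
  cylinders are disjoint; since \<open>W\<close> is countable, there are countably many of
  them.\<close>

lemma emeasure_words:
  assumes "s \<in> W" and L: "L \<subseteq> lists W" "\<And>l. l \<in> L \<Longrightarrow> l \<noteq> [] \<and> hd l = s"
    and disj: "\<And>S l l'. l \<in> L \<Longrightarrow> l' \<in> L \<Longrightarrow> has_prefix S l \<Longrightarrow> has_prefix S l' \<Longrightarrow> l = l'"
  shows "cylinders s L \<in> sets (walk s)"
    and "emeasure (walk s) (cylinders s L) =
      word_mass p L"
proof -
  have cL: "countable L"
    using L(1) countable_W by (meson countable_lists countable_subset)
  have eq: "cylinders s L = (\<Union>l\<in>L. cylinder s l)"
    by auto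
  show "cylinders s L \<in> sets (walk s)"
    unfolding eq by (intro sets.countable_UN'' cL prefix_event)
  have "emeasure (walk s) (\<Union>l\<in>L. cylinder s l) =
    (\<integral>\<^sup>+l. emeasure (walk s) (cylinder s l) \<partial>count_space L)"
    by (rule emeasure_UN_countable[OF prefix_event cL]) (auto simp: disjoint_family_on_def dest: disj)
  also have "\<dots> = word_mass p L"
    using assms by (intro nn_integral_cong emeasure_prefix) auto
  finally show "emeasure (walk s) (cylinders s L) =
      word_mass p L"
    by (simp only: eq)
qed

lemma prob_space_walk: assumes s: "s \<in> W" shows "prob_space (walk s)"
proof -
  let ?P = "\<Pi>\<^sub>M (n::nat, t)\<in>UNIV \<times> W. point_measure W (\<lambda>u. ennreal (p t u))"
  have "prob_space (point_measure W (\<lambda>u. ennreal (p t u)))" if "t \<in> W" for t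
    using that by (intro prob_spaceI) (simp add: space_point_measure point_measure_def emeasure_density
      nn_integral_p indicator_eq_1_iff cong: nn_integral_cong_simp)
  then interpret P: prob_space ?P by (intro prob_space_PiM) auto
  \<comment> \<open>This bound holds for \<open>distr\<close> without any measurability of the map;
    the reverse bound comes from the one-letter cylinder.\<close>
  have "emeasure (walk s) A \<le> 1" for A
    unfolding walk_law_def distr_def emeasure_measure_of_conv by (auto intro: P.emeasure_le_1)
  moreover have "emeasure (walk s) (space (walk s)) \<ge> emeasure (walk s) (cylinder s [s])"
    by (rule emeasure_space)
  ultimately show ?thesis
    using emeasure_prefix[of s "[s]"] s by (intro prob_spaceI antisym) auto
qed

lemma AE_walk_start: assumes s: "s \<in> W" shows "AE S in walk s. S 0 = s"
proof -
  interpret prob_space "walk s" by (rule prob_space_walk[OF s])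
  have "emeasure (walk s) (cylinder s [s]) = 1"
    using emeasure_prefix[of s "[s]"] s by simp
  then have "prob (cylinder s [s]) = 1"
    by (simp add: measure_def)
  from AE_prob_1[OF this] show ?thesis by (auto simp: has_prefix_iff)
qed

text \<open>Words of one length are never proper prefixes of each other, so
  \<open>emeasure_words\<close> applies. Words that do not start at \<open>s\<close> belong to a
  null event and drop out.\<close>

lemma emeasure_prefix_in:
  assumes s: "s \<in> W" and L: "\<And>l. l \<in> L \<Longrightarrow> length l = Suc n"
  shows "{S \<in> space (walk s). map S [0..<Suc n] \<in> L} \<in> sets (walk s)"
    and "emeasure (walk s) {S \<in> space (walk s). map S [0..<Suc n] \<in> L} =
      word_mass p {l \<in> L. set l \<subseteq> W \<and> hd l = s}"
proof -
  have "{S \<in> space (walk s). map S [0..<Suc n] \<in> L} =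
    (\<Union>l\<in>{l\<in>L. set l \<subseteq> W}. cylinder s l)"
    using set_prefix_subset[of _ s "Suc n"] L by (auto simp: has_prefix_def simp del: upt_Suc)
  moreover have "countable {l\<in>L. set l \<subseteq> W}"
    by (rule countable_subset[OF _ countable_lists[OF countable_W]]) auto
  ultimately show m: "{S \<in> space (walk s). map S [0..<Suc n] \<in> L} \<in> sets (walk s)"
    using prefix_event by (metis (no_types, lifting) sets.countable_UN'')
  let ?L = "{l \<in> L. set l \<subseteq> W \<and> hd l = s}"
  have *: "emeasure (walk s) (cylinders s ?L) =
      word_mass p ?L"
    "cylinders s ?L \<in> sets (walk s)"
  proof -
    have len: "l \<noteq> [] \<and> hd l = s" if "l \<in> ?L" for l
      using that L by force
    have uniq: "l = l'" if "l \<in> ?L" "l' \<in> ?L" "has_prefix S l" "has_prefix S l'" for S l l'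
      using that L by (metis (no_types, lifting) has_prefix_same_length mem_Collect_eq)
    have sub: "?L \<subseteq> lists W" by auto
    show "emeasure (walk s) (cylinders s ?L) =
        word_mass p ?L"
      "cylinders s ?L \<in> sets (walk s)"
      by (rule emeasure_words[OF s sub len uniq]; assumption)+
  qed
  have "emeasure (walk s) {S \<in> space (walk s). map S [0..<Suc n] \<in> L} =
      emeasure (walk s) (cylinders s ?L)"
  proof (rule emeasure_eq_AE[OF _ m *(2)])
    show "AE S in walk s. (S \<in> {S \<in> space (walk s). map S [0..<Suc n] \<in> L}) =
       (S \<in> cylinders s ?L)"
      using AE_walk_start[OF s] AE_space
    proof eventually_elim
      case (elim S)
      have "hd (map S [0..<Suc n]) = s" using elim by (simp add: hd_map del: upt_Suc)
      moreover have "set (map S [0..<Suc n]) \<subseteq> W" using elim by (intro set_prefix_subset)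
      ultimately show ?case using L elim by (auto simp: has_prefix_def simp del: upt_Suc)
    qed
  qed
  then show "emeasure (walk s) {S \<in> space (walk s). map S [0..<Suc n] \<in> L} =
      word_mass p ?L"
    using * by simp
qed

text \<open>For a fixed time, all prefixes that end with a forbidden step have weight zero.\<close>

lemma AE_walk_positive:
  assumes s: "s \<in> W"
  shows "AE S in walk s. \<forall>n. p (S n) (S (Suc n)) > 0"
  unfolding AE_all_countable
proof
  fix n
  define L where "L = {l. length l = Suc (Suc n) \<and> p (l ! n) (l ! Suc n) = 0}"
  have 0: "word_weight p l = 0" if "l \<in> L" for l
    using that unfolding word_weight_def L_def by (intro prod_zero) auto
  have "emeasure (walk s) {S \<in> space (walk s). map S [0..<Suc (Suc n)] \<in> L} = 0"
    by (subst emeasure_prefix_in(2)[OF s]) (auto simp: 0 L_def nn_integral_0_iff_AE)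
  then have "AE S in walk s. map S [0..<Suc (Suc n)] \<notin> L"
    using emeasure_prefix_in(1)[OF s, of L "Suc n"] by (intro AE_I'[of "{S \<in> space (walk s). map S [0..<Suc (Suc n)] \<in> L}"]) (auto simp: null_sets_def L_def)
  then show "AE S in walk s. p (S n) (S (Suc n)) > 0"
    using AE_space
  proof eventually_elim
    case (elim S)
    then have "p (S n) (S (Suc n)) \<noteq> 0" by (auto simp: L_def nth_append simp del: upt_Suc)
    then show ?case using p_nonneg[of "S n" "S (Suc n)"] in_space_walk[OF elim(2)] by auto
  qed
qed

end

section \<open>Words and Green functions\<close>

definition words :: "'s set \<Rightarrow> nat \<Rightarrow> 's \<Rightarrow> 's \<Rightarrow> 's list set" where
  "words R n x y = {l. length l = Suc n \<and> set l \<subseteq> R \<and> hd l = x \<and> last l = y}"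

lemma finite_words [simp]: "finite R \<Longrightarrow> finite (words R n x y)"
  by (rule finite_subset[OF _ finite_lists_length_eq[of R "Suc n"]]) (auto simp: words_def)

text \<open>For \<open>x\<close> and \<open>y\<close> in a finite set \<open>R\<close>, this is an
  entry of the \<open>n\<close>-th power of the transition matrix cut down to
  \<open>R\<close>.\<close>

definition restricted_prob :: "('s \<Rightarrow> 's \<Rightarrow> real) \<Rightarrow> 's set \<Rightarrow> nat \<Rightarrow> 's \<Rightarrow> 's \<Rightarrow> real" where
  "restricted_prob p R n x y = (\<Sum>l\<in>words R n x y. word_weight p l)"

definition green :: "('s \<Rightarrow> 's \<Rightarrow> real) \<Rightarrow> 's set \<Rightarrow> 's \<Rightarrow> 's \<Rightarrow> real" where
  "green p R x y = (\<Sum>n. restricted_prob p R n x y)"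

lemma words_0: "x \<in> R \<Longrightarrow> words R 0 x y = (if x = y then {[x]} else {})"
  by (auto simp: words_def length_Suc_conv)

lemma restricted_prob_0: "x \<in> R \<Longrightarrow> restricted_prob p R 0 x y = of_bool (x = y)"
  by (simp add: restricted_prob_def words_0)

lemma restricted_prob_Suc:
  assumes R: "finite R" and x: "x \<in> R"
  shows "restricted_prob p R (Suc n) x y = (\<Sum>z\<in>R. p x z * restricted_prob p R n z y)"
proof -
  have w: "p x (hd l) * word_weight p l = word_weight p (x # l)" if "length l = Suc n" for l
    using that by (cases l) auto
  have "(\<Sum>z\<in>R. p x z * restricted_prob p R n z y) = (\<Sum>(z, l)\<in>Sigma R (\<lambda>z. words R n z y). p x z * word_weight p l)"
    by (simp add: restricted_prob_def sum_distrib_left sum.Sigma R)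
  also have "\<dots> = (\<Sum>zl\<in>Sigma R (\<lambda>z. words R n z y). word_weight p (case zl of (z, l) \<Rightarrow> x # l))"
    by (intro sum.cong refl) (auto simp: words_def w)
  also have "\<dots> = restricted_prob p R (Suc n) x y"
    unfolding restricted_prob_def
  proof (rule sum.reindex_bij_betw)
    show "bij_betw (\<lambda>(z, l). x # l) (Sigma R (\<lambda>z. words R n z y)) (words R (Suc n) x y)"
      by (rule bij_betw_byWitness[where f' = "\<lambda>l. (hd (tl l), tl l)"])
        (use x in \<open>auto simp: words_def length_Suc_conv\<close>)
  qed
  finally show ?thesis ..
qed

text \<open>Decomposition at the last step, derived by induction from the decomposition at the first
  one.\<close>

lemma restricted_prob_Suc':
  assumes R: "finite R" and x: "x \<in> R" and y: "y \<in> R"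
  shows "restricted_prob p R (Suc n) x y = (\<Sum>z\<in>R. restricted_prob p R n x z * p z y)"
  using x
proof (induction n arbitrary: x)
  case 0
  have "(\<Sum>z\<in>R. p x z * restricted_prob p R 0 z y) = (\<Sum>z\<in>R. if z = y then p x z else 0)"
    by (intro sum.cong) (auto simp: restricted_prob_0)
  moreover have "(\<Sum>z\<in>R. restricted_prob p R 0 x z * p z y) = (\<Sum>z\<in>R. if x = z then p z y else 0)"
    using 0 by (intro sum.cong) (auto simp: restricted_prob_0)
  ultimately show ?case using 0 y by (simp add: restricted_prob_Suc R)
next
  case (Suc n)
  have "restricted_prob p R (Suc (Suc n)) x y = (\<Sum>u\<in>R. p x u * (\<Sum>z\<in>R. restricted_prob p R n u z * p z y))"
    using Suc by (subst restricted_prob_Suc) (auto simp: R)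
  also have "\<dots> = (\<Sum>z\<in>R. (\<Sum>u\<in>R. p x u * restricted_prob p R n u z) * p z y)"
    unfolding sum_distrib_left sum_distrib_right by (subst sum.swap) (simp add: mult_ac)
  finally show ?case using Suc by (simp add: restricted_prob_Suc R)
qed

lemma green_equation_left:
  assumes R: "finite R" and x: "x \<in> R" and y: "y \<in> R"
    and s: "\<And>x y. x \<in> R \<Longrightarrow> y \<in> R \<Longrightarrow> summable (\<lambda>n. restricted_prob p R n x y)"
  shows "(\<Sum>z\<in>R. green p R x z * killed_matrix p z y) = of_bool (x = y)"
proof -
  have "(\<Sum>z\<in>R. green p R x z * p z y) = (\<Sum>n. \<Sum>z\<in>R. restricted_prob p R n x z * p z y)"
    unfolding green_def using s[OF x] by (subst suminf_sum) (auto intro!: summable_mult2 simp: suminf_mult2)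
  also have "\<dots> = (\<Sum>n. restricted_prob p R (Suc n) x y)"
    by (simp add: restricted_prob_Suc'[OF R x y])
  also have "\<dots> = green p R x y - of_bool (x = y)"
    unfolding green_def by (subst suminf_split_head[OF s[OF x y]]) (simp add: restricted_prob_0 x)
  finally have *: "(\<Sum>z\<in>R. green p R x z * p z y) = green p R x y - of_bool (x = y)" .
  have "(\<Sum>z\<in>R. green p R x z * killed_matrix p z y) =
    (\<Sum>z\<in>R. if z = y then green p R x z else 0) - (\<Sum>z\<in>R. green p R x z * p z y)"
    unfolding sum_subtractf[symmetric] killed_matrix_def by (intro sum.cong) (auto simp: algebra_simps)
  then show ?thesis using R y * by simp
qed

text \<open>Both one-sided identities are used: the left one for determinants of the killed matrix,
  this one when a matrix with forced rows is multiplied by the Green function from the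
  right.\<close>

lemma green_equation_right:
  assumes R: "finite R" and x: "x \<in> R" and y: "y \<in> R"
    and s: "\<And>x y. x \<in> R \<Longrightarrow> y \<in> R \<Longrightarrow> summable (\<lambda>n. restricted_prob p R n x y)"
  shows "(\<Sum>z\<in>R. p x z * green p R z y) = green p R x y - of_bool (x = y)"
proof -
  have "(\<Sum>z\<in>R. p x z * green p R z y) = (\<Sum>n. \<Sum>z\<in>R. p x z * restricted_prob p R n z y)"
    unfolding green_def using s[OF _ y] by (subst suminf_sum) (auto intro!: summable_mult simp: suminf_mult)
  also have "\<dots> = (\<Sum>n. restricted_prob p R (Suc n) x y)"
    by (simp add: restricted_prob_Suc[OF R x])
  also have "\<dots> = green p R x y - of_bool (x = y)"
    unfolding green_def by (subst suminf_split_head[OF s[OF x y]]) (simp add: restricted_prob_0 x)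
  finally show ?thesis .
qed

section \<open>Green functions of the walk: comparison, limits and summability\<close>

context markov_kernel begin

abbreviation hit_prob :: "'s \<Rightarrow> nat \<Rightarrow> 's \<Rightarrow> real" where
  "hit_prob x n y \<equiv> measure (walk x) {S \<in> space (walk x). S n = y}"

lemma word_weight_nonneg': "set l \<subseteq> W \<Longrightarrow> word_weight p l \<ge> 0"
  using word_weight_nonneg[of W p l] p_nonneg by blast

lemma restricted_prob_nonneg: "R \<subseteq> W \<Longrightarrow> restricted_prob p R n x y \<ge> 0"
  unfolding restricted_prob_def words_def by (intro sum_nonneg word_weight_nonneg') auto

lemma restricted_event [measurable]:
  "stays x n y R \<in> sets (walk x)"
proof -
  have [measurable]: "{S \<in> space (walk x). S i \<in> R} \<in> sets (walk x)" for i
  proof -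
    have "(\<lambda>S. S i) -` (R \<inter> W) \<inter> space (walk x) \<in> sets (walk x)"
      by (intro measurable_sets[OF measurable_step]) simp
    moreover have "(\<lambda>S. S i) -` (R \<inter> W) \<inter> space (walk x) = {S \<in> space (walk x). S i \<in> R}"
      using in_space_walk by blast
    ultimately show ?thesis by simp
  qed
  show ?thesis by (intro sets.sets_Collect_conj step_event sets.sets_Collect_countable_All sets.sets_Collect_imp) auto
qed

lemma restricted_prob_eq_measure:
  assumes R: "finite R" "R \<subseteq> W" and x: "x \<in> R"
  shows "measure (walk x) (stays x n y R) = restricted_prob p R n x y"
proof -
  define L where "L = {l. length l = Suc n \<and> set l \<subseteq> R \<and> last l = y}"
  have "stays x n y R = {S \<in> space (walk x). map S [0..<Suc n] \<in> L}"
    by (auto simp: L_def less_Suc_eq_le[symmetric] simp del: upt_Suc) (auto simp: last_map)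
  moreover have "{l \<in> L. set l \<subseteq> W \<and> hd l = x} = words R n x y"
    using R by (auto simp: L_def words_def)
  ultimately have "emeasure (walk x) (stays x n y R) =
    word_mass p (words R n x y)"
    using emeasure_prefix_in(2)[of x L n] x R by (auto simp: L_def)
  also have "\<dots> = ennreal (restricted_prob p R n x y)"
    unfolding restricted_prob_def nn_integral_count_space_finite[OF finite_words[OF R(1)]]
    using R by (intro sum_ennreal word_weight_nonneg') (auto simp: words_def)
  finally show ?thesis
    using restricted_prob_nonneg[OF R(2)] by (simp add: measure_def)
qed

lemma restricted_prob_le_hit_prob:
  assumes R: "finite R" "R \<subseteq> W" and x: "x \<in> R"
  shows "restricted_prob p R n x y \<le> hit_prob x n y"
proof -
  interpret prob_space "walk x" using prob_space_walk x R by blast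
  show ?thesis unfolding restricted_prob_eq_measure[OF R x, symmetric]
    by (intro finite_measure_mono step_event) auto
qed

lemma summable_restricted_prob:
  assumes R: "finite R" "R \<subseteq> W" and x: "x \<in> R" and s: "summable (\<lambda>n. hit_prob x n y)"
  shows "summable (\<lambda>n. restricted_prob p R n x y)"
  by (rule summable_comparison_test'[OF s, of 0])
    (simp add: restricted_prob_nonneg R restricted_prob_le_hit_prob[OF R x] abs_of_nonneg)

lemma green_nonneg:
  assumes R: "finite R" "R \<subseteq> W" and x: "x \<in> R" and s: "summable (\<lambda>n. hit_prob x n y)"
  shows "green p R x y \<ge> 0"
  unfolding green_def
  by (intro suminf_nonneg summable_restricted_prob assms restricted_prob_nonneg)

lemma nn_integral_loops:
  assumes R: "finite R" "R \<subseteq> W" and x: "x \<in> R" and s: "summable (\<lambda>n. hit_prob x n x)"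
  shows "word_mass p (\<Union>n. words R n x x) = ennreal (green p R x x)"
proof -
  have d: "disjoint_family (\<lambda>n. words R n x x)"
    by (auto simp: disjoint_family_on_def words_def)
  have "word_mass p (\<Union>n. words R n x x) =
    (\<integral>\<^sup>+l\<in>(\<Union>n. words R n x x). ennreal (word_weight p l) \<partial>count_space UNIV)"
    by (rule nn_integral_count_space_indicator) simp
  also have "\<dots> = (\<Sum>n. \<integral>\<^sup>+l\<in>words R n x x. ennreal (word_weight p l) \<partial>count_space UNIV)"
    by (rule nn_integral_disjoint_family[OF _ _ d]) auto
  also have "\<dots> = (\<Sum>n. \<integral>\<^sup>+l. ennreal (word_weight p l) \<partial>count_space (words R n x x))"
    by (simp add: nn_integral_count_space_indicator)
  also have "\<dots> = (\<Sum>n. ennreal (restricted_prob p R n x x))"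
    unfolding restricted_prob_def nn_integral_count_space_finite[OF finite_words[OF R(1)]]
    using R by (intro arg_cong[of _ _ suminf] ext sum_ennreal word_weight_nonneg') (auto simp: words_def)
  also have "\<dots> = ennreal (green p R x x)"
    unfolding green_def
    by (intro suminf_ennreal2 restricted_prob_nonneg summable_restricted_prob assms)
  finally show ?thesis .
qed

text \<open>For each \<open>n\<close> the events of staying in \<open>D k\<close> increase, and by
  \<open>ex\<close> they exhaust the visits to \<open>y\<close> up to a null set. Tannery's theorem,
  with the unrestricted probabilities as majorant, exchanges limit and sum.\<close>

lemma tendsto_green:
  assumes D: "\<And>k. finite (D k)" "\<And>k. D k \<subseteq> W" "incseq D" and x: "x \<in> W" "\<And>k. k \<ge> k0 \<Longrightarrow> x \<in> D k"
    and s: "summable (\<lambda>n. hit_prob x n y)"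
    and ex: "AE S in walk x. \<forall>n. S n = y \<longrightarrow> (\<forall>i\<le>n. S i \<in> (\<Union>k. D k))"
  shows "(\<lambda>k. green p (D k) x y) \<longlonglongrightarrow> (\<Sum>n. hit_prob x n y)"
proof -
  interpret prob_space "walk x" using prob_space_walk x by blast
  define A where "A = (\<lambda>n k. stays x n y (D k))"
  have inc: "incseq (A n)" for n
    using \<open>incseq D\<close> unfolding A_def incseq_def by blast
  have UA: "(\<Union>k. A n k) = {S \<in> space (walk x). S n = y \<and> (\<forall>i\<le>n. S i \<in> (\<Union>k. D k))}" for n
  proof safe
    fix S assume S: "S \<in> space (walk x)" "\<forall>i\<le>n. S i \<in> (\<Union>k. D k)" "y = S n"
    then have "\<forall>i\<in>{..n}. \<exists>k. S i \<in> D k" by auto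
    then obtain f where f: "\<forall>i\<in>{..n}. S i \<in> D (f i)" by metis
    have "S i \<in> D (Max (f ` {..n}))" if "i \<le> n" for i
    proof -
      have "f i \<le> Max (f ` {..n})" using that by (intro Max_ge) auto
      then show ?thesis using f that \<open>incseq D\<close> unfolding incseq_def by blast
    qed
    then show "S \<in> (\<Union>k. A (n) k)" using S unfolding A_def by auto
  qed (auto simp: A_def)
  have lim: "(\<lambda>k. measure (walk x) (A n k)) \<longlonglongrightarrow> hit_prob x n y" for n
  proof -
    have "(\<lambda>k. measure (walk x) (A n k)) \<longlonglongrightarrow> measure (walk x) (\<Union>k. A n k)"
    proof (rule finite_Lim_measure_incseq[OF _ inc], safe)
      show "A n k \<in> sets (walk x)" for k unfolding A_def by (rule restricted_event)
    qed
    moreover have "measure (walk x) (\<Union>k. A n k) = hit_prob x n y"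
      unfolding UA
    proof (rule finite_measure_eq_AE)
      show "AE S in walk x. (S \<in> {S \<in> space (walk x). S n = y \<and> (\<forall>i\<le>n. S i \<in> \<Union> (range D))}) =
        (S \<in> {S \<in> space (walk x). S n = y})"
        using ex by eventually_elim blast
    qed (use restricted_event step_event in blast)+
    ultimately show ?thesis by simp
  qed
  have "\<forall>\<^sub>F (n, k) in at_top \<times>\<^sub>F sequentially. norm (measure (walk x) (A n k)) \<le> hit_prob x n y"
    by (intro always_eventually) (auto simp: A_def intro!: finite_measure_mono)
  from tannerys_theorem[OF lim this s]
  have "(\<lambda>k. \<Sum>n. measure (walk x) (A n k)) \<longlonglongrightarrow> (\<Sum>n. hit_prob x n y)" by simp
  moreover have "\<forall>\<^sub>F k in sequentially. (\<Sum>n. measure (walk x) (A n k)) = green p (D k) x y"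
    using eventually_ge_at_top[of k0]
    by eventually_elim (auto simp: A_def green_def restricted_prob_eq_measure D x)
  ultimately show ?thesis by (simp add: tendsto_cong)
qed

lemma AE_absorbed:
  assumes x: "x \<in> W" and r: "\<And>t. t \<in> W \<Longrightarrow> t \<noteq> r \<Longrightarrow> p r t = 0"
  shows "AE S in walk x. \<forall>n i. S i = r \<longrightarrow> S (i + n) = r"
  using AE_walk_positive[OF x] AE_space
proof eventually_elim
  case (elim S)
  have step: "S (Suc j) = r" if "S j = r" for j
    using r[of "S (Suc j)"] elim(1)[rule_format, of j] in_space_walk[OF elim(2)] that by force
  have "S i = r \<Longrightarrow> S (i + n) = r" for i n
    by (induction n) (auto simp: step)
  then show ?case by blast
qed

text \<open>Markov property at a fixed time, by concatenation of words. The last letter of the first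
  part is also the first letter of \<open>v\<close>, which is why only \<open>tl v\<close> is
  appended.\<close>

lemma hit_prob_concat:
  assumes x: "x \<in> W" and v: "length v = Suc N" "set v \<subseteq> W" "hd v = y"
  shows "measure (walk x) {S \<in> space (walk x). S n = y \<and> (\<forall>i\<le>N. S (n + i) = v ! i)} = hit_prob x n y * word_weight p v"
    and "{S \<in> space (walk x). S n = y \<and> (\<forall>i\<le>N. S (n + i) = v ! i)} \<in> sets (walk x)"
proof -
  define L where "L = {l. length l = Suc n \<and> last l = y}"
  define L' where "L' = (\<lambda>l. l @ tl v) ` L"
  have v': "v = y # tl v" using v by (cases v) auto
  have wv: "word_weight p (l @ tl v) = word_weight p l * word_weight p v" if "l \<in> L" for l
  proof (cases "tl v = []")
    case True then show ?thesis using v' by (metis append_Nil2 mult.right_neutral word_weight_simps(2))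
  next
    case False
    have "word_weight p v = p y (hd (tl v)) * word_weight p (tl v)"
      using v' False by (metis list.collapse word_weight_simps(3))
    then show ?thesis using that False by (subst word_weight_append) (auto simp: L_def)
  qed
  have len: "length l = Suc (n + N)" if "l \<in> L'" for l
    using that v by (auto simp: L'_def L_def)
  have setL: "{S \<in> space (walk x). S n = y} = {S \<in> space (walk x). map S [0..<Suc n] \<in> L}"
    by (auto simp: L_def)
  have split: "map S [0..<Suc (n + N)] = map S [0..<Suc n] @ map (\<lambda>i. S (n + Suc i)) [0..<N]" for S :: "nat \<Rightarrow> 's"
    by (rule nth_equalityI) (auto simp: nth_append less_Suc_eq_le simp del: upt_Suc)
  have setL': "{S \<in> space (walk x). S n = y \<and> (\<forall>i\<le>N. S (n + i) = v ! i)} =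
    {S \<in> space (walk x). map S [0..<Suc (n + N)] \<in> L'}" (is "?A = ?B")
  proof (intro Collect_cong conj_cong refl)
    fix S
    have tl: "map (\<lambda>i. S (n + Suc i)) [0..<N] = tl v \<longleftrightarrow> (\<forall>i<N. S (n + Suc i) = v ! Suc i)"
      using v by (subst list_eq_iff_nth_eq) (simp add: nth_tl)
    have "map S [0..<Suc (n + N)] \<in> L' \<longleftrightarrow> S n = y \<and> map (\<lambda>i. S (n + Suc i)) [0..<N] = tl v"
    proof
      assume "map S [0..<Suc (n + N)] \<in> L'"
      then obtain l where l: "l \<in> L" "map S [0..<Suc n] @ map (\<lambda>i. S (n + Suc i)) [0..<N] = l @ tl v"
        unfolding split L'_def by auto
      then have "map S [0..<Suc n] = l \<and> map (\<lambda>i. S (n + Suc i)) [0..<N] = tl v"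
        by (subst (asm) append_eq_append_conv) (auto simp: L_def)
      then show "S n = y \<and> map (\<lambda>i. S (n + Suc i)) [0..<N] = tl v"
        using l by (auto simp: L_def)
    next
      assume "S n = y \<and> map (\<lambda>i. S (n + Suc i)) [0..<N] = tl v"
      then show "map S [0..<Suc (n + N)] \<in> L'"
        unfolding split L'_def by (intro image_eqI[of _ _ "map S [0..<Suc n]"]) (auto simp: L_def)
    qed
    moreover have "(\<forall>i\<le>N. S (n + i) = v ! i) \<longleftrightarrow> S n = v ! 0 \<and> (\<forall>i<N. S (n + Suc i) = v ! Suc i)"
      by (metis add.right_neutral less_eq_Suc_le not0_implies_Suc zero_le)
    moreover have "v ! 0 = y" using v' by (metis nth_Cons_0)
    ultimately show "(S n = y \<and> (\<forall>i\<le>N. S (n + i) = v ! i)) = (map S [0..<Suc (n + N)] \<in> L')"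
      using tl by auto
  qed
  show "?A \<in> sets (walk x)" unfolding setL' by (rule emeasure_prefix_in(1)[OF x len])
  have "emeasure (walk x) ?A = word_mass p {l \<in> L'. set l \<subseteq> W \<and> hd l = x}"
    unfolding setL' by (rule emeasure_prefix_in(2)[OF x len])
  also have "\<dots> = (\<integral>\<^sup>+l. ennreal (word_weight p (l @ tl v)) \<partial>count_space {l \<in> L. set l \<subseteq> W \<and> hd l = x})"
  proof (rule nn_integral_bij_count_space[symmetric])
    have "set (tl v) \<subseteq> W" using v v' by (metis set_subset_Cons subset_trans)
    then show "bij_betw (\<lambda>l. l @ tl v) {l \<in> L. set l \<subseteq> W \<and> hd l = x} {l \<in> L'. set l \<subseteq> W \<and> hd l = x}"
      by (auto simp: bij_betw_def inj_on_def L'_def L_def hd_append)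
  qed
  also have "\<dots> = (\<integral>\<^sup>+l. ennreal (word_weight p l) * ennreal (word_weight p v) \<partial>count_space {l \<in> L. set l \<subseteq> W \<and> hd l = x})"
    using v by (intro nn_integral_cong) (auto simp: wv ennreal_mult word_weight_nonneg')
  also have "\<dots> = emeasure (walk x) {S \<in> space (walk x). S n = y} * ennreal (word_weight p v)"
    unfolding setL by (subst emeasure_prefix_in(2)[OF x]) (auto simp: L_def nn_integral_multc)
  finally show "measure (walk x) ?A = hit_prob x n y * word_weight p v"
    using v by (simp add: measure_def enn2real_mult word_weight_nonneg')
qed

text \<open>
  If the walk reaches the absorbing state \<open>r\<close> from \<open>y\<close> in \<open>N\<close> steps along a word of weight \<open>q\<close>, then
  \<open>q * P(S n = y) \<le> P(S (n + N) = r) - P(S n = r)\<close>, and the right-hand sides telescope.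
\<close>

lemma summable_hit_prob:
  assumes x: "x \<in> W" and r: "r \<in> W" "\<And>t. t \<in> W \<Longrightarrow> t \<noteq> r \<Longrightarrow> p r t = 0" and y: "y \<noteq> r"
    and v: "v \<noteq> []" "set v \<subseteq> W" "hd v = y" "last v = r" "word_weight p v > 0"
  shows "summable (\<lambda>n. hit_prob x n y)"
proof -
  interpret prob_space "walk x" by (rule prob_space_walk[OF x])
  define N where "N = length v - 1"
  have lv: "length v = Suc N" using v by (simp add: N_def)
  define a where "a = (\<lambda>n. hit_prob x n r)"
  have a01: "0 \<le> a n" "a n \<le> 1" for n by (auto simp: a_def)
  have absorbed: "AE S in walk x. \<forall>n i. S i = r \<longrightarrow> S (i + n) = r"
    by (rule AE_absorbed[OF x r(2)])
  have bound: "hit_prob x n y * word_weight p v \<le> a (n + N) - a n" for n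
  proof -
    define A where "A = {S \<in> space (walk x). S n = y \<and> (\<forall>i\<le>N. S (n + i) = v ! i)}"
    have mA: "A \<in> sets (walk x)" unfolding A_def by (rule hit_prob_concat(2)[OF x lv v(2,3)])
    have "measure (walk x) A + a n = measure (walk x) (A \<union> {S \<in> space (walk x). S n = r})"
      unfolding a_def using y by (intro finite_measure_Union[symmetric] mA) (auto simp: A_def)
    also have "\<dots> \<le> a (n + N)"
      unfolding a_def
    proof (intro finite_measure_mono_AE)
      show "AE S in walk x. S \<in> A \<union> {S \<in> space (walk x). S n = r} \<longrightarrow> S \<in> {S \<in> space (walk x). S (n + N) = r}"
        using absorbed
        by eventually_elim (use v lv in \<open>auto simp: A_def last_conv_nth\<close>)
    qed auto
    finally show ?thesis using hit_prob_concat(1)[OF x lv v(2,3), of n] by (simp add: A_def)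
  qed
  \<comment> \<open>The telescoped sum is at most the sum of the \<open>N\<close> values of
    \<open>a\<close> from time \<open>M\<close> on, each of which is at most 1.\<close>
  have "(\<Sum>n<M. hit_prob x n y) \<le> real N / word_weight p v" for M
  proof -
    have "(\<Sum>n<M. hit_prob x n y) * word_weight p v \<le> (\<Sum>n<M. a (n + N) - a n)"
      unfolding sum_distrib_right by (intro sum_mono bound)
    also have "\<dots> = (\<Sum>n=N..<M + N. a n) - (\<Sum>n<M. a n)"
      using sum.shift_bounds_nat_ivl[of a 0 N M] by (simp add: sum_subtractf lessThan_atLeast0)
    also have "\<dots> \<le> (\<Sum>n<M + N. a n) - (\<Sum>n<M. a n)"
      by (intro diff_right_mono sum_mono2) (auto simp: a01)
    also have "\<dots> = (\<Sum>n=M..<M + N. a n)"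
      using sum.atLeastLessThan_concat[of 0 M "M + N" a] by (simp add: lessThan_atLeast0)
    also have "\<dots> \<le> (\<Sum>n=M..<M + N. 1)" by (intro sum_mono a01)
    finally show ?thesis using v(5) by (simp add: field_simps)
  qed
  then show ?thesis by (intro summableI_nonneg_bounded) auto
qed

end

section \<open>Loop-erasure of a killed walk\<close>

lemma loop_erase_Nil [simp]: "loop_erase [] = []"
  by (simp add: loop_erase_def)

lemma loop_erase_single [simp]: "loop_erase [x] = [x]"
  by (simp add: loop_erase_def)

lemma loop_erase_snoc: "loop_erase (l @ [y]) = takeWhile (\<lambda>z. z \<noteq> y) (loop_erase l) @ [y]"
  by (simp add: loop_erase_def)

lemma loop_erase_eq_Nil [simp]: "loop_erase l = [] \<longleftrightarrow> l = []"
  by (cases l rule: rev_cases) (auto simp: loop_erase_snoc)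

lemma set_loop_erase: "set (loop_erase l) \<subseteq> set l"
  by (induction l rule: rev_induct) (auto simp: loop_erase_snoc dest: set_takeWhileD)

lemma last_loop_erase: "l \<noteq> [] \<Longrightarrow> last (loop_erase l) = last l"
  by (cases l rule: rev_cases) (auto simp: loop_erase_snoc)

lemma hd_loop_erase: "l \<noteq> [] \<Longrightarrow> hd (loop_erase l) = hd l"
proof (induction l rule: rev_induct)
  case (snoc y l)
  show ?case
  proof (cases "l = []")
    case False
    then obtain z q where q: "loop_erase l = z # q" by (metis loop_erase_eq_Nil neq_Nil_conv)
    then show ?thesis using snoc False by (auto simp: loop_erase_snoc)
  qed (simp add: loop_erase_snoc)
qed simp

lemma loop_erase_loop:
  assumes "l \<noteq> []" "hd l = last l"
  shows "loop_erase l = [hd l]"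
proof (cases l rule: rev_cases)
  case (snoc l' y)
  show ?thesis
  proof (cases "l' = []")
    case False
    then obtain z q where q: "loop_erase l' = z # q" by (metis loop_erase_eq_Nil neq_Nil_conv)
    then have "z = y" using hd_loop_erase[OF False] assms snoc False by simp
    then show ?thesis using snoc q False assms by (simp add: loop_erase_snoc)
  qed (use snoc in \<open>simp add: loop_erase_snoc\<close>)
qed (use assms in simp)

text \<open>Decomposition of a word at the last visit to its starting point: everything up to that
  visit is one loop and leaves only that point, so the remainder is erased on its own.\<close>

lemma loop_erase_append_loop:
  assumes "l \<noteq> []" "hd l = last l" "hd l \<notin> set l'"
  shows "loop_erase (l @ l') = hd l # loop_erase l'"
  using assms(3)
proof (induction l' rule: rev_induct)
  case Nil
  then show ?case using loop_erase_loop[OF assms(1,2)] by simp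
next
  case (snoc y l')
  then show ?case by (simp add: loop_erase_snoc flip: append_assoc)
qed

lemma path_edges_Cons: "q \<noteq> [] \<Longrightarrow> path_edges (x # q) = insert (x, hd q) (path_edges q)"
  by (cases q) (auto simp: path_edges_def)

lemma path_edges_single [simp]: "path_edges [] = {}" "path_edges [x] = {}"
  by (auto simp: path_edges_def)

lemma path_edges_in_set: "(a, b) \<in> path_edges q \<Longrightarrow> a \<in> set q \<and> b \<in> set q"
  unfolding path_edges_def by (cases q) (auto dest: set_zip_leftD set_zip_rightD)

definition erased_prefix :: "(nat \<Rightarrow> 's) \<Rightarrow> nat \<Rightarrow> ('s \<times> 's) set" where
  "erased_prefix S n = path_edges (loop_erase (map S [0..<Suc n]))"

lemma loop_erased_edges_hit:
  assumes "S n \<in> A" "\<And>k. k < n \<Longrightarrow> S k \<notin> A"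
  shows "loop_erased_edges A S = erased_prefix S n"
proof -
  have "(LEAST n. S n \<in> A) = n" by (rule Least_equality) (use assms not_less in blast)+
  then show ?thesis unfolding loop_erased_edges_def erased_prefix_def using assms(1) by auto
qed

lemma loop_erased_edges_never:
  assumes "\<And>n. S n \<notin> A"
  shows "loop_erased_edges A S = {e. \<exists>N. \<forall>n\<ge>N. e \<in> erased_prefix S n}"
  unfolding loop_erased_edges_def erased_prefix_def using assms by auto

lemma hitting_cases:
  fixes S :: "nat \<Rightarrow> 's"
  obtains (hit) n where "S n \<in> A" "\<And>k. k < n \<Longrightarrow> S k \<notin> A" | (never) "\<And>n. S n \<notin> A"
proof (cases "\<exists>n. S n \<in> A")
  case True
  show ?thesis
    by (rule hit[of "LEAST n. S n \<in> A"]) (use LeastI_ex[OF True] not_less_Least in blast)+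
qed (use never in blast)

text \<open>A word that meets \<open>A\<close> only in its last letter already fixes the stopping
  time.\<close>

lemma loop_erased_edges_prefix:
  assumes "has_prefix S l" "l \<noteq> []" "set (butlast l) \<inter> A = {}" "last l \<in> A"
  shows "loop_erased_edges A S = path_edges (loop_erase l)"
proof -
  define n where "n = length l - 1"
  have len: "length l = Suc n" using assms(2) by (simp add: n_def)
  have S: "S i = l ! i" if "i \<le> n" for i using assms(1) that len by (auto simp: has_prefix_iff)
  have n: "S n \<in> A" using S[of n] assms(2,4) by (simp add: last_conv_nth n_def)
  have lt: "S i \<notin> A" if "i < n" for i
  proof -
    have "l ! i = butlast l ! i" using that len by (simp add: nth_butlast)
    then have "S i \<in> set (butlast l)" using S[of i] that len by (metis diff_Suc_1 length_butlast less_imp_le nth_mem)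
    then show ?thesis using assms(3) by auto
  qed
  have "map S [0..<Suc n] = l" using assms(1) len by (simp add: has_prefix_def)
  then show ?thesis
    using loop_erased_edges_hit[of S n A] n lt by (simp add: erased_prefix_def)
qed

lemma nn_integral_count_space_times:
  "(\<integral>\<^sup>+z. f (fst z) * g (snd z) \<partial>count_space (A \<times> B)) =
    (\<integral>\<^sup>+x. f x \<partial>count_space A) * (\<integral>\<^sup>+y. g y \<partial>count_space B)"
proof -
  have "(\<integral>\<^sup>+z. f (fst z) * g (snd z) \<partial>count_space (A \<times> B)) =
    (\<integral>\<^sup>+z. (case z of (x, y) \<Rightarrow> f x * indicator A x * (g y * indicator B y)) \<partial>count_space UNIV)"
    by (subst nn_integral_count_space_indicator) (auto intro!: nn_integral_cong simp: indicator_times mult_ac split: prod.splits)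
  also have "\<dots> = (\<integral>\<^sup>+x. \<integral>\<^sup>+y. f x * indicator A x * (g y * indicator B y) \<partial>count_space UNIV \<partial>count_space UNIV)"
    by (subst nn_integral_fst_count_space[symmetric]) simp
  also have "\<dots> = (\<integral>\<^sup>+x. f x * indicator A x \<partial>count_space UNIV) * (\<integral>\<^sup>+y. g y * indicator B y \<partial>count_space UNIV)"
    by (simp add: nn_integral_cmult nn_integral_multc)
  also have "\<dots> = (\<integral>\<^sup>+x. f x \<partial>count_space A) * (\<integral>\<^sup>+y. g y \<partial>count_space B)"
    by (cases "A = UNIV"; cases "B = UNIV") (simp_all add: nn_integral_count_space_indicator)
  finally show ?thesis .
qed

section \<open>Determinants as sums over forests, and the law of the loop-erased path\<close>

context markov_kernel begin

abbreviation steps :: "'s set \<Rightarrow> ('s \<Rightarrow> 's) set" where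
  "steps R \<equiv> PiE R (\<lambda>x. {u \<in> W. p x u \<noteq> 0})"

text \<open>Since the rows of \<open>p\<close> sum to 1, the diagonal 1 can be spread over the
  transitions; this is the Laplacian form that \<open>matrix_tree\<close> expects.\<close>

lemma killed_matrix_eq_sum:
  assumes "x \<in> W" "y \<in> W"
  shows "killed_matrix p x y = (\<Sum>u | u \<in> W \<and> p x u \<noteq> 0. p x u * (of_bool (x = y) - of_bool (u = y)))"
proof -
  have "(\<Sum>u | u \<in> W \<and> p x u \<noteq> 0. p x u * of_bool (u = y)) = (\<Sum>u | u \<in> W \<and> p x u \<noteq> 0. if u = y then p x u else 0)"
    by (intro sum.cong) auto
  also have "\<dots> = p x y" using assms p_finite[of x] by (subst sum.delta) auto
  finally show ?thesis
    using p_sum[OF assms(1)]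
    by (simp add: killed_matrix_def right_diff_distrib sum_subtractf sum_distrib_right[symmetric])
qed

lemma sum_acyclic_eq_det:
  assumes R: "finite R" "R \<subseteq> W"
  shows "(\<Sum>f | f \<in> steps R \<and> acyclic (fun_graph R f). \<Prod>x\<in>R. p x (f x)) =
    walk_det p R"
proof (subst matrix_tree[OF R(1)])
  show "det_on R (\<lambda>x y. \<Sum>u | u \<in> W \<and> p x u \<noteq> 0. p x u * (of_bool (x = y) - of_bool (u = y))) =
    walk_det p R"
    using R(2) by (intro det_on_cong killed_matrix_eq_sum[symmetric]) auto
qed (use p_finite R in auto)

text \<open>Nonnegative as a sum of forest weights, nonzero because the Green function is an
  inverse.\<close>

lemma det_killed_matrix_pos:
  assumes R: "finite R" "R \<subseteq> W" and s: "\<And>x y. x \<in> R \<Longrightarrow> y \<in> R \<Longrightarrow> summable (\<lambda>n. hit_prob x n y)"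
  shows "walk_det p R > 0"
proof -
  have "walk_det p R \<ge> 0"
    unfolding sum_acyclic_eq_det[OF R, symmetric] using R(2)
    by (intro sum_nonneg prod_nonneg ballI p_nonneg) (auto dest: PiE_mem)
  moreover have "det_on R (green p R) * walk_det p R = 1"
    by (intro det_on_resolvent[OF R(1)] green_equation_left[OF R(1)] summable_restricted_prob[OF R] s)
  ultimately show ?thesis by (metis less_eq_real_def mult_zero_right zero_neq_one)
qed

lemma green_diagonal:
  assumes R: "finite R" "R \<subseteq> W" and s: "\<And>x y. x \<in> R \<Longrightarrow> y \<in> R \<Longrightarrow> summable (\<lambda>n. hit_prob x n y)"
    and x: "x \<in> R"
  shows "green p R x x = walk_det p (R - {x}) / walk_det p R"
proof -
  have "green p R x x * walk_det p R = walk_det p (R - {x})"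
    by (intro resolvent_diagonal[OF R(1) x] green_equation_left[OF R(1)] summable_restricted_prob[OF R] s)
  then show ?thesis using det_killed_matrix_pos[OF R s] by (simp add: field_simps)
qed

text \<open>The invariants of the induction below: \<open>L\<close> gathers enough words with
  erasure \<open>g\<close> to carry the stated mass. Reachability along \<open>f\<close> is included
  because, with acyclicity, it keeps the points of \<open>g\<close> apart from a vertex prepended
  later.\<close>

definition erased_words :: "'s set \<Rightarrow> ('s \<Rightarrow> 's) \<Rightarrow> 's \<Rightarrow> 's list set \<Rightarrow> 's list \<Rightarrow> bool" where
  "erased_words R f s L g \<longleftrightarrow>
    (\<forall>l\<in>L. l \<noteq> [] \<and> hd l = s \<and> set l \<subseteq> W \<and> set (butlast l) \<subseteq> R \<and> last l \<notin> R \<and> loop_erase l = g) \<and>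
    g \<noteq> [] \<and> hd g = s \<and> last g \<notin> R \<and> set (butlast g) \<subseteq> R \<and>
    path_edges g = fun_graph (set (butlast g)) f \<and> (\<forall>t\<in>set g. (s, t) \<in> (fun_graph R f)\<^sup>*) \<and>
    word_mass p L =
      ennreal (path_weight f g *
        (walk_det p (R - set g) / walk_det p R))"

lemma erased_wordsD:
  assumes "erased_words R f s L g"
  shows "\<And>l. l \<in> L \<Longrightarrow> l \<noteq> [] \<and> hd l = s \<and> set l \<subseteq> W \<and> set (butlast l) \<subseteq> R \<and> last l \<notin> R \<and> loop_erase l = g"
    and "g \<noteq> []" "hd g = s" "last g \<notin> R" "set (butlast g) \<subseteq> R"
    and "path_edges g = fun_graph (set (butlast g)) f" "\<And>t. t \<in> set g \<Longrightarrow> (s, t) \<in> (fun_graph R f)\<^sup>*"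
    and "word_mass p L = ennreal (path_weight f g * (walk_det p (R - set g) / walk_det p R))"
  using assms unfolding erased_words_def by blast+

text \<open>
  The words whose loop-erasure is the \<open>f\<close>-path from \<open>s\<close> out of \<open>R\<close>: a loop at \<open>s\<close> in \<open>R\<close>, followed
  by such a word from \<open>f s\<close> for \<open>R - {s}\<close>.  The weights of the loops sum to a diagonal Green
  function, which is a ratio of determinants, so the product telescopes.
\<close>

lemma loop_erasure_words:
  assumes "finite R" "R \<subseteq> W" "\<And>x y. x \<in> R \<Longrightarrow> y \<in> R \<Longrightarrow> summable (\<lambda>n. hit_prob x n y)"
    and "\<And>x. x \<in> R \<Longrightarrow> f x \<in> W" "acyclic (fun_graph R f)" "s \<in> W"
  shows "\<exists>L g. erased_words R f s L g"
  using assms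
proof (induction R arbitrary: s rule: finite_psubset_induct)
  case (psubset R)
  note prems = psubset.prems
  have det_pos: "walk_det p R' > 0" if "R' \<subseteq> R" for R'
  proof (rule det_killed_matrix_pos)
    show "finite R'" using that psubset(1) finite_subset by blast
    show "R' \<subseteq> W" using that prems(1) by blast
    show "summable (\<lambda>n. hit_prob x n y)" if "x \<in> R'" "y \<in> R'" for x y
      using that \<open>R' \<subseteq> R\<close> by (intro prems(2)) auto
  qed
  show ?case
  proof (cases "s \<in> R")
    case False
    show ?thesis
      unfolding erased_words_def
    proof (intro exI[of _ "{[s]}"] exI[of _ "[s]"] conjI)
      have "word_mass p {[s]} = 1"
        by (simp add: nn_integral_count_space_finite)
      moreover have "R - set [s] = R" using False by simp
      ultimately show "word_mass p {[s]} =
        ennreal ((\<Prod>t\<in>set (butlast [s]). p t (f t)) *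
          (walk_det p (R - set [s]) / walk_det p R))"
        using det_pos[of R] by simp
    qed (use False prems in \<open>auto simp: loop_erase_loop fun_graph_def\<close>)
  next
    case True
    define R' where "R' = R - {s}"
    have R': "R' \<subset> R" "R' \<subseteq> W" using True prems by (auto simp: R'_def)
    have T': "fun_graph R' f \<subseteq> fun_graph R f" using R' by (auto simp: fun_graph_def)
    have fs: "f s \<in> W" using prems True by blast
    have ac: "acyclic (fun_graph R' f)" using T' prems(4) acyclic_subset by blast
    have sm: "summable (\<lambda>n. hit_prob x n y)" if "x \<in> R'" "y \<in> R'" for x y
      using that R' by (intro prems(2)) auto
    have fW: "f x \<in> W" if "x \<in> R'" for x using that R' prems(3) by blast
    obtain L' g where E: "erased_words R' f (f s) L' g"
      using psubset.IH[OF R'(1) R'(2) sm fW ac fs] by blast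
    note L' = erased_wordsD(1)[OF E] and g = erased_wordsD(2-7)[OF E] and int = erased_wordsD(8)[OF E]
    \<comment> \<open>All points of \<open>g\<close> lie strictly beyond \<open>s\<close> along
      \<open>f\<close>; acyclicity then excludes a return to \<open>s\<close>.\<close>
    have reach: "(s, t) \<in> (fun_graph R f)\<^sup>+" if "t \<in> set g" for t
      using g(6)[OF that] rtrancl_mono[OF T'] True by (intro rtrancl_into_trancl2[of _ "f s"]) auto
    then have s_g: "s \<notin> set g" using prems(4) by (auto simp: acyclic_def)
    have last_g: "last g \<notin> R" using g(1,3) s_g by (auto simp: R'_def)
    have s_l: "s \<notin> set l" "last l \<notin> R" if "l \<in> L'" for l
    proof -
      have "last l = last g" using last_loop_erase[of l] L'[OF that] by auto
      then have "last l \<noteq> s" using s_g g(1) by auto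
      moreover have "set l \<subseteq> insert (last l) (set (butlast l))"
        using L'[OF that] by (metis append_butlast_last_id set_append Un_insert_right list.set(1,2) sup_bot.right_neutral order_refl)
      ultimately show "s \<notin> set l" "last l \<notin> R" using L'[OF that] by (auto simp: R'_def)
    qed
    define K where "K = (\<Union>n. words R n s s)"
    have K: "l \<noteq> []" "hd l = s" "last l = s" "set l \<subseteq> R" if "l \<in> K" for l
      using that by (auto simp: K_def words_def)
    define L where "L = (\<lambda>z. fst z @ snd z) ` (K \<times> L')"
    \<comment> \<open>Words of \<open>L'\<close> avoid \<open>s\<close> and words of
      \<open>K\<close> end in \<open>s\<close>, so the last visit to \<open>s\<close> shows where to
      cut.\<close>
    have inj: "inj_on (\<lambda>z. fst z @ snd z) (K \<times> L')"
    proof (rule inj_onI, clarsimp)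
      fix k l k' l' assume *: "k \<in> K" "l \<in> L'" "k' \<in> K" "l' \<in> L'" "k @ l = k' @ l'"
      then obtain us where "k = k' @ us \<and> us @ l = l' \<or> k @ us = k' \<and> l = us @ l'"
        unfolding append_eq_append_conv2 by blast
      moreover have "us = []" if "k = k' @ us" "us @ l = l'"
        using that s_l(1)[OF *(4)] K(3)[OF *(1)] by (metis Un_iff last_appendR last_in_set set_append)
      moreover have "us = []" if "k @ us = k'" "l = us @ l'"
        using that s_l(1)[OF *(2)] K(3)[OF *(3)] by (metis Un_iff last_appendR last_in_set set_append)
      ultimately show "k = k' \<and> l = l'" by (metis append_Nil append_Nil2)
    qed
    have "word_mass p L =
      (\<integral>\<^sup>+z. ennreal (word_weight p (fst z @ snd z)) \<partial>count_space (K \<times> L'))"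
      by (rule nn_integral_bij_count_space[symmetric]) (use inj in \<open>auto simp: L_def bij_betw_def\<close>)
    also have "\<dots> = (\<integral>\<^sup>+z. ennreal (word_weight p (fst z)) * (ennreal (p s (f s)) * ennreal (word_weight p (snd z))) \<partial>count_space (K \<times> L'))"
    proof (intro nn_integral_cong)
      fix z assume "z \<in> space (count_space (K \<times> L'))"
      then have z: "fst z \<in> K" "snd z \<in> L'" by auto
      have "word_weight p (fst z @ snd z) = word_weight p (fst z) * p s (f s) * word_weight p (snd z)"
        using z K L' by (subst word_weight_append) auto
      moreover have "word_weight p (fst z) \<ge> 0" "word_weight p (snd z) \<ge> 0" "p s (f s) \<ge> 0"
        using subset_trans[OF K(4)[OF z(1)] prems(1)] L'[OF z(2)] fs prems(5)
        by (blast intro: word_weight_nonneg' p_nonneg)+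
      ultimately show "ennreal (word_weight p (fst z @ snd z)) =
        ennreal (word_weight p (fst z)) * (ennreal (p s (f s)) * ennreal (word_weight p (snd z)))"
        by (simp add: ennreal_mult mult.assoc)
    qed
    also have "\<dots> = word_mass p K *
        (\<integral>\<^sup>+l. ennreal (p s (f s)) * ennreal (word_weight p l) \<partial>count_space L')"
      by (rule nn_integral_count_space_times)
    also have "\<dots> = ennreal (green p R s s) * (ennreal (p s (f s)) * ennreal (path_weight f g *
          (walk_det p (R' - set g) / walk_det p R')))"
      using psubset(1) prems True unfolding K_def by (subst nn_integral_loops) (auto simp: nn_integral_cmult int)
    also have "\<dots> = ennreal (green p R s s * (p s (f s) * (path_weight f g *
          (walk_det p (R' - set g) / walk_det p R'))))"
    proof -
      have "p t (f t) \<ge> 0" if "t \<in> R" for t using prems that by (intro p_nonneg) auto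
      then have "path_weight f g \<ge> 0" "p s (f s) \<ge> 0"
        using g(4) R' True by (auto intro!: prod_nonneg)
      moreover have "green p R s s \<ge> 0" using psubset(1) prems True by (intro green_nonneg) auto
      moreover have "walk_det p (R' - set g) \<ge> 0" "walk_det p R' \<ge> 0"
        using R' by (intro less_imp_le det_pos; blast)+
      ultimately show ?thesis by (simp flip: ennreal_mult)
    qed
    also have "green p R s s * (p s (f s) * (path_weight f g *
          (walk_det p (R' - set g) / walk_det p R'))) =
       (\<Prod>t\<in>set (butlast (s # g)). p t (f t)) *
        (det_on (R - set (s # g)) (killed_matrix p) / walk_det p R)"
    proof -
      have "green p R s s = walk_det p R' / walk_det p R"
        unfolding R'_def using psubset(1) prems True by (intro green_diagonal) auto
      moreover have "R - set (s # g) = R' - set g" by (auto simp: R'_def)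
      moreover have "(\<Prod>t\<in>set (butlast (s # g)). p t (f t)) = p s (f s) * path_weight f g"
        using g(1) s_g by (simp, subst prod.insert) (auto dest: in_set_butlastD)
      moreover have "walk_det p R' \<noteq> 0" using det_pos[of R'] R' by auto
      ultimately show ?thesis by simp
    qed
    finally have int': "word_mass p L =
       ennreal ((\<Prod>t\<in>set (butlast (s # g)). p t (f t)) *
        (det_on (R - set (s # g)) (killed_matrix p) / walk_det p R))" .
    show ?thesis
      unfolding erased_words_def
    proof (intro exI[of _ L] exI[of _ "s # g"] conjI ballI)
      fix l assume "l \<in> L"
      then obtain k l' where l: "l = k @ l'" "k \<in> K" "l' \<in> L'" by (auto simp: L_def)
      show "l \<noteq> []" "hd l = s" "last l \<notin> R" using l K L' s_l by auto
      show "set l \<subseteq> W" using l K(4) L' prems(1) by fastforce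
      have "set (butlast l') \<subseteq> R" "set k \<subseteq> R" using l K L' R' by blast+
      then show "set (butlast l) \<subseteq> R" using l L' by (auto simp: butlast_append)
      have "hd k = last k" "hd k \<notin> set l'" using l K s_l by auto
      from loop_erase_append_loop[OF K(1)[OF l(2)] this]
      show "loop_erase l = s # g" using l K L' by auto
    next
      show "path_edges (s # g) = fun_graph (set (butlast (s # g))) f"
        using g by (simp add: path_edges_Cons fun_graph_def)
    next
      fix t assume "t \<in> set (s # g)"
      then show "(s, t) \<in> (fun_graph R f)\<^sup>*" using reach by (auto dest: trancl_into_rtrancl)
    qed (use g last_g True R' int' in auto)
  qed
qed

text \<open>\<open>Q\<close> is the part of the path inside \<open>R\<close>. Its last step leads to
  a state outside \<open>R\<close>, so after adding the path exactly \<open>R - Q\<close> is left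
  for the later rounds.\<close>

lemma loop_erasure_event:
  assumes R: "finite R" "R \<subseteq> W" and s: "\<And>x y. x \<in> R \<Longrightarrow> y \<in> R \<Longrightarrow> summable (\<lambda>n. hit_prob x n y)"
    and f: "\<And>x. x \<in> R \<Longrightarrow> f x \<in> W" "acyclic (fun_graph R f)" and x: "x \<in> R"
  obtains A Q where "A \<in> sets (walk x)" "Q \<subseteq> R" "x \<in> Q"
    "emeasure (walk x) A = ennreal ((\<Prod>t\<in>Q. p t (f t)) *
        (walk_det p (R - Q) / walk_det p R))"
    "\<And>S. S \<in> A \<Longrightarrow> loop_erased_edges (- R) S = fun_graph Q f"
    "f ` Q \<subseteq> Q \<union> - R"
proof -
  have xW: "x \<in> W" using x R by blast
  obtain L g where E: "erased_words R f x L g"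
    using loop_erasure_words[OF R s f xW] by blast
  note L = erased_wordsD(1)[OF E] and g = erased_wordsD(2-6)[OF E] and int = erased_wordsD(8)[OF E]
  define Q where "Q = set (butlast g)"
  have setg: "set g = insert (last g) Q"
    using g(1) unfolding Q_def by (metis append_butlast_last_id set_append Un_insert_right list.set(1,2) sup_bot.right_neutral)
  have RQ: "R - set g = R - Q" using setg g(3) by auto
  \<comment> \<open>If \<open>l'\<close> were a proper prefix of \<open>l\<close>, its last letter,
    which lies outside \<open>R\<close>, would be an inner letter of \<open>l\<close>.\<close>
  have same_length: "length l \<le> length l'" if "l \<in> L" "l' \<in> L" "has_prefix S l" "has_prefix S l'" for S l l'
  proof (rule ccontr)
    assume nle: "\<not> length l \<le> length l'"
    have "length l' > 0" using L[OF that(2)] by simp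
    then have lt: "length l' - 1 < length (butlast l)" "length l' - 1 < length l'" "l' \<noteq> []"
      using nle by (auto simp: less_diff_conv)
    then have "last l' = butlast l ! (length l' - 1)"
      using that(3,4) by (auto simp: has_prefix_iff last_conv_nth nth_butlast)
    then show False using L[OF that(1)] L[OF that(2)] lt by (metis nth_mem subsetD)
  qed
  define A where "A = (cylinders x L)"
  have LW: "L \<subseteq> lists W" using L by blast
  have Lx: "\<And>l. l \<in> L \<Longrightarrow> l \<noteq> [] \<and> hd l = x" using L by blast
  have uniq: "l = l'" if "l \<in> L" "l' \<in> L" "has_prefix S l" "has_prefix S l'" for S l l'
    using that same_length by (metis has_prefix_same_length order_antisym)
  show ?thesis
  proof (rule that[of A Q])
    show "A \<in> sets (walk x)" unfolding A_def by (rule emeasure_words(1)[OF xW LW Lx uniq])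
    show "Q \<subseteq> R" using g by (simp add: Q_def)
    show "x \<in> Q" using setg g x by (metis hd_in_set insertE)
    have "emeasure (walk x) A = word_mass p L"
      unfolding A_def by (rule emeasure_words(2)[OF xW LW Lx uniq])
    then show "emeasure (walk x) A = ennreal ((\<Prod>t\<in>Q. p t (f t)) *
        (walk_det p (R - Q) / walk_det p R))"
      by (simp only: int RQ) (simp add: Q_def)
    show "loop_erased_edges (- R) S = fun_graph Q f" if S: "S \<in> A" for S
    proof -
      obtain l where l: "l \<in> L" "has_prefix S l" using S by (auto simp: A_def)
      have "loop_erased_edges (- R) S = path_edges (loop_erase l)"
        using L[OF l(1)] by (intro loop_erased_edges_prefix l) auto
      then show ?thesis using L[OF l(1)] g by (simp add: Q_def)
    qed
    show "f ` Q \<subseteq> Q \<union> - R"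
    proof safe
      fix t assume "t \<in> Q" "f t \<notin> Q"
      then have "(t, f t) \<in> path_edges g" using g(5) by (simp add: Q_def)
      then have "f t \<in> set g" using path_edges_in_set by metis
      then show "f t \<in> R \<Longrightarrow> False" using setg g(3) \<open>f t \<notin> Q\<close> by auto
    qed
  qed
qed

end

section \<open>Wilson's algorithm on finite domains\<close>

text \<open>The right-hand side uses only countable quantifiers over times and conditions on
  finitely many steps, so measurability can be read off, even for a random \<open>A\<close>.\<close>

lemma in_loop_erased_edges_iff:
  "e \<in> loop_erased_edges A S \<longleftrightarrow>
    (\<exists>n. S n \<in> A \<and> (\<forall>k<n. S k \<notin> A) \<and> e \<in> erased_prefix S n) \<or>
    ((\<forall>n. S n \<notin> A) \<and> (\<exists>N. \<forall>n\<ge>N. e \<in> erased_prefix S n))"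
proof (cases rule: hitting_cases[of S A])
  case (hit n)
  then have "k = n" if "S k \<in> A" "\<forall>i<k. S i \<notin> A" for k
    using that by (metis linorder_neqE_nat)
  then show ?thesis using loop_erased_edges_hit[of S n A] hit by metis
next
  case never
  then show ?thesis using loop_erased_edges_never[of S A] by simp
qed

lemma loop_erased_edges_cong:
  "(\<And>n. S n \<in> A \<longleftrightarrow> S n \<in> B) \<Longrightarrow> loop_erased_edges A S = loop_erased_edges B S"
  by (simp add: loop_erased_edges_def)

lemma loop_erased_edges_in_range: "e \<in> loop_erased_edges A S \<Longrightarrow> fst e \<in> range S \<and> snd e \<in> range S"
proof -
  assume "e \<in> loop_erased_edges A S"
  then obtain n where "e \<in> path_edges (loop_erase (map S [0..<Suc n]))"
    unfolding in_loop_erased_edges_iff erased_prefix_def by blast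
  then have "fst e \<in> set (loop_erase (map S [0..<Suc n]))" "snd e \<in> set (loop_erase (map S [0..<Suc n]))"
    using path_edges_in_set by (metis prod.collapse)+
  then show ?thesis using set_loop_erase[of "map S [0..<Suc n]"] by (auto simp del: upt_Suc)
qed

lemma pred_countable_Bex:
  assumes "countable I" "\<And>i. i \<in> I \<Longrightarrow> Measurable.pred M (\<lambda>x. P x i)"
  shows "Measurable.pred M (\<lambda>x. \<exists>i\<in>I. P x i)"
  using assms unfolding pred_def by (intro sets.sets_Collect_countable_Ex') auto

text \<open>
  Wilson's algorithm on the vertex set \<open>D\<close>, with all states outside \<open>D\<close> covered from the start.
  These states are not merged: they remain distinct endpoints of edges.
\<close>

primrec domain_rounds ::
    "'a set \<Rightarrow> (nat \<Rightarrow> 'a) \<Rightarrow> ('a \<Rightarrow> nat \<Rightarrow> 'a option) \<Rightarrow> nat \<Rightarrow> ('a option \<times> 'a option) set" where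
  "domain_rounds D en X 0 = {}"
| "domain_rounds D en X (Suc j) =
     (let F = domain_rounds D en X j; A = - Some ` D \<union> Field F in
      if \<exists>i. Some (en i) \<notin> A
      then F \<union> loop_erased_edges A (X (en (LEAST i. Some (en i) \<notin> A)))
      else F)"

definition covered ::
    "'a set \<Rightarrow> (nat \<Rightarrow> 'a) \<Rightarrow> ('a \<Rightarrow> nat \<Rightarrow> 'a option) \<Rightarrow> nat \<Rightarrow> 'a option set" where
  "covered D en X j = - Some ` D \<union> Field (domain_rounds D en X j)"

definition domain_edges ::
    "'a set \<Rightarrow> (nat \<Rightarrow> 'a) \<Rightarrow> ('a \<Rightarrow> nat \<Rightarrow> 'a option) \<Rightarrow> ('a option \<times> 'a option) set" where
  "domain_edges D en X = (\<Union>j. domain_rounds D en X j)"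

declare domain_rounds.simps(2) [simp del]

lemma domain_rounds_Suc_start:
  assumes "Some (en i) \<notin> covered D en X j" "\<And>i'. i' < i \<Longrightarrow> Some (en i') \<in> covered D en X j"
  shows "domain_rounds D en X (Suc j) =
    domain_rounds D en X j \<union> loop_erased_edges (covered D en X j) (X (en i))"
proof -
  have "(LEAST i. Some (en i) \<notin> covered D en X j) = i"
    by (rule Least_equality) (use assms not_less in blast)+
  then show ?thesis using assms(1) by (auto simp: domain_rounds.simps(2) Let_def covered_def)
qed

lemma domain_rounds_Suc_stop:
  assumes "\<And>i. Some (en i) \<in> covered D en X j"
  shows "domain_rounds D en X (Suc j) = domain_rounds D en X j"
  using assms by (auto simp: domain_rounds.simps(2) Let_def covered_def)

text \<open>\<open>LEAST\<close> is replaced by quantifiers over the enumeration, again with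
  measurability in view.\<close>

lemma in_domain_rounds_Suc_iff:
  "e \<in> domain_rounds D en X (Suc j) \<longleftrightarrow> e \<in> domain_rounds D en X j \<or>
    (\<exists>i. Some (en i) \<notin> covered D en X j \<and> (\<forall>i'<i. Some (en i') \<in> covered D en X j) \<and>
      e \<in> loop_erased_edges (covered D en X j) (X (en i)))"
proof (cases "\<exists>i. Some (en i) \<notin> covered D en X j")
  case True
  define i where "i = (LEAST i. Some (en i) \<notin> covered D en X j)"
  have i: "Some (en i) \<notin> covered D en X j" "\<And>k. k < i \<Longrightarrow> Some (en k) \<in> covered D en X j"
    unfolding i_def using LeastI_ex[OF True] not_less_Least by blast+
  have uniq: "k = i" if "Some (en k) \<notin> covered D en X j" "\<forall>i'<k. Some (en i') \<in> covered D en X j" for k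
    using that i by (metis linorder_neqE_nat)
  have "(\<exists>i. Some (en i) \<notin> covered D en X j \<and> (\<forall>i'<i. Some (en i') \<in> covered D en X j) \<and>
      e \<in> loop_erased_edges (covered D en X j) (X (en i))) \<longleftrightarrow>
    e \<in> loop_erased_edges (covered D en X j) (X (en i))" (is "(\<exists>i. ?P i) \<longleftrightarrow> ?Q")
  proof
    assume "\<exists>i. ?P i"
    then obtain k where k: "?P k" ..
    then have "k = i" by (intro uniq) auto
    then show ?Q using k by simp
  next
    assume ?Q
    then have "?P i" using i by simp
    then show "\<exists>i. ?P i" ..
  qed
  moreover have "domain_rounds D en X (Suc j) =
    domain_rounds D en X j \<union> loop_erased_edges (covered D en X j) (X (en i))"
    using i by (rule domain_rounds_Suc_start)
  ultimately show ?thesis by simp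
next
  case False
  then show ?thesis using domain_rounds_Suc_stop[of en D X j] by blast
qed

lemma domain_rounds_mono: "i \<le> j \<Longrightarrow> domain_rounds D en X i \<subseteq> domain_rounds D en X j"
  by (rule lift_Suc_mono_le[of "domain_rounds D en X"]) (auto simp: in_domain_rounds_Suc_iff)

lemma covered_mono: "i \<le> j \<Longrightarrow> covered D en X i \<subseteq> covered D en X j"
  unfolding covered_def using domain_rounds_mono[of i j D en X] mono_Field by (auto simp: mono_def)

lemma domain_edges_eq_rounds:
  assumes "\<And>i. Some (en i) \<in> covered D en X j"
  shows "domain_edges D en X = domain_rounds D en X j"
proof -
  have same: "domain_rounds D en X (j + k) = domain_rounds D en X j" for k
  proof (induction k)
    case (Suc k)
    have "Some (en i) \<in> covered D en X (j + k)" for i using assms covered_mono[of j "j + k" D en X] by auto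
    then show ?case using Suc domain_rounds_Suc_stop[of en D X "j + k"] by simp
  qed simp
  show ?thesis
  proof
    show "domain_edges D en X \<subseteq> domain_rounds D en X j"
      unfolding domain_edges_def
    proof
      fix e assume "e \<in> (\<Union>j. domain_rounds D en X j)"
      then obtain i where "e \<in> domain_rounds D en X i" by blast
      then have "e \<in> domain_rounds D en X (j + i)" using domain_rounds_mono[of i "j + i"] by auto
      then show "e \<in> domain_rounds D en X j" by (simp add: same)
    qed
  qed (auto simp: domain_edges_def)
qed

text \<open>The condition is relative to \<open>None \<in> W\<close>, because the walk with
  conductances \<open>ct\<close> has no cemetery when the graph is infinite.\<close>

locale absorbing_kernel = markov_kernel W p
  for W :: "'a option set" and p :: "'a option \<Rightarrow> 'a option \<Rightarrow> real" +
  assumes absorbing: "\<And>t. None \<in> W \<Longrightarrow> t \<in> W \<Longrightarrow> t \<noteq> None \<Longrightarrow> p None t = 0"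
begin

lemma AE_alive:
  assumes s: "s \<in> W"
  shows "AE S in walk s. \<forall>n. S n \<noteq> None \<longrightarrow> (\<forall>i\<le>n. S i \<in> W - {None})"
proof (cases "None \<in> W")
  case True
  have "AE S in walk s. \<forall>n i. S i = None \<longrightarrow> S (i + n) = None"
    by (rule AE_absorbed[OF s absorbing[OF True]])
  then show ?thesis using AE_space
  proof eventually_elim
    case (elim S)
    show ?case
    proof (intro allI impI)
      fix n i assume *: "S n \<noteq> None" "i \<le> n"
      have "S i \<noteq> None" using elim(1)[rule_format, of i "n - i"] * by auto
      then show "S i \<in> W - {None}" using in_space_walk[OF elim(2)] by simp
    qed
  qed
next
  case False
  show ?thesis using AE_space
  proof eventually_elim
    case (elim S)
    have "S i \<in> W - {None}" for i
      using in_space_walk[OF elim, of i] False by (cases "S i") auto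
    then show ?case by simp
  qed
qed

end

text \<open>Finitely many predecessors, together with finitely many successors, make coverage of a
  vertex depend on finitely many possible edges. The passage to infinite vertex sets rests on
  this.\<close>

locale transient_kernel = absorbing_kernel W p
  for W :: "'a option set" and p :: "'a option \<Rightarrow> 'a option \<Rightarrow> real" +
  fixes V :: "'a set" and en :: "nat \<Rightarrow> 'a"
  assumes V_eq: "V = Some -` W"
    and range_en: "range en = V"
    and finite_predecessors: "\<And>y. y \<in> V \<Longrightarrow> finite {s \<in> W. p s (Some y) \<noteq> 0}"
    and transient: "\<And>x y. x \<in> V \<Longrightarrow> y \<in> V \<Longrightarrow>
      summable (\<lambda>n. measure (walk_law W p (Some x)) {S \<in> space (walk_law W p (Some x)). S n = Some y})"
begin

lemma Some_W [simp]: "Some x \<in> W \<longleftrightarrow> x \<in> V"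
  by (simp add: V_eq)

lemma en_V [simp]: "en i \<in> V"
  using range_en by blast

lemma countable_V: "countable V"
  unfolding range_en[symmetric] by simp

lemma W_cases: "s \<in> W \<Longrightarrow> s = None \<or> (\<exists>x\<in>V. s = Some x)"
  by (cases s) auto

lemma transient_states:
  assumes "x \<in> W - {None}" "y \<in> W - {None}"
  shows "summable (\<lambda>n. hit_prob x n y)"
proof -
  obtain a b where "x = Some a" "y = Some b" using assms by auto
  then show ?thesis using transient[of a b] assms by simp
qed

section \<open>Families of independent walks and measurability of the algorithm\<close>

abbreviation walks :: "('a \<Rightarrow> nat \<Rightarrow> 'a option) measure" where
  "walks \<equiv> \<Pi>\<^sub>M x\<in>V. walk (Some x)"

abbreviation edges_event :: "('a option \<times> 'a option) list \<Rightarrow> 'a set \<Rightarrow> ('a \<Rightarrow> nat \<Rightarrow> 'a option) set" where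
  "edges_event es D \<equiv> {X \<in> space walks. set es \<subseteq> domain_edges D en X}"

definition proper :: "('a \<Rightarrow> nat \<Rightarrow> 'a option) \<Rightarrow> bool" where
  "proper X \<longleftrightarrow> (\<forall>x\<in>V. \<forall>n. X x n \<in> W)"

lemma proper_walks: "X \<in> space walks \<Longrightarrow> proper X"
  unfolding proper_def space_PiM by (metis PiE_mem in_space_walk)

lemma domain_rounds_subset: "proper X \<Longrightarrow> domain_rounds D en X j \<subseteq> W \<times> W"
proof (induction j)
  case (Suc j)
  have "e \<in> W \<times> W" if "e \<in> loop_erased_edges A (X (en i))" for e A i
    using loop_erased_edges_in_range[OF that] Suc.prems by (auto simp: proper_def mem_Times_iff)
  then show ?case using Suc by (auto simp: in_domain_rounds_Suc_iff)
qed simp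

text \<open>For \<open>D = V\<close> the only state covered from the start that a proper walk can
  visit is \<open>None\<close>, which is also where \<open>wilson_rounds\<close> stops a
  walk.\<close>

lemma wilson_rounds_eq:
  assumes X: "proper X"
  shows "wilson_rounds en X j = domain_rounds V en X j"
proof (induction j)
  case (Suc j)
  define F where "F = domain_rounds V en X j"
  have start: "Some (en i) \<in> - Some ` V \<union> Field F \<longleftrightarrow> Some (en i) \<in> Field F" for i by auto
  have "loop_erased_edges (insert None (Field F)) (X (en i)) = loop_erased_edges (- Some ` V \<union> Field F) (X (en i))" for i
  proof (rule loop_erased_edges_cong)
    fix n
    have "X (en i) n \<in> W" using X by (simp add: proper_def)
    then show "X (en i) n \<in> insert None (Field F) \<longleftrightarrow> X (en i) n \<in> - Some ` V \<union> Field F"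
      using W_cases[of "X (en i) n"] by (elim meta_impE disjE bexE) auto
  qed
  then show ?case using Suc by (simp add: domain_rounds.simps(2) Let_def start F_def)
qed simp

lemma wilson_edges_eq: "proper X \<Longrightarrow> wilson_edges en X = domain_edges V en X"
  by (simp add: wilson_edges_def domain_edges_def wilson_rounds_eq)

lemma pred_step [measurable]: "x \<in> V \<Longrightarrow> Measurable.pred walks (\<lambda>X. X x n = t)"
proof -
  assume "x \<in> V"
  then have "(\<lambda>X. X x) \<in> measurable walks (walk (Some x))"
    by (rule measurable_component_singleton)
  moreover have "Measurable.pred (walk (Some x)) (\<lambda>S. S n = t)"
    using step_event[of "Some x" n t] by (simp add: pred_def)
  ultimately show ?thesis by (rule measurable_compose)
qed

text \<open>The target set varies with the walks, so the event is split over the countably many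
  possible values of \<open>X x n\<close>.\<close>

lemma pred_step_in:
  assumes "x \<in> V" "\<And>s. s \<in> W \<Longrightarrow> Measurable.pred walks (\<lambda>X. s \<in> A X)"
  shows "Measurable.pred walks (\<lambda>X. X x n \<in> A X)"
proof -
  have "Measurable.pred walks (\<lambda>X. \<exists>s\<in>W. X x n = s \<and> s \<in> A X)"
    by (intro pred_countable_Bex countable_W pred_intros_logic pred_step assms)
  moreover have "(X x n \<in> A X) = (\<exists>s\<in>W. X x n = s \<and> s \<in> A X)" if "X \<in> space walks" for X
    using proper_walks[OF that] assms(1) by (auto simp: proper_def)
  ultimately show ?thesis by (subst measurable_cong) auto
qed

lemma pred_erased_prefix:
  assumes "x \<in> V"
  shows "Measurable.pred walks (\<lambda>X. e \<in> erased_prefix (X x) n)"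
proof -
  \<comment> \<open>The event depends on the first \<open>Suc n\<close> states only, hence is a
    countable union over words.\<close>
  let ?L = "{l \<in> lists W. length l = Suc n \<and> e \<in> path_edges (loop_erase l)}"
  have "Measurable.pred walks (\<lambda>X. \<exists>l\<in>?L. \<forall>i<Suc n. X x i = l ! i)"
    by (intro pred_countable_Bex countable_Collect countable_lists countable_W pred_intros_countable
        pred_intros_logic pred_step assms measurable_const) simp_all
  moreover have "(e \<in> erased_prefix (X x) n) = (\<exists>l\<in>?L. \<forall>i<Suc n. X x i = l ! i)"
    if "X \<in> space walks" for X
  proof
    assume "e \<in> erased_prefix (X x) n"
    then show "\<exists>l\<in>?L. \<forall>i<Suc n. X x i = l ! i"
      using proper_walks[OF that] assms
      by (intro bexI[of _ "map (X x) [0..<Suc n]"]) (auto simp: proper_def erased_prefix_def simp del: upt_Suc)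
  next
    assume "\<exists>l\<in>?L. \<forall>i<Suc n. X x i = l ! i"
    then obtain l where l: "l \<in> ?L" "\<forall>i<Suc n. X x i = l ! i" by blast
    then have "map (X x) [0..<Suc n] = l" by (intro nth_equalityI) (auto simp del: upt_Suc)
    then show "e \<in> erased_prefix (X x) n" using l by (simp add: erased_prefix_def del: upt_Suc)
  qed
  ultimately show ?thesis by (subst measurable_cong) auto
qed

lemma pred_domain_rounds: "Measurable.pred walks (\<lambda>X. e \<in> domain_rounds D en X j)"
proof (induction j arbitrary: e)
  case (Suc j)
  have cov: "Measurable.pred walks (\<lambda>X. s \<in> covered D en X j)" for s
  proof -
    have "Measurable.pred walks (\<lambda>X. s \<in> - Some ` D \<or>
      (\<exists>t\<in>W. (s, t) \<in> domain_rounds D en X j \<or> (t, s) \<in> domain_rounds D en X j))"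
      by (intro pred_countable_Bex countable_W pred_intros_logic measurable_const Suc) simp_all
    moreover have "(s \<in> covered D en X j) = (s \<in> - Some ` D \<or>
      (\<exists>t\<in>W. (s, t) \<in> domain_rounds D en X j \<or> (t, s) \<in> domain_rounds D en X j))" if "X \<in> space walks" for X
      using domain_rounds_subset[OF proper_walks[OF that], of D j] by (auto simp: covered_def Field_def)
    ultimately show ?thesis by (subst measurable_cong) auto
  qed
  have step: "Measurable.pred walks (\<lambda>X. X (en i) n \<in> covered D en X j)" for i n
    by (rule pred_step_in) (auto intro: cov)
  show ?case
    unfolding in_domain_rounds_Suc_iff in_loop_erased_edges_iff
    by (intro pred_intros_logic pred_intros_countable Suc cov step pred_erased_prefix en_V) simp_all
qed simp

lemma pred_domain_edges: "Measurable.pred walks (\<lambda>X. e \<in> domain_edges D en X)"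
  unfolding domain_edges_def UN_iff by (intro pred_countable_Bex countableI_type pred_domain_rounds)

lemma domain_edges_event: "(edges_event es D) \<in> sets walks"
proof -
  have "Measurable.pred walks (\<lambda>X. \<forall>e\<in>set es. e \<in> domain_edges D en X)"
    by (intro pred_intros_finite pred_domain_edges) auto
  then show ?thesis by (simp add: pred_def subset_eq)
qed

lemma measure_wilson:
  "measure (wilson_measure W p en) {F. set es \<subseteq> F} =
    measure walks (edges_event es V)"
proof -
  let ?N = "sigma UNIV (range (\<lambda>e. {F. e \<in> F})) :: ('a option \<times> 'a option) set measure"
  have "wilson_edges en \<in> measurable walks ?N"
  proof (rule measurable_measure_of)
    fix A assume "A \<in> range (\<lambda>e. {F :: ('a option \<times> 'a option) set. e \<in> F})"
    then obtain e where A: "A = {F. e \<in> F}" by blast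
    have "wilson_edges en -` A \<inter> space walks = {X \<in> space walks. e \<in> domain_edges V en X}"
      using wilson_edges_eq[OF proper_walks] by (auto simp: A)
    then show "wilson_edges en -` A \<inter> space walks \<in> sets walks"
      using pred_domain_edges[of e V] by (simp add: pred_def)
  qed auto
  moreover have "{F. set es \<subseteq> F} \<in> sets ?N"
  proof -
    have "{F :: ('a option \<times> 'a option) set. set es \<subseteq> F} = {F \<in> space ?N. \<forall>e\<in>set es. e \<in> F}"
      by (auto simp: space_measure_of_conv)
    also have "\<dots> \<in> sets ?N"
      by (intro sets.sets_Collect_finite_All) (auto simp: space_measure_of_conv)
    finally show ?thesis .
  qed
  moreover have "wilson_edges en -` {F. set es \<subseteq> F} \<inter> space walks = (edges_event es V)"
    using wilson_edges_eq[OF proper_walks] by auto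
  ultimately show ?thesis
    unfolding wilson_measure_def V_eq[symmetric] by (simp add: measure_distr)
qed

text \<open>The locale asks for a probability space at every index; outside \<open>V\<close> the
  walk from \<open>en 0\<close> serves as a default.\<close>

lemma product_prob_space_walks: "product_prob_space (\<lambda>x. walk (Some (if x \<in> V then x else en 0)))"
  by (intro product_prob_space.intro product_sigma_finite.intro product_prob_space_axioms.intro
      prob_space_imp_sigma_finite prob_space_walk) auto

lemma emeasure_walks_Collect:
  assumes "J \<subseteq> V" "finite J" "\<And>x. x \<in> J \<Longrightarrow> A x \<in> sets (walk (Some x))"
  shows "emeasure walks {X \<in> space walks. \<forall>x\<in>J. X x \<in> A x} = (\<Prod>x\<in>J. emeasure (walk (Some x)) (A x))"
    and "{X \<in> space walks. \<forall>x\<in>J. X x \<in> A x} \<in> sets walks"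
proof -
  interpret product_prob_space "\<lambda>x. walk (Some (if x \<in> V then x else en 0))" V
    by (rule product_prob_space_walks)
  have eq: "walks = (\<Pi>\<^sub>M x\<in>V. walk (Some (if x \<in> V then x else en 0)))"
    by (intro PiM_cong) auto
  have "emeasure walks {X \<in> space walks. \<forall>x\<in>J. X x \<in> A x} =
    (\<Prod>x\<in>J. emeasure (walk (Some (if x \<in> V then x else en 0))) (A x))"
    unfolding eq using assms by (intro emeasure_PiM_Collect) auto
  also have "\<dots> = (\<Prod>x\<in>J. emeasure (walk (Some x)) (A x))"
    using assms(1) by (intro prod.cong) auto
  finally show "emeasure walks {X \<in> space walks. \<forall>x\<in>J. X x \<in> A x} = (\<Prod>x\<in>J. emeasure (walk (Some x)) (A x))" .
  show "{X \<in> space walks. \<forall>x\<in>J. X x \<in> A x} \<in> sets walks"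
  proof (intro sets.sets_Collect_finite_All assms(2))
    fix x assume x: "x \<in> J"
    then have "(\<lambda>X. X x) -` A x \<inter> space walks \<in> sets walks"
      using assms by (intro measurable_sets[OF measurable_component_singleton]) auto
    then show "{X \<in> space walks. X x \<in> A x} \<in> sets walks"
      by (simp add: vimage_def Collect_conj_eq Int_commute)
  qed
qed

lemma prob_space_walks: "prob_space walks"
  by (intro prob_space_PiM prob_space_walk) auto

text \<open>\<open>R\<close> is the set of states still uncovered. As long as every round erases to
  a piece of \<open>f\<close>, the starting points of the later rounds depend only on
  \<open>f\<close> and the enumeration, so one fixed event for each walk from \<open>J\<close>
  suffices. The last clause is stated for every \<open>j\<close> so that the induction can resume in
  the middle of a run.\<close>

lemma domain_edges_lower:
  assumes "finite R" "R \<subseteq> Some ` D" "D \<subseteq> V" "\<And>x. x \<in> R \<Longrightarrow> f x \<in> W" "acyclic (fun_graph R f)"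
  shows "\<exists>J A. J \<subseteq> Some -` R \<and> (\<forall>x\<in>J. A x \<in> sets (walk (Some x))) \<and>
    (\<Prod>x\<in>J. emeasure (walk (Some x)) (A x)) = ennreal ((\<Prod>t\<in>R. p t (f t)) / walk_det p R) \<and>
    (\<forall>X j. (\<forall>x\<in>J. X x \<in> A x) \<longrightarrow> covered D en X j = - R \<longrightarrow>
      domain_edges D en X = domain_rounds D en X j \<union> fun_graph R f)"
  using assms
proof (induction R rule: finite_psubset_induct)
  case (psubset R)
  note prems = psubset.prems
  have RW: "R \<subseteq> W"
  proof
    fix x assume "x \<in> R"
    then obtain d where "x = Some d" "d \<in> D" using prems(1) by blast
    then show "x \<in> W" using prems(2) by auto
  qed
  have trans: "summable (\<lambda>n. hit_prob x n y)" if "x \<in> R" "y \<in> R" for x y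
    using that RW prems(1) by (intro transient_states) auto
  show ?case
  proof (cases "R = {}")
    case True
    show ?thesis
    proof (intro exI[of _ "{}"] exI[of _ "\<lambda>x. {}"] conjI allI impI)
      fix X j assume "covered D en X j = - R"
      then have "domain_edges D en X = domain_rounds D en X j"
        using True by (intro domain_edges_eq_rounds) auto
      then show "domain_edges D en X = domain_rounds D en X j \<union> fun_graph R f"
        using True by (simp add: fun_graph_def)
    qed (use True in auto)
  next
    case False
    then obtain y where y: "Some y \<in> R" using prems(1) by blast
    then have "y \<in> V" using prems by blast
    then obtain i0 where "en i0 = y" using range_en by (metis imageE)
    then have ex: "\<exists>i. Some (en i) \<in> R" using y by blast
    define i where "i = (LEAST i. Some (en i) \<in> R)"
    define x where "x = en i"
    have i: "Some x \<in> R" "\<And>k. k < i \<Longrightarrow> Some (en k) \<notin> R"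
      unfolding i_def x_def using LeastI_ex[OF ex] not_less_Least by blast+
    obtain A0 Q where A0: "A0 \<in> sets (walk (Some x))" and Q: "Q \<subseteq> R" "Some x \<in> Q"
      and em: "emeasure (walk (Some x)) A0 = ennreal ((\<Prod>t\<in>Q. p t (f t)) *
        (walk_det p (R - Q) / walk_det p R))"
      and le: "\<And>S. S \<in> A0 \<Longrightarrow> loop_erased_edges (- R) S = fun_graph Q f"
      and fQ: "f ` Q \<subseteq> Q \<union> - R"
      using loop_erasure_event[OF psubset(1) RW trans prems(3,4) i(1)] by blast
    define R' where "R' = R - Q"
    have R': "R' \<subset> R" "R' \<subseteq> Some ` D" "Some x \<notin> R'" using Q prems by (auto simp: R'_def)
    have T': "fun_graph R' f \<subseteq> fun_graph R f" using R' by (auto simp: fun_graph_def)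
    have ac: "acyclic (fun_graph R' f)" using T' prems(4) acyclic_subset by blast
    have fW: "f t \<in> W" if "t \<in> R'" for t using that R' prems(3) by blast
    obtain J' A' where J': "J' \<subseteq> Some -` R'" "\<forall>x\<in>J'. A' x \<in> sets (walk (Some x))"
      and em': "(\<Prod>x\<in>J'. emeasure (walk (Some x)) (A' x)) = ennreal ((\<Prod>t\<in>R'. p t (f t)) / walk_det p R')"
      and run: "\<And>X j. (\<forall>x\<in>J'. X x \<in> A' x) \<Longrightarrow> covered D en X j = - R' \<Longrightarrow>
        domain_edges D en X = domain_rounds D en X j \<union> fun_graph R' f"
      using psubset.IH[OF R'(1,2) prems(2) fW ac] by blast
    have x: "x \<notin> J'" using J' R' by blast
    have finJ: "finite J'"
      using J'(1) psubset(1) R'(1) by (meson finite_subset finite_vimageI inj_Some psubset_imp_subset)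
    define A where "A = A'(x := A0)"
    have det_pos: "walk_det p S > 0" if "S \<subseteq> R" for S
    proof (rule det_killed_matrix_pos)
      show "finite S" using that psubset(1) finite_subset by blast
      show "S \<subseteq> W" using that RW by blast
      show "summable (\<lambda>n. hit_prob x n y)" if "x \<in> S" "y \<in> S" for x y
        using that \<open>S \<subseteq> R\<close> by (intro trans) auto
    qed
    have nonneg: "(\<Prod>t\<in>S. p t (f t)) \<ge> 0" if "S \<subseteq> R" for S
      using that RW prems(3) by (intro prod_nonneg ballI p_nonneg) auto
    show ?thesis
    proof (intro exI[of _ "insert x J'"] exI[of _ A] conjI allI impI)
      show "insert x J' \<subseteq> Some -` R" using i(1) J' R'(1) by auto
      show "\<forall>x\<in>insert x J'. A x \<in> sets (walk (Some x))" using J'(2) A0 by (simp add: A_def)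
      have "(\<Prod>x\<in>insert x J'. emeasure (walk (Some x)) (A x)) =
        emeasure (walk (Some x)) A0 * (\<Prod>x\<in>J'. emeasure (walk (Some x)) (A' x))"
      proof -
        have "(\<Prod>x\<in>J'. emeasure (walk (Some x)) (A x)) = (\<Prod>x\<in>J'. emeasure (walk (Some x)) (A' x))"
          using x by (intro prod.cong) (auto simp: A_def)
        then show ?thesis using x finJ by (simp add: A_def)
      qed
      also have "\<dots> = ennreal (((\<Prod>t\<in>Q. p t (f t)) * (walk_det p R' / walk_det p R)) *
         ((\<Prod>t\<in>R'. p t (f t)) / walk_det p R'))"
        unfolding em em' R'_def[symmetric]
        using nonneg[OF Q(1)] nonneg[of R'] det_pos[of R'] det_pos[of R] R'(1)
        by (intro ennreal_mult[symmetric]) (auto intro!: mult_nonneg_nonneg divide_nonneg_nonneg)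
      also have "((\<Prod>t\<in>Q. p t (f t)) * (walk_det p R' / walk_det p R)) *
         ((\<Prod>t\<in>R'. p t (f t)) / walk_det p R') = (\<Prod>t\<in>R. p t (f t)) / walk_det p R"
      proof -
        have "walk_det p R' \<noteq> 0" using det_pos[of R'] R'(1) by auto
        moreover have "(\<Prod>t\<in>R. p t (f t)) = (\<Prod>t\<in>R'. p t (f t)) * (\<Prod>t\<in>Q. p t (f t))"
          unfolding R'_def by (rule prod.subset_diff[OF Q(1) psubset(1)])
        ultimately show ?thesis by simp
      qed
      finally show "(\<Prod>x\<in>insert x J'. emeasure (walk (Some x)) (A x)) =
         ennreal ((\<Prod>t\<in>R. p t (f t)) / walk_det p R)" .
    next
      fix X j assume X: "\<forall>x\<in>insert x J'. X x \<in> A x" and cov: "covered D en X j = - R"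
      have "X x \<in> A0" using X by (simp add: A_def)
      have XJ': "\<forall>x\<in>J'. X x \<in> A' x" using X x by (auto simp: A_def split: if_splits)
      have "domain_rounds D en X (Suc j) = domain_rounds D en X j \<union> loop_erased_edges (covered D en X j) (X (en i))"
        using i by (intro domain_rounds_Suc_start) (auto simp: cov x_def)
      then have rounds: "domain_rounds D en X (Suc j) = domain_rounds D en X j \<union> fun_graph Q f"
        using le[OF \<open>X x \<in> A0\<close>] by (simp add: cov x_def)
      have "Field (fun_graph Q f) = Q \<union> f ` Q" by (force simp: Field_def fun_graph_def)
      then have "covered D en X (Suc j) = covered D en X j \<union> (Q \<union> f ` Q)"
        unfolding covered_def rounds by (auto simp: Field_Un)
      then have "covered D en X (Suc j) = - R'" using fQ by (auto simp: cov R'_def)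
      from run[OF XJ' this] show "domain_edges D en X = domain_rounds D en X j \<union> fun_graph R f"
        using rounds Q(1) by (auto simp: R'_def fun_graph_def)
    qed
  qed
qed

lemma prob_domain_edges_sum:
  assumes D: "finite D" "D \<subseteq> V" and R: "R = Some ` D"
  shows "measure walks (edges_event es D) =
    (\<Sum>f | f \<in> steps R \<and> acyclic (fun_graph R f) \<and> set es \<subseteq> fun_graph R f.
      \<Prod>x\<in>R. p x (f x)) / walk_det p R"
proof -
  interpret prob_space walks by (rule prob_space_walks)
  define T where "T = {f \<in> steps R. acyclic (fun_graph R f)}"
  define w where "w = (\<lambda>f. (\<Prod>x\<in>R. p x (f x)) / walk_det p R)"
  have RW: "finite R" "R \<subseteq> W" using D R by auto
  have "finite (steps R)"
    using RW by (intro finite_PiE p_finite) auto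
  then have finT: "finite T" by (rule rev_finite_subset) (auto simp: T_def)
  have det_pos: "walk_det p R > 0"
    using RW transient D R by (intro det_killed_matrix_pos) auto
  have "\<exists>B. B \<in> sets walks \<and> measure walks B = w f \<and> (\<forall>X\<in>B. X \<in> space walks \<and> domain_edges D en X = fun_graph R f)"
    if f: "f \<in> T" for f
  proof -
    have fW: "f x \<in> W" if "x \<in> R" for x using f that by (auto simp: T_def dest: PiE_mem)
    have ac: "acyclic (fun_graph R f)" using f by (simp add: T_def)
    have RD: "R \<subseteq> Some ` D" using R by simp
    obtain J A where J: "J \<subseteq> Some -` R" "\<forall>x\<in>J. A x \<in> sets (walk (Some x))"
      and em: "(\<Prod>x\<in>J. emeasure (walk (Some x)) (A x)) = ennreal (w f)"
      and run: "\<And>X j. (\<forall>x\<in>J. X x \<in> A x) \<Longrightarrow> covered D en X j = - R \<Longrightarrow>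
        domain_edges D en X = domain_rounds D en X j \<union> fun_graph R f"
      using domain_edges_lower[OF RW(1) RD D(2) fW ac] unfolding w_def by blast
    have JV: "J \<subseteq> V" "finite J" using J(1) R D by (auto intro: finite_subset)
    define B where "B = {X \<in> space walks. \<forall>x\<in>J. X x \<in> A x}"
    have "emeasure walks B = ennreal (w f)" "B \<in> sets walks"
      unfolding B_def using emeasure_walks_Collect[OF JV, of A] J(2) em by auto
    moreover have "w f \<ge> 0"
      unfolding w_def using det_pos RW fW by (intro divide_nonneg_pos prod_nonneg ballI p_nonneg) auto
    ultimately have "measure walks B = w f" by (simp add: measure_def)
    \<comment> \<open>At \<open>j = 0\<close> exactly the complement of \<open>R\<close> is
      covered.\<close>
    moreover have "domain_edges D en X = fun_graph R f" if "X \<in> B" for X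
      using run[of X 0] that by (simp add: B_def covered_def R)
    ultimately show ?thesis using \<open>B \<in> sets walks\<close> by (intro exI[of _ B]) (auto simp: B_def)
  qed
  then obtain B where B: "\<And>f. f \<in> T \<Longrightarrow> B f \<in> sets walks" "\<And>f. f \<in> T \<Longrightarrow> measure walks (B f) = w f"
    "\<And>f X. f \<in> T \<Longrightarrow> X \<in> B f \<Longrightarrow> X \<in> space walks \<and> domain_edges D en X = fun_graph R f"
    by metis
  have inj: "f = g" if "f \<in> T" "g \<in> T" "fun_graph R f = fun_graph R g" for f g
  proof (rule PiE_ext[of f R _ g])
    show "f x = g x" if "x \<in> R" for x
      using \<open>fun_graph R f = fun_graph R g\<close> that by (metis in_fun_graph)
  qed (use that in \<open>auto simp: T_def\<close>)
  have disj: "disjoint_family_on B T"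
    unfolding disjoint_family_on_def using B(3) inj by (metis disjoint_iff)
  have meas_U: "measure walks (\<Union>f\<in>U. B f) = (\<Sum>f\<in>U. w f)" if "U \<subseteq> T" for U
  proof -
    have "measure walks (\<Union>f\<in>U. B f) = (\<Sum>f\<in>U. measure walks (B f))"
      using that B(1) finT disj
      by (intro finite_measure_finite_Union) (auto intro: finite_subset disjoint_family_on_mono)
    then show ?thesis using B(2) that by (simp add: subset_eq)
  qed
  have "(\<Sum>f\<in>T. w f) = 1"
    using sum_acyclic_eq_det[OF RW] det_pos
    by (simp add: w_def T_def Collect_conj_eq sum_divide_distrib[symmetric])
  then have "prob (\<Union>f\<in>T. B f) = 1" using meas_U[of T] by simp
  then have ae: "AE X in walks. X \<in> (\<Union>f\<in>T. B f)" by (rule AE_prob_1)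
  let ?U = "{f \<in> T. set es \<subseteq> fun_graph R f}"
  have "measure walks (edges_event es D) = measure walks (\<Union>f\<in>?U. B f)"
  proof (rule finite_measure_eq_AE[OF _ domain_edges_event])
    show "AE X in walks. (X \<in> (edges_event es D)) = (X \<in> (\<Union>f\<in>?U. B f))"
      using ae by eventually_elim (use B(3) in blast)
    show "(\<Union>f\<in>?U. B f) \<in> sets walks" using finT B(1) by (intro sets.finite_UN) auto
  qed
  also have "\<dots> = (\<Sum>f\<in>?U. w f)" by (rule meas_U) auto
  also have "\<dots> = (\<Sum>f | f \<in> steps R \<and> acyclic (fun_graph R f) \<and> set es \<subseteq> fun_graph R f.
      \<Prod>x\<in>R. p x (f x)) / walk_det p R"
    unfolding w_def sum_divide_distrib by (rule sum.cong) (auto simp: T_def)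
  finally show ?thesis .
qed

end

section \<open>The transfer-current determinant for a finite domain\<close>

lemma det_on_zero_column:
  assumes R: "finite R" and y: "y \<in> R" "\<And>x. x \<in> R \<Longrightarrow> M x y = 0"
  shows "det_on R M = 0"
  unfolding det_on_def
proof (intro sum.neutral ballI)
  fix \<pi> assume "\<pi> \<in> {\<pi>. \<pi> permutes R}"
  then have "\<pi> ` R = R" by (auto simp: permutes_image)
  then obtain x where "x \<in> R" "\<pi> x = y" using y(1) by (metis imageE)
  then have "(\<Prod>x\<in>R. M x (\<pi> x)) = 0" using y(2) by (intro prod_zero[OF R]) auto
  then show "of_int (sign \<pi>) * (\<Prod>x\<in>R. M x (\<pi> x)) = 0" by simp
qed

lemma det_on_identical_columns:
  fixes M :: "nat \<Rightarrow> nat \<Rightarrow> 'r::comm_ring_1"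
  assumes ij: "i < n" "j < n" "i \<noteq> j" and eq: "\<And>k. k < n \<Longrightarrow> M k i = M k j"
  shows "det_on {0..<n} M = 0"
  unfolding det_mat_eq_det_on[symmetric]
  by (rule det_identical_columns[OF _ ij(3,1,2)]) (use ij eq in \<open>auto intro!: eq_vecI\<close>)

lemma sum_of_bool_times:
  fixes h :: "'s \<Rightarrow> 'r::semiring_1"
  assumes "finite R"
  shows "(\<Sum>z\<in>R. of_bool (x = z) * h z) = (if x \<in> R then h x else 0)"
proof -
  have "(\<Sum>z\<in>R. of_bool (x = z) * h z) = (\<Sum>z\<in>R. if x = z then h z else 0)"
    by (intro sum.cong) auto
  then show ?thesis using assms by simp
qed

context transient_kernel begin

text \<open>A walk started outside \<open>R\<close> counts as already stopped, hence the value
  0.\<close>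

abbreviation killed_green :: "'a option set \<Rightarrow> 'a option \<Rightarrow> 'a option \<Rightarrow> real" where
  "killed_green R s t \<equiv> if s \<in> R then green p R s t else 0"

lemma forced_acyclic_sum:
  assumes R: "finite R" "R \<subseteq> W" and s: "\<And>x y. x \<in> R \<Longrightarrow> y \<in> R \<Longrightarrow> summable (\<lambda>n. hit_prob x n y)"
    and S: "S \<subseteq> R" and g: "\<And>x. x \<in> S \<Longrightarrow> g x \<in> W \<and> p x (g x) \<noteq> 0"
  shows "(\<Sum>f | f \<in> steps R \<and> acyclic (fun_graph R f) \<and> fun_graph S g \<subseteq> fun_graph R f.
      \<Prod>x\<in>R. p x (f x)) / walk_det p R =
    (\<Prod>x\<in>S. p x (g x)) * det_on S (\<lambda>x y. green p R x y - killed_green R (g x) y)"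
proof -
  \<comment> \<open>An edge is forced by shrinking the choice set at its source to one element; the
    weights stay the same and \<open>matrix_tree\<close> still applies.\<close>
  define N where "N = (\<lambda>x. if x \<in> S then {g x} else {u \<in> W. p x u \<noteq> 0})"
  have finN: "finite (N x)" if "x \<in> R" for x using that R p_finite by (auto simp: N_def)
  have eq: "f \<in> steps R \<and> fun_graph S g \<subseteq> fun_graph R f \<longleftrightarrow> f \<in> PiE R N" for f
  proof -
    have "fun_graph S g \<subseteq> fun_graph R f \<longleftrightarrow> (\<forall>x\<in>S. f x = g x)"
      using S by (auto simp: fun_graph_def)
    moreover have "f \<in> PiE R N \<longleftrightarrow> f \<in> extensional R \<and> (\<forall>x\<in>R - S. f x \<in> W \<and> p x (f x) \<noteq> 0) \<and> (\<forall>x\<in>S. f x = g x)"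
      using S by (auto simp: PiE_iff N_def)
    moreover have "(\<forall>x\<in>S. f x = g x) \<Longrightarrow> (\<forall>x\<in>S. f x \<in> W \<and> p x (f x) \<noteq> 0)"
      using g by simp
    ultimately show ?thesis using S by (auto simp: PiE_iff)
  qed
  define B where "B = (\<lambda>x y. \<Sum>u\<in>N x. p x u * (of_bool (x = y) - of_bool (u = y)))"
  have sum: "(\<Sum>f | f \<in> steps R \<and> acyclic (fun_graph R f) \<and> fun_graph S g \<subseteq> fun_graph R f.
      \<Prod>x\<in>R. p x (f x)) = det_on R B"
  proof -
    have "{f. f \<in> steps R \<and> acyclic (fun_graph R f) \<and> fun_graph S g \<subseteq> fun_graph R f} =
      {f. f \<in> PiE R N \<and> acyclic (fun_graph R f)}"
      unfolding eq[symmetric] by blast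
    then show ?thesis unfolding B_def using matrix_tree[OF R(1) finN] by simp
  qed
  note sr = summable_restricted_prob[OF R _ s]
  have BG: "(\<Sum>z\<in>R. B x z * green p R z y) =
    (if x \<in> S then p x (g x) * (green p R x y - killed_green R (g x) y) else of_bool (x = y))"
    if xy: "x \<in> R" "y \<in> R" for x y
  proof (cases "x \<in> S")
    case True
    have "(\<Sum>z\<in>R. B x z * green p R z y) =
      p x (g x) * ((\<Sum>z\<in>R. of_bool (x = z) * green p R z y) - (\<Sum>z\<in>R. of_bool (g x = z) * green p R z y))"
      using True by (simp add: B_def N_def sum_subtractf[symmetric] sum_distrib_left algebra_simps)
    also have "(\<Sum>z\<in>R. of_bool (x = z) * green p R z y) = green p R x y"
      using R xy by (simp add: sum_of_bool_times)
    also have "(\<Sum>z\<in>R. of_bool (g x = z) * green p R z y) = killed_green R (g x) y"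
      using R by (simp add: sum_of_bool_times)
    finally show ?thesis using True by simp
  next
    case False
    have "B x z = of_bool (x = z) - p x z" if "z \<in> R" for z
      using False killed_matrix_eq_sum[OF subsetD[OF R(2) xy(1)] subsetD[OF R(2) that]]
      by (simp add: B_def N_def killed_matrix_def)
    then have "(\<Sum>z\<in>R. B x z * green p R z y) = (\<Sum>z\<in>R. of_bool (x = z) * green p R z y) - (\<Sum>z\<in>R. p x z * green p R z y)"
      by (simp add: sum_subtractf[symmetric] left_diff_distrib)
    also have "(\<Sum>z\<in>R. of_bool (x = z) * green p R z y) = green p R x y"
      using R xy by (simp add: sum_of_bool_times)
    also have "(\<Sum>z\<in>R. p x z * green p R z y) = green p R x y - of_bool (x = y)"
      by (rule green_equation_right[OF R(1) xy sr])
    finally show ?thesis using False by simp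
  qed
  let ?H = "\<lambda>x y. green p R x y - killed_green R (g x) y"
  have "det_on R B * det_on R (green p R) = det_on R (\<lambda>x y. \<Sum>z\<in>R. B x z * green p R z y)"
    by (rule det_on_mult[OF R(1), symmetric])
  also have "\<dots> = det_on S (\<lambda>x y. \<Sum>z\<in>R. B x z * green p R z y)"
    by (rule det_on_identity_rows[OF R(1) S]) (auto simp: BG)
  also have "\<dots> = det_on S (\<lambda>x y. p x (g x) * ?H x y)"
    using S by (intro det_on_cong) (auto simp: BG subset_eq)
  also have "\<dots> = (\<Prod>x\<in>S. p x (g x)) * det_on S ?H"
    by (rule det_on_scale_rows)
  finally have "det_on R B * det_on R (green p R) = (\<Prod>x\<in>S. p x (g x)) * det_on S ?H" .
  moreover have "det_on R (green p R) * walk_det p R = 1"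
    by (intro det_on_resolvent[OF R(1)] green_equation_left[OF R(1)] sr)
  \<comment> \<open>With \<open>b\<close>, \<open>a\<close>, \<open>d\<close> the determinants of
    \<open>B\<close>, of the Green function and of the killed matrix, division by \<open>d\<close>
    becomes multiplication by \<open>a\<close>.\<close>
  moreover have "b / d = x" if "b * a = x" "a * d = 1" for a b d x :: real
  proof -
    have "d \<noteq> 0" using that(2) by auto
    moreover have "x * d = b" unfolding that(1)[symmetric] mult.assoc that(2) by simp
    ultimately show ?thesis by (simp add: field_simps)
  qed
  ultimately show ?thesis unfolding sum by blast
qed

definition domain_green :: "'a set \<Rightarrow> 'a option \<Rightarrow> 'a option \<Rightarrow> real" where
  "domain_green D s t = killed_green (Some ` D) s t"

abbreviation edge_weight :: "('a option \<times> 'a option) list \<Rightarrow> real" where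
  "edge_weight es \<equiv> \<Prod>e\<leftarrow>es. p (fst e) (snd e)"

text \<open>Column \<open>j\<close> involves only the source of the \<open>j\<close>-th edge, so
  edges with a common source give equal columns.\<close>

abbreviation transfer_matrix ::
    "('a option \<Rightarrow> 'a option \<Rightarrow> real) \<Rightarrow> ('a option \<times> 'a option) list \<Rightarrow> nat \<Rightarrow> nat \<Rightarrow> real" where
  "transfer_matrix K es \<equiv> \<lambda>i j. K (fst (es ! i)) (fst (es ! j)) - K (snd (es ! i)) (fst (es ! j))"

lemma prob_domain_edges_det:
  assumes D: "finite D" "D \<subseteq> V" and es: "distinct es"
    and e: "\<And>e. e \<in> set es \<Longrightarrow> fst e \<in> Some ` D \<and> snd e \<in> W \<and> p (fst e) (snd e) \<noteq> 0"
  shows "measure walks (edges_event es D) =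
    det_on {0..<length es} (transfer_matrix (domain_green D) es)
    * edge_weight es"
proof -
  define R where "R = Some ` D"
  have R: "finite R" "R \<subseteq> W" using D by (auto simp: R_def)
  have s: "summable (\<lambda>n. hit_prob x n y)" if "x \<in> R" "y \<in> R" for x y
    using that D by (intro transient_states) (auto simp: R_def)
  note P = prob_domain_edges_sum[OF D R_def, of es]
  show ?thesis
  proof (cases "distinct (map fst es)")
    \<comment> \<open>Two distinct edges with the same source cannot both lie in the graph of a
      function, so both sides vanish.\<close>
    case False
    then obtain i j where ij: "i < length es" "j < length es" "i \<noteq> j" "fst (es ! i) = fst (es ! j)"
      by (auto simp: distinct_conv_nth)
    then have "snd (es ! i) \<noteq> snd (es ! j)" using es by (metis nth_eq_iff_index_eq prod_eqI)
    then have "\<not> set es \<subseteq> fun_graph R f" for f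
      using ij nth_mem[OF ij(1)] nth_mem[OF ij(2)] by (metis in_fun_graph prod.collapse subsetD)
    then have "measure walks (edges_event es D) = 0"
      unfolding P by simp
    then show ?thesis using ij by (subst det_on_identical_columns[OF ij(1-3)]) auto
  next
    case True
    define S where "S = fst ` set es"
    \<comment> \<open>With distinct sources the list is itself the graph of a function, the form
      used by \<open>forced_acyclic_sum\<close>.\<close>
    define g where "g = (\<lambda>x. THE u. (x, u) \<in> set es)"
    have g: "g x = u" if "(x, u) \<in> set es" for x u
    proof -
      have inj: "inj_on fst (set es)" using True by (simp add: distinct_map)
      have uniq: "u' = u" if "(x, u') \<in> set es" for u'
        using inj_onD[OF inj, of "(x, u')" "(x, u)"] that \<open>(x, u) \<in> set es\<close> by simp
      show ?thesis unfolding g_def by (rule the_equality, rule that) (rule uniq)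
    qed
    have graph: "set es = fun_graph S g"
      by (force simp: S_def fun_graph_def g)
    have "S \<subseteq> R" using e by (auto simp: S_def R_def)
    have gS: "g x \<in> W \<and> p x (g x) \<noteq> 0" if "x \<in> S" for x
      using that e[of "(x, g x)"] graph by auto
    have bij: "bij_betw (\<lambda>i. fst (es ! i)) {0..<length es} S"
    proof (subst bij_betw_cong)
      show "bij_betw ((!) (map fst es)) {0..<length es} S"
        by (rule bij_betw_nth[OF True]) (auto simp: S_def)
    qed simp
    have snd_g: "snd (es ! i) = g (fst (es ! i))" if "i < length es" for i
      by (rule g[symmetric]) (simp add: that)
    have "edge_weight es = (\<Prod>e\<in>set es. p (fst e) (snd e))"
      using es by (simp add: prod.distinct_set_conv_list)
    also have "\<dots> = (\<Prod>x\<in>S. p x (g x))"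
      unfolding graph fun_graph_def by (subst prod.reindex) (auto simp: inj_on_def)
    finally have prod: "edge_weight es = (\<Prod>x\<in>S. p x (g x))" .
    have "measure walks (edges_event es D) =
      (\<Prod>x\<in>S. p x (g x)) * det_on S (\<lambda>x y. green p R x y - killed_green R (g x) y)"
      unfolding P unfolding graph by (rule forced_acyclic_sum[OF R s \<open>S \<subseteq> R\<close> gS])
    also have "det_on S (\<lambda>x y. green p R x y - killed_green R (g x) y) =
      det_on S (\<lambda>x y. domain_green D x y - domain_green D (g x) y)"
      using \<open>S \<subseteq> R\<close> by (intro det_on_cong) (auto simp: domain_green_def R_def)
    also have "\<dots> = det_on {0..<length es} (transfer_matrix (domain_green D) es)"
      unfolding det_on_bij[OF bij finite_atLeastLessThan] by (intro det_on_cong) (simp add: snd_g)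
    finally show ?thesis by (simp add: prod)
  qed
qed

lemma prob_domain_edges_None:
  assumes D: "finite D" "D \<subseteq> V" and e: "e \<in> set es" "fst e = None"
  shows "measure walks (edges_event es D) = 0"
proof -
  have no: "\<not> set es \<subseteq> fun_graph (Some ` D) f" for f using e by (force simp: fun_graph_def)
  show ?thesis unfolding prob_domain_edges_sum[OF D refl] by (simp add: no)
qed

end

section \<open>Exhaustion by finite domains\<close>

lemma path_edges_loop_step:
  "path_edges (takeWhile (\<lambda>z. z \<noteq> y) q @ [y]) \<subseteq> path_edges q \<union> (if q = [] then {} else {(last q, y)})"
proof (induction q)
  case (Cons z q)
  show ?case
  proof (cases "z = y \<or> q = []")
    case False
    have "hd (takeWhile (\<lambda>z. z \<noteq> y) q @ [y]) = hd q" using False by (cases q) auto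
    then show ?thesis using Cons False by (auto simp: path_edges_Cons)
  qed (auto simp: path_edges_Cons)
qed simp

lemma erased_prefix_0 [simp]: "erased_prefix S 0 = {}"
  by (simp add: erased_prefix_def)

text \<open>A step can erase many edges but adds at most its own; an edge with source
  \<open>a\<close> can therefore enter only right after a visit to \<open>a\<close>.\<close>

lemma erased_prefix_Suc: "erased_prefix S (Suc n) \<subseteq> erased_prefix S n \<union> {(S n, S (Suc n))}"
proof -
  have "last (loop_erase (map S [0..<Suc n])) = S n" by (subst last_loop_erase) auto
  moreover have "erased_prefix S (Suc n) =
    path_edges (takeWhile (\<lambda>z. z \<noteq> S (Suc n)) (loop_erase (map S [0..<Suc n])) @ [S (Suc n)])"
    unfolding erased_prefix_def by (subst upt_Suc_append) (simp_all add: loop_erase_snoc[symmetric] del: upt_Suc)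
  ultimately show ?thesis
    using path_edges_loop_step[of "S (Suc n)" "loop_erase (map S [0..<Suc n])"]
    by (auto simp: erased_prefix_def simp del: upt_Suc)
qed

lemma erased_prefix_steps: "e \<in> erased_prefix S n \<Longrightarrow> \<exists>k<n. e = (S k, S (Suc k))"
proof (induction n)
  case (Suc n)
  then show ?case using erased_prefix_Suc[of S n] less_Suc_eq by blast
qed simp

text \<open>After the last visit to \<open>a\<close> the edge can only disappear, so its status
  changes at most once more.\<close>

lemma erased_prefix_eventually_constant:
  assumes "finite {n. S n = a}"
  obtains M b where "\<And>n. n \<ge> M \<Longrightarrow> (a, c) \<in> erased_prefix S n \<longleftrightarrow> b"
proof -
  obtain M where M: "\<And>n. n \<ge> M \<Longrightarrow> S n \<noteq> a"
    using finite_nat_set_iff_bounded[of "{n. S n = a}"] assms by (auto simp: not_le[symmetric])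
  have down: "(a, c) \<in> erased_prefix S n" if "(a, c) \<in> erased_prefix S (n + k)" "n \<ge> M" for n k
    using that
  proof (induction k)
    case (Suc k)
    then have "S (n + k) \<noteq> a" using M by simp
    then show ?case using Suc erased_prefix_Suc[of S "n + k"] by auto
  qed simp
  show ?thesis
  proof (cases "\<exists>n\<ge>M. (a, c) \<notin> erased_prefix S n")
    case True
    then obtain n0 where n0: "n0 \<ge> M" "(a, c) \<notin> erased_prefix S n0" by blast
    have "(a, c) \<notin> erased_prefix S n" if "n \<ge> n0" for n
      using down[of n0 "n - n0"] n0 that by auto
    then show ?thesis using that[of n0 False] by blast
  next
    case False
    then show ?thesis using that[of M True] by blast
  qed
qed

text \<open>Steps are taken before the walk is stopped, hence never from a state of
  \<open>A\<close>. Consequently a covered vertex receives no new outgoing edge.\<close>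

lemma loop_erased_edges_steps:
  assumes e: "e \<in> loop_erased_edges A S"
  obtains k where "e = (S k, S (Suc k))" "S k \<notin> A"
proof (cases rule: hitting_cases[of S A])
  case (hit n)
  then have "e \<in> erased_prefix S n" using e loop_erased_edges_hit by blast
  then obtain k where "k < n" "e = (S k, S (Suc k))" using erased_prefix_steps by blast
  then show ?thesis using hit that by blast
next
  case never
  then obtain n where "e \<in> erased_prefix S n" using e loop_erased_edges_never by blast
  then obtain k where "e = (S k, S (Suc k))" using erased_prefix_steps by blast
  then show ?thesis using never that by blast
qed

text \<open>A round covers the vertex it starts from even when its walk runs forever; this
  guarantees progress through the enumeration.\<close>

lemma start_in_Field_loop_erased_edges:
  assumes "S 0 \<notin> A" "finite {n. S n = S 0}"
  shows "S 0 \<in> Field (loop_erased_edges A S)"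
proof (cases rule: hitting_cases[of S A])
  case (hit n)
  define q where "q = loop_erase (map S [0..<Suc n])"
  have "hd (map S [0..<Suc n]) = S 0" by (simp add: hd_map del: upt_Suc)
  then have "hd q = S 0" unfolding q_def by (subst hd_loop_erase) auto
  moreover have "last q = S n" unfolding q_def by (subst last_loop_erase) auto
  moreover have "S 0 \<noteq> S n" using assms(1) hit by metis
  moreover have "q \<noteq> []" by (simp add: q_def)
  ultimately obtain z q' where "q = S 0 # z # q'" by (cases q; cases "tl q") auto
  then have "(S 0, z) \<in> path_edges q" by (simp add: path_edges_Cons)
  moreover have "loop_erased_edges A S = path_edges q"
    using loop_erased_edges_hit[of S n A] hit by (simp add: erased_prefix_def q_def)
  ultimately show ?thesis by (auto simp: Field_def)
next
  case never
  \<comment> \<open>The step taken after the last visit to the starting point can never be erased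
    again.\<close>
  define N where "N = Max {n. S n = S 0}"
  have N: "S N = S 0" using Max_in[OF assms(2)] unfolding N_def by blast
  have after: "S n \<noteq> S 0" if "n > N" for n
    using Max_ge[OF assms(2), of n] that unfolding N_def by auto
  have "(S 0, S (Suc N)) \<in> erased_prefix S n" if n: "n \<ge> Suc N" for n
  proof -
    have split: "map S [0..<Suc n] = map S [0..<Suc N] @ map S [Suc N..<Suc n]"
      using n upt_add_eq_append[of 0 "Suc N" "Suc n - Suc N"] by (simp del: upt_Suc)
    have hd1: "hd (map S [0..<Suc N]) = S 0" by (simp add: hd_map del: upt_Suc)
    have last1: "last (map S [0..<Suc N]) = S 0" using N by simp
    have notin: "S 0 \<notin> set (map S [Suc N..<Suc n])"
    proof
      assume "S 0 \<in> set (map S [Suc N..<Suc n])"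
      then obtain k where "k \<ge> Suc N" "S k = S 0" by (auto simp del: upt_Suc)
      then show False using after[of k] by simp
    qed
    have "loop_erase (map S [0..<Suc n]) = S 0 # loop_erase (map S [Suc N..<Suc n])"
      unfolding split using loop_erase_append_loop[of "map S [0..<Suc N]" "map S [Suc N..<Suc n]"] hd1 last1 notin
      by (simp del: upt_Suc)
    moreover have "hd (loop_erase (map S [Suc N..<Suc n])) = S (Suc N)"
      using n by (subst hd_loop_erase) (auto simp: hd_map simp del: upt_Suc)
    moreover have "loop_erase (map S [Suc N..<Suc n]) \<noteq> []" using n by (simp del: upt_Suc)
    ultimately show ?thesis unfolding erased_prefix_def by (simp add: path_edges_Cons del: upt_Suc)
  qed
  then have "(S 0, S (Suc N)) \<in> loop_erased_edges A S"
    using loop_erased_edges_never[of S A] never by blast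
  then show ?thesis by (auto simp: Field_def)
qed

text \<open>
  If the walk never hits \<open>A\<close>, its hitting time of \<open>B k\<close> tends to infinity, and by transience
  an edge eventually stays in or out of the loop-erased path.
\<close>

lemma loop_erased_edges_tendsto:
  assumes agree: "\<And>n. \<forall>\<^sub>F k in sequentially. S n \<in> B k \<longleftrightarrow> S n \<in> A"
    and fin: "finite {n. S n = a}"
  shows "\<forall>\<^sub>F k in sequentially. (a, c) \<in> loop_erased_edges (B k) S \<longleftrightarrow> (a, c) \<in> loop_erased_edges A S"
proof (cases rule: hitting_cases[of S A])
  case (hit n)
  have "\<forall>\<^sub>F k in sequentially. \<forall>i\<in>{..n}. S i \<in> B k \<longleftrightarrow> S i \<in> A"
    by (intro eventually_ball_finite ballI agree) auto
  then show ?thesis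
  proof eventually_elim
    case (elim k)
    have "loop_erased_edges (B k) S = erased_prefix S n"
      using elim hit by (intro loop_erased_edges_hit) auto
    moreover have "loop_erased_edges A S = erased_prefix S n"
      using hit by (intro loop_erased_edges_hit) auto
    ultimately show ?case by simp
  qed
next
  case never
  obtain M b where M: "\<And>n. n \<ge> M \<Longrightarrow> (a, c) \<in> erased_prefix S n \<longleftrightarrow> b"
    using erased_prefix_eventually_constant[OF fin] by blast
  have b: "(\<exists>N. \<forall>n\<ge>N. (a, c) \<in> erased_prefix S n) \<longleftrightarrow> b"
    using M by (metis nle_le)
  have "\<forall>\<^sub>F k in sequentially. \<forall>i\<in>{..M}. S i \<in> B k \<longleftrightarrow> S i \<in> A"
    by (intro eventually_ball_finite ballI agree) auto
  then show ?thesis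
  proof eventually_elim
    case (elim k)
    have "(a, c) \<in> loop_erased_edges (B k) S \<longleftrightarrow> b"
    proof (cases rule: hitting_cases[of S "B k"])
      case (hit n)
      then have "\<not> n \<le> M" using elim never by auto
      then show ?thesis using loop_erased_edges_hit[of S n "B k"] hit M[of n] by simp
    next
      case never': never
      then show ?thesis using loop_erased_edges_never[of S "B k"] b by simp
    qed
    moreover have "(a, c) \<in> loop_erased_edges A S \<longleftrightarrow> b"
      using loop_erased_edges_never[of S A] never b by simp
    ultimately show ?case by simp
  qed
qed

section \<open>Pathwise convergence of the algorithm along an exhaustion\<close>

context transient_kernel begin

text \<open>The almost sure properties of the walks on which the limit arguments rest; for a regular
  family these arguments are deterministic.\<close>

definition regular :: "('a \<Rightarrow> nat \<Rightarrow> 'a option) \<Rightarrow> bool" where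
  "regular X \<longleftrightarrow> proper X \<and> (\<forall>x\<in>V. X x 0 = Some x \<and> (\<forall>n. p (X x n) (X x (Suc n)) > 0) \<and>
    (\<forall>y\<in>V. finite {n. X x n = Some y}))"

lemma regular_en:
  assumes "regular X"
  shows "X (en i) n \<in> W" "X (en i) 0 = Some (en i)" "p (X (en i) n) (X (en i) (Suc n)) \<noteq> 0"
    "y \<in> V \<Longrightarrow> finite {n. X (en i) n = Some y}"
  using assms unfolding regular_def proper_def by (auto simp: less_le)

lemma AE_regular: "AE X in walks. regular X"
proof -
  have "AE X in walks. X x 0 = Some x \<and> (\<forall>n. p (X x n) (X x (Suc n)) > 0) \<and> (\<forall>y\<in>V. finite {n. X x n = Some y})"
    if x: "x \<in> V" for x
  proof (rule AE_PiM_component[where P = "\<lambda>S. S 0 = Some x \<and> (\<forall>n. p (S n) (S (Suc n)) > 0) \<and> (\<forall>y\<in>V. finite {n. S n = Some y})"])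
    interpret prob_space "walk (Some x)" using x by (intro prob_space_walk) simp
    \<comment> \<open>Borel-Cantelli, from the summability in \<open>transient\<close>.\<close>
    have fin: "AE S in walk (Some x). finite {n. S n = Some y}" if y: "y \<in> V" for y
    proof -
      have "AE S in walk (Some x). \<forall>\<^sub>F n in sequentially. S \<in> space (walk (Some x)) - {S \<in> space (walk (Some x)). S n = Some y}"
        by (intro borel_cantelli_AE1 step_event transient x y) (simp add: emeasure_eq_measure)
      then show ?thesis
      proof eventually_elim
        case (elim S)
        then obtain N where N: "\<And>n. n \<ge> N \<Longrightarrow> S n \<noteq> Some y" unfolding eventually_sequentially by blast
        have "{n. S n = Some y} \<subseteq> {..<N}" using N by (auto simp: not_le[symmetric])
        then show ?case by (rule finite_subset) simp
      qed
    qed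
    show "AE S in walk (Some x). S 0 = Some x \<and> (\<forall>n. p (S n) (S (Suc n)) > 0) \<and> (\<forall>y\<in>V. finite {n. S n = Some y})"
      using x by (intro AE_conjI AE_walk_start AE_walk_positive) (auto simp: AE_ball_countable[OF countable_V] fin)
  qed (use x in \<open>auto intro: prob_space_walk\<close>)
  then have "AE X in walks. \<forall>x\<in>V. X x 0 = Some x \<and> (\<forall>n. p (X x n) (X x (Suc n)) > 0) \<and> (\<forall>y\<in>V. finite {n. X x n = Some y})"
    by (simp only: AE_ball_countable[OF countable_V]) blast
  moreover have "AE X in walks. proper X" using AE_space by eventually_elim (rule proper_walks)
  ultimately show ?thesis by eventually_elim (simp add: regular_def)
qed

lemma domain_rounds_positive:
  assumes X: "regular X"
  shows "e \<in> domain_rounds D en X j \<Longrightarrow> e \<in> W \<times> W \<and> p (fst e) (snd e) \<noteq> 0"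
proof (induction j)
  case (Suc j)
  show ?case
  proof (cases "e \<in> domain_rounds D en X j")
    case False
    then obtain i where "e \<in> loop_erased_edges (covered D en X j) (X (en i))"
      using Suc.prems by (auto simp: in_domain_rounds_Suc_iff)
    then obtain k where "e = (X (en i) k, X (en i) (Suc k))" by (rule loop_erased_edges_steps)
    then show ?thesis using regular_en[OF X] by simp
  qed (use Suc in blast)
qed simp

text \<open>Each round covers its starting vertex, the first uncovered one. The number of rounds
  needed does not depend on \<open>D\<close>.\<close>

lemma en_covered:
  assumes X: "regular X"
  shows "i < j \<Longrightarrow> Some (en i) \<in> covered D en X j"
proof (induction j arbitrary: i)
  case (Suc j)
  show ?case
  proof (cases "Some (en i) \<in> covered D en X j")
    case True
    then show ?thesis using covered_mono[of j "Suc j" D en X] by auto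
  next
    case False
    then have "i = j" using Suc by (metis less_antisym)
    have "domain_rounds D en X (Suc j) = domain_rounds D en X j \<union> loop_erased_edges (covered D en X j) (X (en i))"
      using False Suc.IH \<open>i = j\<close> by (intro domain_rounds_Suc_start) auto
    moreover have "Some (en i) \<in> Field (loop_erased_edges (covered D en X j) (X (en i)))"
      using start_in_Field_loop_erased_edges[of "X (en i)" "covered D en X j"] regular_en(2)[OF X, of i]
        regular_en(4)[where y = "en i" and i = i, OF X] False by simp
    ultimately show ?thesis unfolding covered_def by (auto simp: Field_Un)
  qed
qed simp

text \<open>New edges have uncovered sources, so the outgoing edge of a covered vertex is
  final.\<close>

lemma covered_source_frozen:
  assumes "s \<in> covered D en X j"
  shows "(s, t) \<in> domain_rounds D en X (j + k) \<longleftrightarrow> (s, t) \<in> domain_rounds D en X j"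
proof (induction k)
  case (Suc k)
  have "s \<in> covered D en X (j + k)" using assms covered_mono[of j "j + k" D en X] by auto
  then have "(s, t) \<notin> loop_erased_edges (covered D en X (j + k)) (X (en i))" for i
    by (auto elim!: loop_erased_edges_steps)
  then show ?case using Suc by (simp add: in_domain_rounds_Suc_iff)
qed simp

text \<open>The infinite union of rounds is replaced by one round whose number is independent of
  \<open>D\<close>, so a limit in \<open>D\<close> can be taken at a fixed round.\<close>

lemma domain_edges_iff_rounds:
  assumes X: "regular X"
  shows "(Some (en i), t) \<in> domain_edges D en X \<longleftrightarrow> (Some (en i), t) \<in> domain_rounds D en X (Suc i)"
proof
  assume "(Some (en i), t) \<in> domain_edges D en X"
  then obtain j where "(Some (en i), t) \<in> domain_rounds D en X j" by (auto simp: domain_edges_def)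
  then have "(Some (en i), t) \<in> domain_rounds D en X (Suc i + j)"
    using domain_rounds_mono[of j "Suc i + j" D en X] by auto
  then show "(Some (en i), t) \<in> domain_rounds D en X (Suc i)"
    using covered_source_frozen[OF en_covered[OF X, of i "Suc i" D]] by simp
qed (auto simp: domain_edges_def)

context
  fixes D :: "nat \<Rightarrow> 'a set"
  assumes D_subset: "\<And>k. D k \<subseteq> V" and D_eventually: "\<And>x. x \<in> V \<Longrightarrow> \<forall>\<^sub>F k in sequentially. x \<in> D k"
begin

text \<open>Convergence is pointwise in the edge, not uniform: for given \<open>k\<close> the
  algorithms on \<open>D k\<close> and on \<open>V\<close> may differ far away. The induction
  therefore carries single edges, and coverage of one state has to be reduced to finitely many of
  them.\<close>

lemma domain_rounds_tendsto:
  assumes X: "regular X"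
  shows "\<forall>\<^sub>F k in sequentially. e \<in> domain_rounds (D k) en X j \<longleftrightarrow> e \<in> domain_rounds V en X j"
proof (induction j arbitrary: e)
  case (Suc j)
  let ?A = "covered V en X j" and ?B = "\<lambda>k. covered (D k) en X j"
  have agree: "\<forall>\<^sub>F k in sequentially. s \<in> ?B k \<longleftrightarrow> s \<in> ?A" if s: "s \<in> W" for s
  proof (cases s)
    case None
    then show ?thesis by (auto simp: covered_def)
  next
    case (Some y)
    then have y: "y \<in> V" using s by simp
    \<comment> \<open>The finitely many edges at \<open>s\<close> that walks can use.\<close>
    define K where "K = (\<lambda>u. (s, u)) ` {u \<in> W. p s u \<noteq> 0} \<union> (\<lambda>u. (u, s)) ` {u \<in> W. p u s \<noteq> 0}"
    have K: "finite K" using p_finite[OF s] finite_predecessors[OF y] by (auto simp: K_def Some)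
    have field: "s \<in> Field (domain_rounds D' en X j) \<longleftrightarrow> (\<exists>e\<in>K. e \<in> domain_rounds D' en X j)" for D'
    proof
      assume "s \<in> Field (domain_rounds D' en X j)"
      then obtain u where "(s, u) \<in> domain_rounds D' en X j \<or> (u, s) \<in> domain_rounds D' en X j"
        by (auto simp: Field_def)
      then show "\<exists>e\<in>K. e \<in> domain_rounds D' en X j"
        using domain_rounds_positive[OF X, of _ D' j] unfolding K_def by fastforce
    qed (auto simp: K_def Field_def)
    have "\<forall>\<^sub>F k in sequentially. \<forall>e\<in>K. e \<in> domain_rounds (D k) en X j \<longleftrightarrow> e \<in> domain_rounds V en X j"
      by (intro eventually_ball_finite K ballI Suc.IH)
    then show ?thesis
      using D_eventually[OF y]
    proof eventually_elim
      case (elim k)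
      then show ?case using y Some field[of "D k"] field[of V] by (auto simp: covered_def)
    qed
  qed
  show ?case
  proof (cases "e \<in> W \<times> W")
    case False
    then show ?thesis using domain_rounds_positive[OF X, of e] by (auto intro!: always_eventually)
  next
    case True
    show ?thesis
    proof (cases "\<exists>i. Some (en i) \<notin> ?A")
      \<comment> \<open>All vertices are covered in the limit, but the algorithm on
        \<open>D k\<close> may still run another round. It cannot touch the edges out of
        \<open>fst e\<close>, which is covered for large \<open>k\<close>.\<close>
      case False
      then have stop: "domain_rounds V en X (Suc j) = domain_rounds V en X j"
        using domain_rounds_Suc_stop[of en V X j] by blast
      have "fst e \<in> ?A"
      proof (cases "fst e")
        case (Some x)
        then have "x \<in> V" using True by (auto simp: mem_Times_iff)
        then show ?thesis using False Some range_en by (metis imageE)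
      qed (auto simp: covered_def)
      moreover have "fst e \<in> W" using True by (simp add: mem_Times_iff)
      ultimately have "\<forall>\<^sub>F k in sequentially. fst e \<in> ?B k" using agree[of "fst e"] by simp
      then show ?thesis
        using Suc.IH[of e]
      proof eventually_elim
        case (elim k)
        then show ?case
          using covered_source_frozen[of "fst e" "D k" X j "snd e" 1] by (simp add: stop)
      qed
    next
      case ex: True
      define i where "i = (LEAST i. Some (en i) \<notin> ?A)"
      have i: "Some (en i) \<notin> ?A" "\<And>i'. i' < i \<Longrightarrow> Some (en i') \<in> ?A"
        unfolding i_def using LeastI_ex[OF ex] not_less_Least by blast+
      \<comment> \<open>For large \<open>k\<close> the round starts at the same vertex, because this
        involves only the entries of the enumeration up to \<open>i\<close>.\<close>
      have start: "\<forall>\<^sub>F k in sequentially. \<forall>i'\<in>{..i}. Some (en i') \<in> ?B k \<longleftrightarrow> Some (en i') \<in> ?A"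
        by (intro eventually_ball_finite ballI agree) auto
      have "\<forall>\<^sub>F k in sequentially. e \<in> loop_erased_edges (?B k) (X (en i)) \<longleftrightarrow> e \<in> loop_erased_edges ?A (X (en i))"
      proof (cases "fst e")
        case None
        have "e \<notin> loop_erased_edges A (X (en i))" if "None \<in> A" for A
          using None that by (auto elim!: loop_erased_edges_steps)
        then show ?thesis by (simp add: covered_def)
      next
        case (Some y)
        then have "finite {n. X (en i) n = fst e}"
          using True regular_en(4)[where y = y and i = i, OF X] by (simp add: mem_Times_iff)
        moreover have "\<forall>\<^sub>F k in sequentially. X (en i) n \<in> ?B k \<longleftrightarrow> X (en i) n \<in> ?A" for n
          by (rule agree) (rule regular_en(1)[OF X])
        ultimately have "\<forall>\<^sub>F k in sequentially. (fst e, snd e) \<in> loop_erased_edges (?B k) (X (en i)) \<longleftrightarrow>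
            (fst e, snd e) \<in> loop_erased_edges ?A (X (en i))"
          by (intro loop_erased_edges_tendsto)
        then show ?thesis by simp
      qed
      then show ?thesis
        using start Suc.IH[of e]
      proof eventually_elim
        case (elim k)
        have "domain_rounds (D k) en X (Suc j) = domain_rounds (D k) en X j \<union> loop_erased_edges (?B k) (X (en i))"
          using i elim by (intro domain_rounds_Suc_start) auto
        moreover have "domain_rounds V en X (Suc j) = domain_rounds V en X j \<union> loop_erased_edges ?A (X (en i))"
          using i by (intro domain_rounds_Suc_start) auto
        ultimately show ?case using elim by simp
      qed
    qed
  qed
qed simp

lemma domain_edges_tendsto:
  assumes X: "regular X" and e: "fst e = None \<or> fst e \<in> Some ` V"
  shows "\<forall>\<^sub>F k in sequentially. e \<in> domain_edges (D k) en X \<longleftrightarrow> e \<in> domain_edges V en X"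
proof (cases "fst e")
  case None
  have "(None, t) \<notin> domain_edges D' en X" for t D'
  proof -
    have "(None, t) \<notin> domain_rounds D' en X j" for j
      using covered_source_frozen[of None D' X 0 t j] by (simp add: covered_def)
    then show ?thesis by (simp add: domain_edges_def)
  qed
  then have "e \<notin> domain_edges D' en X" for D' using None by (metis prod.collapse)
  then show ?thesis by simp
next
  case (Some x)
  then obtain i where "x = en i" using e range_en by auto
  then have "e = (Some (en i), snd e)" using Some by (metis prod.collapse)
  then show ?thesis
    using domain_rounds_tendsto[OF X, of e "Suc i"] domain_edges_iff_rounds[OF X, of i "snd e"] by simp
qed

lemma prob_domain_edges_tendsto:
  assumes e: "\<And>e. e \<in> set es \<Longrightarrow> fst e = None \<or> fst e \<in> Some ` V"
  shows "(\<lambda>k. measure walks (edges_event es (D k))) \<longlonglongrightarrow>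
    measure walks (edges_event es V)"
proof -
  interpret prob_space walks by (rule prob_space_walks)
  let ?E = "\<lambda>D. (edges_event es D)"
  have "(\<lambda>k. \<integral>X. indicator (?E (D k)) X \<partial>walks) \<longlonglongrightarrow> (\<integral>X. (indicator (?E V) X :: real) \<partial>walks)"
  proof (rule integral_dominated_convergence[where w = "\<lambda>_. 1"])
    show "AE X in walks. (\<lambda>k. indicator (?E (D k)) X :: real) \<longlonglongrightarrow> indicator (?E V) X"
      using AE_regular
    proof eventually_elim
      case (elim X)
      have "\<forall>\<^sub>F k in sequentially. \<forall>e\<in>set es. e \<in> domain_edges (D k) en X \<longleftrightarrow> e \<in> domain_edges V en X"
        by (intro eventually_ball_finite ballI domain_edges_tendsto elim e) auto
      then have "\<forall>\<^sub>F k in sequentially. (indicator (?E (D k)) X :: real) = indicator (?E V) X"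
        by eventually_elim (auto simp: indicator_def)
      then show ?case by (rule tendsto_eventually)
    qed
  qed (auto intro!: borel_measurable_indicator domain_edges_event)
  then show ?thesis by (simp add: domain_edges_event)
qed

end

text \<open>Expected numbers of visits, not yet divided by conductances; the value 0 at
  \<open>None\<close> implements the convention for the cemetery.\<close>

definition walk_green :: "'a option \<Rightarrow> 'a option \<Rightarrow> real" where
  "walk_green s t = (if s = None \<or> t = None then 0 else \<Sum>n. hit_prob s n t)"

theorem wilson_transfer_current:
  assumes es: "distinct es"
    and e: "\<And>e. e \<in> set es \<Longrightarrow> fst e \<in> W \<and> snd e \<in> W \<and> (fst e = None \<or> p (fst e) (snd e) \<noteq> 0)"
  shows "measure (wilson_measure W p en) {F. set es \<subseteq> F} =
    det_on {0..<length es} (transfer_matrix walk_green es)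
    * edge_weight es"
proof -
  \<comment> \<open>For finite \<open>V\<close> this sequence is eventually constant, so one limit
    argument treats both settings.\<close>
  define D where "D = (\<lambda>k. en ` {..<k})"
  have D: "finite (D k)" "D k \<subseteq> V" for k using range_en by (auto simp: D_def)
  have incD: "incseq D" by (auto simp: D_def incseq_def)
  have evD: "\<forall>\<^sub>F k in sequentially. x \<in> D k" if x: "x \<in> V" for x
  proof -
    obtain i where "x = en i" using x range_en by blast
    then show ?thesis by (intro eventually_mono[OF eventually_gt_at_top[of i]]) (auto simp: D_def)
  qed
  have UD: "(\<Union>k. D k) = V" using range_en by (auto simp: D_def)
  have fst_V: "fst e = None \<or> fst e \<in> Some ` V" if "e \<in> set es" for e
    using W_cases e[OF that] by blast
  have lim: "(\<lambda>k. measure walks (edges_event es (D k))) \<longlonglongrightarrow>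
    measure (wilson_measure W p en) {F. set es \<subseteq> F}"
    unfolding measure_wilson by (rule prob_domain_edges_tendsto[OF D(2) evD fst_V])
  show ?thesis
  proof (cases "\<exists>e\<in>set es. fst e = None")
    \<comment> \<open>No edge leaves the cemetery, so the probability is 0; on the other side the
      column of such an edge vanishes.\<close>
    case True
    then obtain e where e: "e \<in> set es" "fst e = None" by blast
    then obtain j where j: "j < length es" "es ! j = e" by (auto simp: in_set_conv_nth)
    have "measure (wilson_measure W p en) {F. set es \<subseteq> F} = 0"
      using lim by (simp add: prob_domain_edges_None[OF D e] LIMSEQ_const_iff)
    moreover have "det_on {0..<length es} (transfer_matrix walk_green es) = 0"
      by (rule det_on_zero_column[of _ j]) (use j e in \<open>auto simp: walk_green_def\<close>)
    ultimately show ?thesis by simp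
  next
    case False
    then have src: "fst e \<in> Some ` V" if "e \<in> set es" for e using fst_V that by blast
    have green: "(\<lambda>k. domain_green (D k) s t) \<longlonglongrightarrow> walk_green s t" if s: "s \<in> W" and t: "t \<in> Some ` V" for s t
    proof (cases s)
      case None
      then show ?thesis by (simp add: domain_green_def walk_green_def image_iff)
    next
      case (Some x)
      then have x: "x \<in> V" using s by simp
      obtain y where y: "y \<in> V" "t = Some y" using t by blast
      obtain k0 where k0: "\<And>k. k \<ge> k0 \<Longrightarrow> x \<in> D k" using evD[OF x] unfolding eventually_sequentially by blast
      have "(\<lambda>k. green p (Some ` D k) s t) \<longlonglongrightarrow> (\<Sum>n. hit_prob s n t)"
      proof (rule tendsto_green[where ?k0.0 = k0])
        show "Some ` D k \<subseteq> W" for k using D(2)[of k] by auto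
        show "incseq (\<lambda>k. Some ` D k)" using incD by (auto simp: incseq_def)
        show "summable (\<lambda>n. hit_prob s n t)" using transient[OF x y(1)] Some y by simp
        show "AE S in walk s. \<forall>n. S n = t \<longrightarrow> (\<forall>i\<le>n. S i \<in> (\<Union>k. Some ` D k))"
          using AE_alive[OF s]
        proof eventually_elim
          case (elim S)
          have "W - {None} \<subseteq> (\<Union>k. Some ` D k)"
          proof
            fix u assume "u \<in> W - {None}"
            then obtain x where "u = Some x" "x \<in> V" by (cases u) auto
            then show "u \<in> (\<Union>k. Some ` D k)" using UD by auto
          qed
          then show ?case using elim y(2) by blast
        qed
      qed (use D s k0 Some in auto)
      moreover have "\<forall>\<^sub>F k in sequentially. domain_green (D k) s t = green p (Some ` D k) s t"
        using evD[OF x] by eventually_elim (auto simp: domain_green_def Some)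
      moreover have "walk_green s t = (\<Sum>n. hit_prob s n t)" using Some y by (simp add: walk_green_def)
      ultimately show ?thesis by (simp add: tendsto_cong)
    qed
    have "\<forall>\<^sub>F k in sequentially. \<forall>e\<in>set es. fst e \<in> Some ` D k"
    proof (intro eventually_ball_finite ballI)
      fix e assume "e \<in> set es"
      then obtain x where "x \<in> V" "fst e = Some x" using src by blast
      then show "\<forall>\<^sub>F k in sequentially. fst e \<in> Some ` D k" using evD[of x] by (simp add: inj_image_mem_iff)
    qed simp
    then have formula: "\<forall>\<^sub>F k in sequentially. measure walks (edges_event es (D k)) =
      det_on {0..<length es} (transfer_matrix (domain_green (D k)) es)
      * edge_weight es"
    proof eventually_elim
      case (elim k)
      show ?case
      proof (rule prob_domain_edges_det[OF D es])
        fix e' assume e': "e' \<in> set es"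
        have "fst e' \<in> Some ` D k" using elim e' by (rule bspec)
        moreover have "fst e' \<noteq> None" using False e' by metis
        ultimately show "fst e' \<in> Some ` D k \<and> snd e' \<in> W \<and> p (fst e') (snd e') \<noteq> 0" using e[OF e'] by metis
      qed
    qed
    have "(\<lambda>k. det_on {0..<length es} (transfer_matrix (domain_green (D k)) es)
      * edge_weight es) \<longlonglongrightarrow>
      det_on {0..<length es} (transfer_matrix walk_green es)
      * edge_weight es"
      using e src by (intro tendsto_mult tendsto_const tendsto_det_on tendsto_diff green) auto
    then show ?thesis
      using LIMSEQ_unique[OF lim] tendsto_cong[OF formula] by simp
  qed
qed

end

section \<open>Partition functions\<close>

text \<open>A tree rooted at \<open>None\<close> is an acyclic choice of one outgoing edge at every
  other vertex. The result is the weighted Laplacian with the row and column of the root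
  removed.\<close>

lemma Z_RST_eq_det:
  assumes V: "finite V" and E: "E \<subseteq> V_rho V \<times> V_rho V"
  shows "Z_RST (V_rho V) E C None =
    det_on (Some ` V) (\<lambda>s u. of_bool (s = u) * total_cond E C s - (if (s, u) \<in> E then C (s, u) else 0))"
proof -
  define R where "R = Some ` V"
  define N where "N = (\<lambda>s. E `` {s})"
  have R: "finite R" "R = V_rho V - {None}" using V by (auto simp: R_def V_rho_def)
  let ?F = "{f \<in> PiE R N. acyclic (fun_graph R f)}"
  have finN: "finite (N s)" for s
  proof (rule finite_subset)
    show "N s \<subseteq> V_rho V" using E by (auto simp: N_def)
    show "finite (V_rho V)" using V by (simp add: V_rho_def)
  qed
  have bij: "bij_betw (fun_graph R) ?F {T. rst (V_rho V) E None T}"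
    unfolding bij_betw_def
  proof
    show "inj_on (fun_graph R) ?F"
    proof (rule inj_onI)
      fix f g assume "f \<in> ?F" "g \<in> ?F"
        and eq: "fun_graph R f = fun_graph R g"
      then have "f \<in> PiE R N" "g \<in> PiE R N" by auto
      then show "f = g"
      proof (rule PiE_ext)
        fix x assume "x \<in> R"
        then show "f x = g x" using eq by (metis in_fun_graph)
      qed
    qed
    show "fun_graph R ` ?F = {T. rst (V_rho V) E None T}"
    proof (intro equalityI subsetI)
      fix T assume "T \<in> fun_graph R ` ?F"
      then obtain f where f: "f \<in> PiE R N" "acyclic (fun_graph R f)" "T = fun_graph R f" by blast
      have "Domain T = R" by (auto simp: f(3) fun_graph_def)
      moreover have "T \<subseteq> E" using f by (auto simp: fun_graph_def N_def PiE_iff)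
      moreover have "single_valued T" by (auto simp: f(3) single_valued_def)
      ultimately show "T \<in> {T. rst (V_rho V) E None T}"
        using f by (auto simp: rst_def rsf_def roots_def R V_rho_def)
    next
      fix T assume "T \<in> {T. rst (V_rho V) E None T}"
      then have T: "T \<subseteq> E" "acyclic T" "single_valued T" "V_rho V - Domain T = {None}"
        by (auto simp: rst_def rsf_def roots_def)
      then have dom: "Domain T = R" using E by (auto simp: R(2))
      define f where "f = restrict (\<lambda>s. THE t. (s, t) \<in> T) R"
      have f: "(s, t) \<in> T \<longleftrightarrow> s \<in> R \<and> t = f s" for s t
      proof
        assume st: "(s, t) \<in> T"
        then have "(THE t. (s, t) \<in> T) = t" using T(3) by (intro the_equality) (auto dest: single_valuedD)
        then show "s \<in> R \<and> t = f s" using st dom by (auto simp: f_def)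
      next
        assume st: "s \<in> R \<and> t = f s"
        then obtain t' where t': "(s, t') \<in> T" using dom by blast
        then have "(THE t. (s, t) \<in> T) = t'" using T(3) by (intro the_equality) (auto dest: single_valuedD)
        then show "(s, t) \<in> T" using st t' by (auto simp: f_def)
      qed
      have "T = fun_graph R f" using f by auto
      moreover have "f \<in> PiE R N"
      proof (rule PiE_I)
        show "f s \<in> N s" if "s \<in> R" for s using f[of s "f s"] that T(1) by (auto simp: N_def)
      qed (auto simp: f_def)
      ultimately show "T \<in> fun_graph R ` ?F" using T(2) by blast
    qed
  qed
  have "Z_RST (V_rho V) E C None = (\<Sum>f\<in>?F. \<Prod>e\<in>fun_graph R f. C e)"
    unfolding Z_RST_def by (rule sum.reindex_bij_betw[OF bij, symmetric])
  also have "\<dots> = (\<Sum>f | f \<in> PiE R N \<and> acyclic (fun_graph R f). \<Prod>s\<in>R. C (s, f s))"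
    by (intro sum.cong) (auto simp: fun_graph_def prod.reindex inj_on_def)
  also have "\<dots> = det_on R (\<lambda>s u. \<Sum>t\<in>N s. C (s, t) * (of_bool (s = u) - of_bool (t = u)))"
    by (rule matrix_tree[OF R(1) finN])
  also have "\<dots> = det_on R (\<lambda>s u. of_bool (s = u) * total_cond E C s - (if (s, u) \<in> E then C (s, u) else 0))"
  proof (rule det_on_cong)
    fix s u
    have "(\<Sum>t\<in>N s. C (s, t) * of_bool (t = u)) = (\<Sum>t\<in>N s. of_bool (u = t) * C (s, t))"
      by (intro sum.cong) auto
    also have "\<dots> = (if (s, u) \<in> E then C (s, u) else 0)"
      by (simp add: sum_of_bool_times[OF finN]) (simp add: N_def)
    finally show "(\<Sum>t\<in>N s. C (s, t) * (of_bool (s = u) - of_bool (t = u))) =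
        of_bool (s = u) * total_cond E C s - (if (s, u) \<in> E then C (s, u) else 0)"
      by (simp add: right_diff_distrib sum_subtractf sum_distrib_left total_cond_def N_def mult.commute)
  qed
  finally show ?thesis by (simp add: R_def)
qed

text \<open>Each root is joined to \<open>None\<close>, and its mass becomes the weight of the new
  edge. The cone is taken over all of \<open>V\<close>, including vertices of mass zero, so that
  every forest has an image.\<close>

lemma Z_RSF_eq_Z_RST_cone:
  assumes V: "finite V" and E: "E \<subseteq> V \<times> V"
  shows "Z_RSF V E c m = Z_RST (V_rho V) (cone_edges E V) (c_rho c m) None"
proof -
  define \<Phi> where "\<Phi> = (\<lambda>F. map_prod Some Some ` F \<union> (\<lambda>x. (Some x, None :: 'a option)) ` roots V F)"
  define \<Psi> where "\<Psi> = (\<lambda>T. {(x :: 'a, y :: 'a). (Some x, Some y) \<in> T})"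
  have in\<Phi>: "(Some x, Some y) \<in> \<Phi> F \<longleftrightarrow> (x, y) \<in> F" "(Some x, None) \<in> \<Phi> F \<longleftrightarrow> x \<in> roots V F"
    "(None, t) \<notin> \<Phi> F" for x y t F
    by (auto simp: \<Phi>_def)
  have rst: "rst (V_rho V) (cone_edges E V) None (\<Phi> F)" if F: "rsf E F" for F
  proof -
    have FE: "F \<subseteq> E" "acyclic F" "single_valued F" using F by (auto simp: rsf_def)
    \<comment> \<open>A path that reaches \<open>None\<close> ends there, so a cycle would already
      be a cycle of \<open>F\<close>.\<close>
    have path: "(s, t) \<in> (\<Phi> F)\<^sup>+ \<Longrightarrow> s \<noteq> None \<and> (t = None \<or> (the s, the t) \<in> F\<^sup>+)" for s t
    proof (induction rule: trancl_induct)
      case (base t)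
      then show ?case by (auto simp: \<Phi>_def)
    next
      case (step t u)
      then obtain y where y: "t = Some y" using in\<Phi>(3) by (cases t) auto
      then have "(the s, y) \<in> F\<^sup>+" using step by auto
      then show ?case using step y in\<Phi>(1)[of y _ F] by (cases u) (auto intro: trancl_into_trancl)
    qed
    have "acyclic (\<Phi> F)"
      unfolding acyclic_def using path FE(2) unfolding acyclic_def by blast
    moreover have "single_valued (\<Phi> F)"
      using FE(3) unfolding single_valued_def \<Phi>_def roots_def by auto
    moreover have "\<Phi> F \<subseteq> cone_edges E V"
      using FE(1) by (auto simp: \<Phi>_def cone_edges_def roots_def)
    moreover have "roots (V_rho V) (\<Phi> F) = {None}"
    proof -
      have "Some x \<in> Domain (\<Phi> F)" if "x \<in> V" for x
      proof (cases "x \<in> Domain F")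
        case True
        then obtain y where "(x, y) \<in> F" by blast
        then show ?thesis using in\<Phi>(1) by blast
      next
        case False
        then have "x \<in> roots V F" using that by (simp add: roots_def)
        then show ?thesis using in\<Phi>(2) by blast
      qed
      moreover have "None \<notin> Domain (\<Phi> F)" using in\<Phi>(3) by blast
      ultimately show ?thesis by (auto simp: roots_def V_rho_def)
    qed
    ultimately show ?thesis by (simp add: rst_def rsf_def)
  qed
  have rsf: "rsf E (\<Psi> T)" "\<Phi> (\<Psi> T) = T" if T: "rst (V_rho V) (cone_edges E V) None T" for T
  proof -
    have TE: "T \<subseteq> cone_edges E V" "acyclic T" "single_valued T" "V_rho V - Domain T = {None}"
      using T by (auto simp: rst_def rsf_def roots_def)
    have "(Some x, Some y) \<in> T\<^sup>+" if "(x, y) \<in> (\<Psi> T)\<^sup>+" for x y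
      using that by (induction rule: trancl_induct) (auto simp: \<Psi>_def intro: trancl_into_trancl)
    then have "acyclic (\<Psi> T)" using TE(2) unfolding acyclic_def by blast
    moreover have "single_valued (\<Psi> T)" using TE(3) unfolding single_valued_def \<Psi>_def by auto
    moreover have "\<Psi> T \<subseteq> E" using TE(1) by (auto simp: \<Psi>_def cone_edges_def)
    ultimately show "rsf E (\<Psi> T)" by (simp add: rsf_def)
    have None: "(None, t) \<notin> T" for t using TE(4) by blast
    have root: "x \<in> roots V (\<Psi> T) \<longleftrightarrow> (Some x, None) \<in> T" for x
    proof
      assume x: "x \<in> roots V (\<Psi> T)"
      then have "Some x \<in> V_rho V" by (auto simp: roots_def V_rho_def)
      then have "Some x \<in> Domain T" using TE(4) by blast
      then obtain t where "(Some x, t) \<in> T" by blast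
      then show "(Some x, None) \<in> T" using x by (cases t) (auto simp: roots_def \<Psi>_def)
    next
      assume x: "(Some x, None) \<in> T"
      then have "x \<in> V" using TE(1) E by (auto simp: cone_edges_def)
      moreover have "(Some x, Some y) \<notin> T" for y using x TE(3) by (auto dest: single_valuedD)
      ultimately show "x \<in> roots V (\<Psi> T)" by (auto simp: roots_def \<Psi>_def)
    qed
    have "(s, t) \<in> \<Phi> (\<Psi> T) \<longleftrightarrow> (s, t) \<in> T" for s t
      using in\<Phi> root None by (cases s; cases t) (auto simp: \<Psi>_def)
    then show "\<Phi> (\<Psi> T) = T" by auto
  qed
  have "\<Psi> (\<Phi> F) = F" for F using in\<Phi> by (auto simp: \<Psi>_def)
  then have bij: "bij_betw \<Phi> {F. rsf E F} {T. rst (V_rho V) (cone_edges E V) None T}"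
    using rst rsf by (intro bij_betw_byWitness[where f' = \<Psi>]) auto
  have weight: "(\<Prod>e\<in>\<Phi> F. c_rho c m e) = (\<Prod>e\<in>F. c e) * (\<Prod>x\<in>roots V F. m x)" if "rsf E F" for F
  proof -
    have "finite F" using that E V by (auto simp: rsf_def intro: finite_subset[of _ "V \<times> V"])
    moreover have "finite (roots V F)" using V by (simp add: roots_def)
    moreover have "(\<Prod>e\<in>map_prod Some Some ` F. c_rho c m e) = (\<Prod>e\<in>F. c e)"
    proof (subst prod.reindex)
      show "prod (c_rho c m \<circ> map_prod Some Some) F = prod c F"
        by (intro prod.cong refl) auto
    qed (auto simp: inj_on_def)
    moreover have "(\<Prod>e\<in>(\<lambda>x. (Some x, None)) ` roots V F. c_rho c m e) = (\<Prod>x\<in>roots V F. m x)"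
      by (subst prod.reindex) (auto simp: inj_on_def)
    ultimately show ?thesis
      unfolding \<Phi>_def by (subst prod.union_disjoint) auto
  qed
  show ?thesis
    unfolding Z_RST_def Z_RSF_def using weight
    by (subst sum.reindex_bij_betw[OF bij, symmetric]) simp
qed

section \<open>The two walks of the theorem\<close>

text \<open>The factors \<open>h y / h x\<close> telescope along the word.\<close>

lemma word_weight_conjugate:
  assumes "\<And>x y. x \<in> U \<Longrightarrow> y \<in> U \<Longrightarrow> p' x y = h y / h x * p x y" "\<And>x. x \<in> U \<Longrightarrow> h x \<noteq> 0"
  shows "l \<noteq> [] \<Longrightarrow> set l \<subseteq> U \<Longrightarrow> word_weight p' l = h (last l) / h (hd l) * word_weight p l"
proof (induction l)
  case (Cons x l)
  show ?case
  proof (cases l)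
    case Nil
    then show ?thesis using Cons.prems assms(2) by simp
  next
    case (Cons y l')
    then have "x \<in> U" "y \<in> U" using Cons.prems by auto
    then show ?thesis using Cons Cons.IH Cons.prems assms by simp
  qed
qed simp

context absorbing_kernel begin

lemma emeasure_hit_alive:
  assumes s: "s \<in> W" and y: "y \<noteq> None"
  shows "emeasure (walk s) {S \<in> space (walk s). S n = y} =
    word_mass p {l. length l = Suc n \<and> last l = y \<and> set l \<subseteq> W - {None} \<and> hd l = s}"
proof -
  let ?L = "{l. length l = Suc n \<and> last l = y \<and> set l \<subseteq> W - {None}}"
  have "emeasure (walk s) {S \<in> space (walk s). S n = y} = emeasure (walk s) {S \<in> space (walk s). map S [0..<Suc n] \<in> ?L}"
  proof (rule emeasure_eq_AE)
    show "AE S in walk s. (S \<in> {S \<in> space (walk s). S n = y}) = (S \<in> {S \<in> space (walk s). map S [0..<Suc n] \<in> ?L})"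
      using AE_alive[OF s]
    proof eventually_elim
      case (elim S)
      have "last (map S [0..<Suc n]) = S n" by simp
      then have "map S [0..<Suc n] \<in> ?L \<longleftrightarrow> S n = y \<and> (\<forall>i\<le>n. S i \<in> W - {None})"
        by (auto simp: less_Suc_eq_le[symmetric] image_subset_iff simp del: upt_Suc)
      then show ?case using elim y by blast
    qed
  qed (use emeasure_prefix_in(1)[OF s, of ?L n] in auto)
  also have "\<dots> = word_mass p {l \<in> ?L. set l \<subseteq> W \<and> hd l = s}"
    by (rule emeasure_prefix_in(2)[OF s]) simp
  also have "{l \<in> ?L. set l \<subseteq> W \<and> hd l = s} = {l. length l = Suc n \<and> last l = y \<and> set l \<subseteq> W - {None} \<and> hd l = s}"
    by auto
  finally show ?thesis .
qed

end

text \<open>The two kernels may differ in whether they have a cemetery. A walk found at a living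
  state has followed a word of living states, and on such words the weights are compared one by
  one.\<close>

lemma hit_prob_conjugate:
  fixes W W' :: "'a option set" and h :: "'a option \<Rightarrow> real"
  assumes K: "absorbing_kernel W p" and K': "absorbing_kernel W' p'"
    and same: "W - {None} = W' - {None}"
    and p': "\<And>x y. x \<in> W - {None} \<Longrightarrow> y \<in> W - {None} \<Longrightarrow> p' x y = h y / h x * p x y"
    and h: "\<And>x. x \<in> W - {None} \<Longrightarrow> h x > 0"
    and x: "x \<in> W - {None}" and y: "y \<in> W - {None}"
  shows "measure (walk_law W' p' x) {S \<in> space (walk_law W' p' x). S n = y} =
    h y / h x * measure (walk_law W p x) {S \<in> space (walk_law W p x). S n = y}"
proof -
  interpret K: absorbing_kernel W p by fact
  interpret K': absorbing_kernel W' p' by fact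
  let ?L = "{l. length l = Suc n \<and> last l = y \<and> set l \<subseteq> W - {None} \<and> hd l = x}"
  have h0: "h x > 0" "h y > 0" using h x y by auto
  have "emeasure (walk_law W' p' x) {S \<in> space (walk_law W' p' x). S n = y} =
    (\<integral>\<^sup>+l. ennreal (word_weight p' l) \<partial>count_space ?L)"
    using K'.emeasure_hit_alive[of x y n] x y same by auto
  also have "\<dots> = (\<integral>\<^sup>+l. ennreal (h y / h x) * ennreal (word_weight p l) \<partial>count_space ?L)"
  proof (rule nn_integral_cong)
    fix l assume "l \<in> space (count_space ?L)"
    then have l: "l \<noteq> []" "set l \<subseteq> W - {None}" "last l = y" "hd l = x" by auto
    have hne: "h u \<noteq> 0" if "u \<in> W - {None}" for u using h[OF that] by simp
    have "word_weight p' l = h (last l) / h (hd l) * word_weight p l"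
      by (rule word_weight_conjugate[OF p' hne l(1,2)])
    moreover have "word_weight p l \<ge> 0" using l by (intro K.word_weight_nonneg') auto
    ultimately show "ennreal (word_weight p' l) = ennreal (h y / h x) * ennreal (word_weight p l)"
      using l h0 by (simp flip: ennreal_mult)
  qed
  also have "\<dots> = ennreal (h y / h x) * emeasure (walk_law W p x) {S \<in> space (walk_law W p x). S n = y}"
    using K.emeasure_hit_alive[of x y n] x y by (simp add: nn_integral_cmult)
  finally show ?thesis using h0 by (simp add: measure_def enn2real_mult)
qed

context transient_kernel begin

text \<open>Passing from probabilities to conductances multiplies the weight of the
  \<open>j\<close>-th edge by \<open>q\<close> at its source; dividing column \<open>j\<close> by
  the same factor compensates.\<close>

lemma wilson_transfer_conductances:
  assumes es: "distinct es"
    and e: "\<And>e. e \<in> set es \<Longrightarrow> fst e \<in> W \<and> snd e \<in> W \<and>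
      (fst e = None \<or> p (fst e) (snd e) \<noteq> 0 \<and> q (fst e) \<noteq> 0 \<and> C e = q (fst e) * p (fst e) (snd e))"
    and H: "\<And>e f. e \<in> set es \<Longrightarrow> f \<in> set es \<Longrightarrow>
      H e f = walk_green (fst e) (fst f) / q (fst f) - walk_green (snd e) (fst f) / q (fst f)"
  shows "measure (wilson_measure W p en) {F. set es \<subseteq> F} =
    Determinant.det (Matrix.mat (length es) (length es) (\<lambda>(i, j). H (es ! i) (es ! j))) * (\<Prod>e\<leftarrow>es. C e)"
proof -
  define n where "n = length es"
  define M where "M = (transfer_matrix walk_green es)"
  have H': "det_on {0..<n} (\<lambda>i j. H (es ! i) (es ! j)) = det_on {0..<n} (\<lambda>i j. M i j / q (fst (es ! j)))"
    by (intro det_on_cong) (auto simp: H M_def n_def diff_divide_distrib)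
  have W: "measure (wilson_measure W p en) {F. set es \<subseteq> F} = det_on {0..<n} M * edge_weight es"
    unfolding M_def n_def using e by (intro wilson_transfer_current es) blast
  show ?thesis
  proof (cases "\<exists>e\<in>set es. fst e = None")
    case True
    then obtain j where j: "j < n" "fst (es ! j) = None" by (auto simp: in_set_conv_nth n_def)
    then have M0: "M i j = 0" for i by (simp add: M_def walk_green_def)
    then have "det_on {0..<n} M = 0" "det_on {0..<n} (\<lambda>i j. M i j / q (fst (es ! j))) = 0"
      using j by (auto intro!: det_on_zero_column[of _ j])
    then show ?thesis unfolding W det_mat_eq_det_on n_def[symmetric] H' by simp
  next
    case False
    then have e': "p (fst e) (snd e) \<noteq> 0 \<and> q (fst e) \<noteq> 0 \<and> C e = q (fst e) * p (fst e) (snd e)" if "e \<in> set es" for e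
      using e[OF that] that by metis
    have A: "(\<Prod>e\<leftarrow>es. C e) = (\<Prod>i\<in>{0..<n}. q (fst (es ! i))) * edge_weight es"
    proof -
      have "(\<Prod>i\<in>{0..<n}. q (fst (es ! i))) = (\<Prod>e\<in>set es. q (fst e))"
        unfolding n_def atLeast0LessThan
        by (rule prod.reindex_bij_betw[OF bij_betw_nth[OF es refl refl], of "\<lambda>e. q (fst e)"])
      then show ?thesis
        using es e' by (simp add: prod.distinct_set_conv_list[symmetric] prod.distrib[symmetric])
    qed
    have B: "det_on {0..<n} (\<lambda>i j. M i j / q (fst (es ! j))) * (\<Prod>i\<in>{0..<n}. q (fst (es ! i))) = det_on {0..<n} M"
    proof -
      have "det_on {0..<n} (\<lambda>i j. M i j / q (fst (es ! j))) = det_on {0..<n} M / (\<Prod>j\<in>{0..<n}. q (fst (es ! j)))"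
      proof -
        have "(\<Prod>i\<in>{0..<n}. M i (\<pi> i) / q (fst (es ! \<pi> i))) = (\<Prod>i\<in>{0..<n}. M i (\<pi> i)) / (\<Prod>j\<in>{0..<n}. q (fst (es ! j)))"
          if "\<pi> permutes {0..<n}" for \<pi>
          using prod.reindex_bij_betw[OF permutes_imp_bij[OF that], of "\<lambda>j. q (fst (es ! j))"] by (simp add: prod_dividef)
        then show ?thesis by (simp add: det_on_def sum_divide_distrib)
      qed
      moreover have "(\<Prod>j\<in>{0..<n}. q (fst (es ! j))) \<noteq> 0" using e' by (simp add: n_def)
      ultimately show ?thesis by simp
    qed
    show ?thesis
      unfolding W det_mat_eq_det_on n_def[symmetric] H' A B[symmetric] by (rule mult.assoc)
  qed
qed

end

text \<open>
  The common part of both settings: in the finite one \<open>W\<close> contains the cemetery \<open>None\<close>, in the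
  infinite one it does not.
\<close>

locale doob_transform =
  fixes V :: "'a set" and E :: "('a \<times> 'a) set"
    and c :: "'a \<times> 'a \<Rightarrow> real" and m lam :: "'a \<Rightarrow> real"
    and W :: "'a option set" and Eo :: "('a option \<times> 'a option) set"
    and ct :: "'a option \<times> 'a option \<Rightarrow> real"
  assumes countable_V: "countable V"
    and edges_in: "E \<subseteq> V \<times> V"
    and undirected: "sym E"
    and locally_finite: "\<And>x. x \<in> V \<Longrightarrow> finite (E `` {x})"
    and connected: "\<And>x y. x \<in> V \<Longrightarrow> y \<in> V \<Longrightarrow> (x, y) \<in> E\<^sup>*"
    and cond_pos: "\<And>e. e \<in> E \<Longrightarrow> c e > 0"
    and mass_nonneg: "\<And>x. x \<in> V \<Longrightarrow> m x \<ge> 0"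
    and mass_pos: "\<exists>z\<in>V. m z > 0"
    and lam_pos: "\<And>x. x \<in> V \<Longrightarrow> lam x > 0"
    and W_V: "V = Some -` W"
    and Eo_W: "Eo \<subseteq> W \<times> W"
    and Eo_inner: "\<And>x y. (Some x, Some y) \<in> Eo \<longleftrightarrow> (x, y) \<in> E"
    and ct_inner: "\<And>x y. (x, y) \<in> E \<Longrightarrow> ct (Some x, Some y) = lam y / lam x * c (x, y)"
    and ct_boundary: "\<And>x. (Some x, None) \<in> Eo \<Longrightarrow> ct (Some x, None) > 0"
    and total_ct: "\<And>x. x \<in> V \<Longrightarrow> total_cond Eo ct (Some x) = killed_cond E c m x"
begin

abbreviation "ck \<equiv> killed_cond E c m"
abbreviation "pk \<equiv> killed_prob E c m"
abbreviation "pt \<equiv> conductance_prob Eo ct"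

lemma edge_V: "(x, y) \<in> E \<Longrightarrow> x \<in> V \<and> y \<in> V"
  using edges_in by blast

lemma killed_cond_pos: assumes x: "x \<in> V" shows "ck x > 0"
proof -
  obtain z where z: "z \<in> V" "m z > 0" using mass_pos by blast
  have nonneg: "total_cond E c x \<ge> 0"
    unfolding total_cond_def using cond_pos by (intro sum_nonneg) (auto intro: less_imp_le)
  show ?thesis
  proof (cases "x = z")
    case True
    then show ?thesis using z nonneg by (simp add: killed_cond_def)
  next
    case False
    then obtain y where "(x, y) \<in> E" using connected[OF x z(1)] by (metis converse_rtranclE)
    then have "total_cond E c x > 0"
      unfolding total_cond_def using locally_finite[OF x] cond_pos by (intro sum_pos) auto
    then show ?thesis using mass_nonneg[OF x] by (simp add: killed_cond_def)
  qed
qed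

lemma killed_prob_None: "t \<noteq> None \<Longrightarrow> pk None t = 0"
  by (cases t) auto

lemma absorbing_kernel_killed: "absorbing_kernel (V_rho V) (pk)"
proof
  show "countable (V_rho V)" using countable_V by (simp add: V_rho_def)
  fix s assume s: "s \<in> V_rho V"
  show "pk s t \<ge> 0" if "t \<in> V_rho V" for t
  proof (cases s)
    case None
    then show ?thesis by (cases t) auto
  next
    case (Some x)
    then have "x \<in> V" using s by (auto simp: V_rho_def)
    then show ?thesis
      using Some killed_cond_pos[of x] mass_nonneg[of x] cond_pos by (cases t) (auto intro: less_imp_le)
  qed
  have "finite {t \<in> V_rho V. pk s t \<noteq> 0} \<and>
    (\<Sum>t | t \<in> V_rho V \<and> pk s t \<noteq> 0. pk s t) = 1"
  proof (cases s)
    case None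
    then have "{t \<in> V_rho V. pk s t \<noteq> 0} = {None}"
      using killed_prob_None by (auto simp: V_rho_def)
    then show ?thesis using None by simp
  next
    case (Some x)
    then have x: "x \<in> V" using s by (auto simp: V_rho_def)
    let ?N = "insert None (Some ` (E `` {x}))"
    have fin: "finite ?N" using locally_finite[OF x] by simp
    have sub: "{t \<in> V_rho V. pk s t \<noteq> 0} \<subseteq> ?N"
    proof safe
      fix t assume t: "pk s t \<noteq> 0" "t \<notin> Some ` (E `` {x})"
      show "t = None" by (cases t) (use t Some in \<open>auto split: if_splits\<close>)
    qed
    have "(\<Sum>t | t \<in> V_rho V \<and> pk s t \<noteq> 0. pk s t) = (\<Sum>t\<in>?N. pk s t)"
      using sub edge_V by (intro sum.mono_neutral_left fin) (auto simp: V_rho_def)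
    also have "\<dots> = m x / ck x + (\<Sum>y\<in>E `` {x}. c (x, y) / ck x)"
      using locally_finite[OF x] by (simp add: Some sum.reindex image_iff)
    also have "\<dots> = 1"
      using killed_cond_pos[OF x] unfolding sum_divide_distrib[symmetric] add_divide_distrib[symmetric]
      by (simp add: killed_cond_def total_cond_def add.commute)
    finally show ?thesis using finite_subset[OF sub fin] by blast
  qed
  then show "finite {t \<in> V_rho V. pk s t \<noteq> 0}"
    "(\<Sum>t | t \<in> V_rho V \<and> pk s t \<noteq> 0. pk s t) = 1" by blast+
qed (rule killed_prob_None)

text \<open>Connectedness leads from \<open>y\<close> to a vertex of positive mass, where the walk
  can be killed. Such a word is what \<open>summable_hit_prob\<close> asks for.\<close>

lemma word_to_cemetery:
  assumes y: "y \<in> V"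
  obtains v where "v \<noteq> []" "set v \<subseteq> V_rho V" "hd v = Some y" "last v = None" "word_weight (pk) v > 0"
proof -
  obtain z where z: "z \<in> V" "m z > 0" using mass_pos by blast
  have "\<exists>v. v \<noteq> [] \<and> set v \<subseteq> V_rho V \<and> hd v = Some y \<and> last v = None \<and> word_weight (pk) v > 0"
    using connected[OF y z(1)]
  proof (induction rule: converse_rtrancl_induct)
    case base
    show ?case using z killed_cond_pos[OF z(1)] by (intro exI[of _ "[Some z, None]"]) (auto simp: V_rho_def)
  next
    case (step x y)
    then obtain v where v: "v \<noteq> []" "set v \<subseteq> V_rho V" "hd v = Some y" "last v = None" "word_weight (pk) v > 0"
      by blast
    obtain v' where v': "v = Some y # v'" using v by (cases v) auto
    have x: "x \<in> V" using edge_V[OF step(1)] by blast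
    have "pk (Some x) (Some y) > 0"
      using step(1) cond_pos killed_cond_pos[OF x] by simp
    then show ?case using v x unfolding v' by (intro exI[of _ "Some x # Some y # v'"]) (auto simp: V_rho_def)
  qed
  then show ?thesis using that by blast
qed

lemma transient_kernel_killed:
  assumes en: "range en = V"
  shows "transient_kernel (V_rho V) (pk) V en"
proof -
  interpret absorbing_kernel "V_rho V" "pk" by (rule absorbing_kernel_killed)
  show ?thesis
  proof
    show "V = Some -` V_rho V" by (auto simp: V_rho_def)
    show "range en = V" by (rule en)
  next
    fix y assume y: "y \<in> V"
    show "finite {s \<in> V_rho V. pk s (Some y) \<noteq> 0}"
    proof (rule finite_subset)
      show "{s \<in> V_rho V. pk s (Some y) \<noteq> 0} \<subseteq> Some ` (E `` {y})"
      proof safe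
        fix s assume s: "pk s (Some y) \<noteq> 0"
        then show "s \<in> Some ` (E `` {y})"
          using undirected by (cases s) (auto split: if_splits dest: symD)
      qed
    qed (use locally_finite[OF y] in simp)
    fix x assume x: "x \<in> V"
    obtain v where v: "v \<noteq> []" "set v \<subseteq> V_rho V" "hd v = Some y" "last v = None" "word_weight (pk) v > 0"
      using word_to_cemetery[OF y] by blast
    show "summable (\<lambda>n. hit_prob (Some x) n (Some y))"
      by (rule summable_hit_prob[OF _ _ killed_prob_None _ v]) (use x in \<open>auto simp: V_rho_def\<close>)
  qed
qed

text \<open>By \<open>total_ct\<close> the two walks have the same denominators, so the relation
  between conductances carries over to probabilities.\<close>

lemma conductance_prob_inner:
  assumes "x \<in> V"
  shows "pt (Some x) (Some y) = lam y / lam x * pk (Some x) (Some y)"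
  using assms by (simp add: conductance_prob_def Eo_inner ct_inner total_ct)

lemma conductance_prob_None: "t \<noteq> None \<Longrightarrow> pt None t = 0"
  by (simp add: conductance_prob_def)

lemma ct_pos: "(Some x, t) \<in> Eo \<Longrightarrow> ct (Some x, t) > 0"
  using ct_boundary ct_inner cond_pos lam_pos edge_V by (cases t) (auto simp: Eo_inner intro!: mult_pos_pos divide_pos_pos)

lemma V_iff: "x \<in> V \<longleftrightarrow> Some x \<in> W"
  by (simp add: W_V)

lemma absorbing_kernel_conductance: "absorbing_kernel W (pt)"
proof
  have "W \<subseteq> insert None (Some ` V)"
  proof
    fix s assume "s \<in> W"
    then show "s \<in> insert None (Some ` V)" by (cases s) (auto simp: V_iff)
  qed
  then show "countable W" using countable_V by (meson countable_image countable_insert countable_subset)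
  fix s assume s: "s \<in> W"
  show "pt s t \<ge> 0" if "t \<in> W" for t
  proof (cases s)
    case (Some x)
    then have "x \<in> V" using s by (simp add: V_iff)
    then show ?thesis
      using Some killed_cond_pos[of x] ct_pos[of x t]
      by (auto simp: conductance_prob_def total_ct intro!: divide_nonneg_nonneg intro: less_imp_le)
  qed (simp add: conductance_prob_def)
  have "finite {t \<in> W. pt s t \<noteq> 0} \<and>
    (\<Sum>t | t \<in> W \<and> pt s t \<noteq> 0. pt s t) = 1"
  proof (cases s)
    case None
    then have "{t \<in> W. pt s t \<noteq> 0} = {None}"
      using s by (auto simp: conductance_prob_def)
    then show ?thesis using None by (simp add: conductance_prob_def)
  next
    case (Some x)
    then have x: "x \<in> V" using s by (simp add: V_iff)
    have "Eo `` {s} \<subseteq> insert None (Some ` (E `` {x}))"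
    proof
      fix t assume "t \<in> Eo `` {s}"
      then show "t \<in> insert None (Some ` (E `` {x}))" by (cases t) (auto simp: Some Eo_inner)
    qed
    then have fin: "finite (Eo `` {s})" using locally_finite[OF x] by (meson finite_imageI finite_insert finite_subset)
    have sub: "{t \<in> W. pt s t \<noteq> 0} \<subseteq> Eo `` {s}"
      by (auto simp: Some conductance_prob_def split: if_splits)
    have "(\<Sum>t | t \<in> W \<and> pt s t \<noteq> 0. pt s t) = (\<Sum>t\<in>Eo `` {s}. pt s t)"
      using sub Eo_W by (intro sum.mono_neutral_left fin) auto
    also have "\<dots> = (\<Sum>t\<in>Eo `` {s}. ct (s, t) / total_cond Eo ct s)"
      by (intro sum.cong) (auto simp: conductance_prob_def Some)
    also have "\<dots> = total_cond Eo ct s / total_cond Eo ct s"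
      by (simp add: sum_divide_distrib[symmetric] total_cond_def)
    also have "\<dots> = 1" using killed_cond_pos[OF x] total_ct[OF x] by (simp add: Some)
    finally show ?thesis using finite_subset[OF sub fin] by blast
  qed
  then show "finite {t \<in> W. pt s t \<noteq> 0}"
    "(\<Sum>t | t \<in> W \<and> pt s t \<noteq> 0. pt s t) = 1" by blast+
qed (rule conductance_prob_None)

lemma hit_prob_conductance:
  assumes "x \<in> V" "y \<in> V"
  shows "measure (walk_law W (pt) (Some x)) {S \<in> space (walk_law W (pt) (Some x)). S n = Some y} =
    lam y / lam x * measure (killed_walk V E c m x) {S \<in> space (killed_walk V E c m x). S n = Some y}"
proof -
  have W': "V_rho V - {None} = Some ` V" "W - {None} = Some ` V"
  proof -
    show "W - {None} = Some ` V"
    proof safe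
      fix s assume s: "s \<in> W" "s \<notin> Some ` V"
      show "s = None" using s by (cases s) (auto simp: V_iff)
    qed (auto simp: V_iff)
  qed (auto simp: V_rho_def)
  have "measure (walk_law W (pt) (Some x)) {S \<in> space (walk_law W (pt) (Some x)). S n = Some y} =
    lam (the (Some y)) / lam (the (Some x)) *
      measure (walk_law (V_rho V) (pk) (Some x)) {S \<in> space (walk_law (V_rho V) (pk) (Some x)). S n = Some y}"
    by (rule hit_prob_conjugate[where h = "\<lambda>s. lam (the s)", OF absorbing_kernel_killed absorbing_kernel_conductance])
      (use assms W' lam_pos conductance_prob_inner in auto)
  then show ?thesis by (simp add: killed_walk_def)
qed

text \<open>This walk may have no cemetery, so \<open>summable_hit_prob\<close> is applied to the
  killed walk instead; for fixed endpoints the visit probabilities differ by a constant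
  factor.\<close>

lemma transient_kernel_conductance:
  assumes en: "range en = V"
  shows "transient_kernel W (pt) V en"
proof -
  interpret K: transient_kernel "V_rho V" "pk" V en by (rule transient_kernel_killed[OF en])
  interpret absorbing_kernel W "pt" by (rule absorbing_kernel_conductance)
  show ?thesis
  proof
    show "V = Some -` W" by (rule W_V)
    show "range en = V" by (rule en)
  next
    fix y assume y: "y \<in> V"
    show "finite {s \<in> W. pt s (Some y) \<noteq> 0}"
    proof (rule finite_subset[OF _ K.finite_predecessors[OF y]], safe)
      fix s assume s: "s \<in> W" "pt s (Some y) \<noteq> 0"
      then obtain x where "s = Some x" "x \<in> V" using conductance_prob_None by (cases s) (auto simp: V_iff)
      then show "s \<in> V_rho V" "pk s (Some y) = 0 \<Longrightarrow> False"
        using s by (auto simp: V_rho_def conductance_prob_inner simp del: killed_prob.simps)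
    qed
    fix x assume x: "x \<in> V"
    show "summable (\<lambda>n. hit_prob (Some x) n (Some y))"
      unfolding hit_prob_conductance[OF x y] using K.transient[OF x y]
      by (intro summable_mult) (simp add: killed_walk_def)
  qed
qed

lemma transfer_current_killed:
  assumes en: "range en = V" and es: "distinct es" "set es \<subseteq> E_rho V E m"
  shows "measure (wilson_measure (V_rho V) (pk) en) {F. set es \<subseteq> F} =
    Determinant.det (Matrix.mat (length es) (length es) (\<lambda>(i, j). H_rho V E c m (es ! i) (es ! j)))
    * (\<Prod>e\<leftarrow>es. c_rho c m e)"
proof -
  interpret K: transient_kernel "V_rho V" "pk" V en by (rule transient_kernel_killed[OF en])
  define q where "q = (\<lambda>s. ck (the s))"
  have green: "green_rho V E c m s t = K.walk_green s t / q t" for s t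
    by (cases s; cases t) (auto simp: K.walk_green_def potential_def killed_walk_def q_def)
  show ?thesis
  proof (rule K.wilson_transfer_conductances[where q = q, OF es(1)])
    fix e assume "e \<in> set es"
    then have e: "e \<in> cone_edges E {x \<in> V. m x > 0}" using es(2) by (auto simp: E_rho_def)
    show "fst e \<in> V_rho V \<and> snd e \<in> V_rho V \<and> (fst e = None \<or> pk (fst e) (snd e) \<noteq> 0 \<and>
      q (fst e) \<noteq> 0 \<and> c_rho c m e = q (fst e) * pk (fst e) (snd e))"
    proof (cases "fst e")
      case None
      then show ?thesis using e by (auto simp: cone_edges_def V_rho_def)
    next
      case (Some x)
      then have x: "x \<in> V" using e edge_V by (auto simp: cone_edges_def)
      show ?thesis
        using e Some killed_cond_pos[OF x] edge_V cond_pos by (fastforce simp: cone_edges_def V_rho_def q_def)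
    qed
  qed (simp add: H_rho_def green split_beta)
qed

lemma transfer_current_conductance:
  assumes en: "range en = V" and es: "distinct es" "set es \<subseteq> Eo"
  shows "measure (wilson_measure W (pt) en) {F. set es \<subseteq> F} =
    Determinant.det (Matrix.mat (length es) (length es) (\<lambda>(i, j). H_tilde V E c m lam (es ! i) (es ! j)))
    * (\<Prod>e\<leftarrow>es. ct e)"
proof -
  interpret K: transient_kernel W "pt" V en by (rule transient_kernel_conductance[OF en])
  interpret L: transient_kernel "V_rho V" "pk" V en by (rule transient_kernel_killed[OF en])
  define q where "q = (\<lambda>s. ck (the s))"
  have green: "green_tilde V E c m lam s t = K.walk_green s t / q t"
    if "s \<in> W" "t \<in> W" for s t
  proof (cases "s = None \<or> t = None")
    case True
    then show ?thesis by (cases s; cases t) (auto simp: K.walk_green_def)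
  next
    case False
    then obtain x y where xy: "s = Some x" "t = Some y" by auto
    then have V: "x \<in> V" "y \<in> V" using that by simp_all
    have "K.walk_green s t = lam y / lam x * potential V E c m x y"
      unfolding K.walk_green_def xy hit_prob_conductance[OF V] potential_def killed_walk_def
      using suminf_mult[OF L.transient[OF V], of "lam y / lam x"] by simp
    then show ?thesis by (simp add: xy q_def)
  qed
  have esW: "fst e \<in> W \<and> snd e \<in> W" if "e \<in> set es" for e
    using subsetD[OF Eo_W subsetD[OF es(2) that]] by (simp add: mem_Times_iff)
  show ?thesis
  proof (rule K.wilson_transfer_conductances[where q = q, OF es(1)])
    fix e assume e: "e \<in> set es"
    show "fst e \<in> W \<and> snd e \<in> W \<and> (fst e = None \<or> pt (fst e) (snd e) \<noteq> 0 \<and>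
      q (fst e) \<noteq> 0 \<and> ct e = q (fst e) * pt (fst e) (snd e))"
    proof (cases "fst e")
      case (Some x)
      then have x: "x \<in> V" using esW[OF e] by simp
      have "e = (Some x, snd e)" using Some by (metis prod.collapse)
      moreover from this have "ct e > 0" "e \<in> Eo" using ct_pos[of x "snd e"] e es(2) by auto
      ultimately show ?thesis
        using esW[OF e] killed_cond_pos[OF x] total_ct[OF x] by (simp add: conductance_prob_def q_def Some)
    qed (use esW[OF e] in simp)
  next
    fix e f assume "e \<in> set es" "f \<in> set es"
    then show "H_tilde V E c m lam e f = K.walk_green (fst e) (fst f) / q (fst f) - K.walk_green (snd e) (fst f) / q (fst f)"
      using esW green by (simp add: H_tilde_def split_beta)
  qed
qed

end

section \<open>The partition functions as one determinant\<close>

lemma cone_edges_inner: "(Some x, Some y) \<in> cone_edges E B \<longleftrightarrow> (x, y) \<in> E"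
  by (auto simp: cone_edges_def)

lemma cone_edges_subset: "E \<subseteq> V \<times> V \<Longrightarrow> B \<subseteq> V \<Longrightarrow> cone_edges E B \<subseteq> V_rho V \<times> V_rho V"
  by (auto simp: cone_edges_def V_rho_def)

lemma total_cond_cone_edges:
  assumes "finite (E `` {x})"
  shows "total_cond (cone_edges E B) C (Some x) =
    (\<Sum>y\<in>E `` {x}. C (Some x, Some y)) + (if x \<in> B then C (Some x, None) else 0)"
proof -
  have "cone_edges E B `` {Some x} = Some ` (E `` {x}) \<union> (if x \<in> B then {None} else {})"
    by (auto simp: cone_edges_def)
  moreover have "sum (\<lambda>t. C (Some x, t)) (Some ` (E `` {x})) = (\<Sum>y\<in>E `` {x}. C (Some x, Some y))"
    by (simp add: sum.reindex)
  ultimately show ?thesis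
    unfolding total_cond_def using assms by (auto simp: sum.union_disjoint image_iff)
qed

context doob_transform begin

lemma partition_functions:
  assumes V: "finite V" and W: "W = V_rho V"
  shows "Z_RSF V E c m = Z_RST (V_rho V) (E_rho V E m) (c_rho c m) None"
    and "Z_RST (V_rho V) (E_rho V E m) (c_rho c m) None = Z_RST W Eo ct None"
proof -
  define L where "L = (\<lambda>s u. of_bool (s = u) * killed_cond E c m (the s)
    - (if (the s, the u) \<in> E then c (the s, the u) else 0))"
  \<comment> \<open>Edges to \<open>None\<close> at vertices of mass zero carry weight zero, so
    \<open>B\<close> may be all of \<open>V\<close>, as for forests, or only the support of
    \<open>m\<close>, as in \<open>E_rho\<close>.\<close>
  have cone: "Z_RST (V_rho V) (cone_edges E B) (c_rho c m) None = det_on (Some ` V) L"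
    if B: "B \<subseteq> V" "{x \<in> V. m x > 0} \<subseteq> B" for B
  proof (subst Z_RST_eq_det[OF V cone_edges_subset[OF edges_in B(1)]], rule det_on_cong)
    fix s u assume "s \<in> Some ` V" "u \<in> Some ` V"
    then obtain x y where x: "s = Some x" "x \<in> V" and y: "u = Some y" by blast
    have "x \<notin> B \<Longrightarrow> m x = 0" using B(2) x(2) mass_nonneg[OF x(2)] by (auto simp: less_le)
    then have "total_cond (cone_edges E B) (c_rho c m) (Some x) = killed_cond E c m x"
      by (subst total_cond_cone_edges[OF locally_finite[OF x(2)]]) (simp add: killed_cond_def total_cond_def)
    then show "of_bool (s = u) * total_cond (cone_edges E B) (c_rho c m) s -
        (if (s, u) \<in> cone_edges E B then c_rho c m (s, u) else 0) = L s u"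
      by (simp add: L_def x y cone_edges_inner)
  qed
  show "Z_RSF V E c m = Z_RST (V_rho V) (E_rho V E m) (c_rho c m) None"
    unfolding Z_RSF_eq_Z_RST_cone[OF V edges_in] E_rho_def by (subst (1 2) cone) auto
  \<comment> \<open>The entries for \<open>ct\<close> are those for \<open>c\<close> conjugated by
    \<open>lam\<close>; the diagonals agree by \<open>total_ct\<close>.\<close>
  have "Z_RST W Eo ct None = det_on (Some ` V) (\<lambda>s u. lam (the u) / lam (the s) * L s u)"
    unfolding W
  proof (subst Z_RST_eq_det[OF V Eo_W[unfolded W]], rule det_on_cong)
    fix s u assume "s \<in> Some ` V" "u \<in> Some ` V"
    then obtain x y where x: "s = Some x" "x \<in> V" and y: "u = Some y" "y \<in> V" by blast
    show "of_bool (s = u) * total_cond Eo ct s - (if (s, u) \<in> Eo then ct (s, u) else 0) =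
        lam (the u) / lam (the s) * L s u"
      using lam_pos[OF x(2)] by (auto simp: L_def x(1) y(1) Eo_inner ct_inner total_ct[OF x(2)] right_diff_distrib)
  qed
  also have "\<dots> = det_on (Some ` V) L"
    by (rule det_on_conjugate) (use V lam_pos in force)+
  finally show "Z_RST (V_rho V) (E_rho V E m) (c_rho c m) None = Z_RST W Eo ct None"
    unfolding E_rho_def by (subst cone) auto
qed

end

text \<open>The harmonicity equation at \<open>x\<close>, divided by \<open>lam x\<close>.\<close>

lemma harmonic_total_cond:
  assumes "massive_laplacian E c m lam x = 0" "lam x \<noteq> 0"
  shows "(\<Sum>y\<in>E `` {x}. lam y / lam x * c (x, y)) = total_cond E c x + m x"
proof -
  have "(\<Sum>y\<in>E `` {x}. c (x, y) * lam y) = (total_cond E c x + m x) * lam x"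
    using assms(1)
    by (simp add: massive_laplacian_def right_diff_distrib sum_subtractf sum_distrib_left
        total_cond_def algebra_simps)
  moreover have "(\<Sum>y\<in>E `` {x}. lam y / lam x * c (x, y)) = (\<Sum>y\<in>E `` {x}. c (x, y) * lam y) / lam x"
    unfolding sum_divide_distrib by (intro sum.cong) auto
  ultimately show ?thesis using assms(2) by simp
qed

section \<open>The two settings as instances of \<open>doob_transform\<close>\<close>

lemma (in infinite_case) doob_transform: "doob_transform V E c m lam Vo Eo ct"
proof
  show "\<exists>z\<in>V. m z > 0" using mass_nonzero mass_nonneg by (auto simp: less_le)
  show "V = Some -` Vo" by (auto simp: Vo_def)
  show "Eo \<subseteq> Vo \<times> Vo" using edges_in by (auto simp: Eo_def Vo_def)
  show inner: "(Some x, Some y) \<in> Eo \<longleftrightarrow> (x, y) \<in> E" for x y by (auto simp: Eo_def)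
  show "ct (Some x, None) > 0" if "(Some x, None) \<in> Eo" for x using that by (auto simp: Eo_def)
  fix x assume x: "x \<in> V"
  have "Eo `` {Some x} = Some ` (E `` {x})" by (auto simp: Eo_def)
  then have "total_cond Eo ct (Some x) = (\<Sum>y\<in>E `` {x}. ct (Some x, Some y))"
    by (simp add: total_cond_def sum.reindex)
  also have "\<dots> = (\<Sum>y\<in>E `` {x}. lam y / lam x * c (x, y))"
    by (intro sum.cong) (auto simp: ct_inner)
  also have "\<dots> = killed_cond E c m x"
    using harmonic_total_cond[OF lam_harmonic[OF x]] lam_pos[OF x] by (simp add: killed_cond_def)
  finally show "total_cond Eo ct (Some x) = killed_cond E c m x" .
qed (use countable_V edges_in undirected locally_finite connected cond_pos mass_nonneg lam_pos ct_inner in auto)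

context finite_case begin

lemma E_neighbours: "x \<in> V \<Longrightarrow> E `` {x} = Ei `` {x} \<inter> V"
  by (auto simp: E_induced)

lemma V_sub: "x \<in> V \<Longrightarrow> x \<in> Vi"
  using V_strict by blast

text \<open>A path from \<open>V\<close> to a vertex outside must leave \<open>V\<close> somewhere.
  The edge found provides positive wired mass even where \<open>mi\<close> vanishes.\<close>

lemma boundary_edge: "\<exists>u v. (u, v) \<in> Ei \<and> u \<in> V \<and> v \<notin> V"
proof -
  obtain x y where "x \<in> V" "y \<in> Vi" "y \<notin> V" using V_nonempty V_strict by blast
  have "(x, y) \<in> Ei\<^sup>*" using connected \<open>x \<in> V\<close> \<open>y \<in> Vi\<close> V_sub by blast
  then show ?thesis using \<open>x \<in> V\<close> \<open>y \<notin> V\<close>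
    by (induction rule: converse_rtrancl_induct) blast+
qed

lemma ct_boundary_pos: "x \<in> V \<Longrightarrow> Ei `` {x} - V \<noteq> {} \<Longrightarrow> ct (Some x, None) > 0"
  unfolding ct_boundary using locally_finite[OF V_sub] cond_pos lam_pos edges_in V_sub
  by (intro sum_pos) auto

lemma total_cond_split: "x \<in> V \<Longrightarrow> (\<Sum>y\<in>Ei `` {x}. g y) = (\<Sum>y\<in>E `` {x}. g y) + (\<Sum>y\<in>Ei `` {x} - V. g y)"
  for g :: "'a \<Rightarrow> real"
  using locally_finite[OF V_sub] by (simp add: E_neighbours sum.Int_Diff)

lemma doob_transform: "doob_transform V E c m lam Vo Eo ct"
proof
  show "countable V" using finite_V by (rule countable_finite)
  show "E \<subseteq> V \<times> V" by (auto simp: E_induced)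
  show "sym E" using undirected by (auto simp: E_induced sym_def)
  show E_fin: "finite (E `` {x})" if "x \<in> V" for x
    using locally_finite[OF V_sub[OF that]] by (simp add: E_neighbours[OF that])
  show "c e > 0" if "e \<in> E" for e using that cond_pos c_restrict by (auto simp: E_induced)
  have out_nonneg: "(\<Sum>y\<in>Ei `` {x} - V. ci (x, y)) \<ge> 0" for x
    using cond_pos by (intro sum_nonneg) (auto intro: less_imp_le)
  show "m x \<ge> 0" if "x \<in> V" for x
    using out_nonneg[of x] mass_nonneg[OF V_sub[OF that]] by (simp add: m_wired[OF that])
  show "\<exists>z\<in>V. m z > 0"
  proof -
    obtain u v where uv: "(u, v) \<in> Ei" "u \<in> V" "v \<notin> V" using boundary_edge by blast
    have "(\<Sum>y\<in>Ei `` {u} - V. ci (u, y)) > 0"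
      using uv cond_pos locally_finite[OF V_sub[OF uv(2)]] by (intro sum_pos) auto
    then show ?thesis using uv mass_nonneg[OF V_sub[OF uv(2)]] by (intro bexI[of _ u]) (simp_all add: m_wired)
  qed
  show "V = Some -` Vo" by (auto simp: Vo_def)
  show "Eo \<subseteq> Vo \<times> Vo" by (auto simp: Eo_def Vo_def cone_edges_def E_induced)
  show "(Some x, Some y) \<in> Eo \<longleftrightarrow> (x, y) \<in> E" for x y by (simp add: Eo_def cone_edges_inner)
  show "ct (Some x, Some y) = lam y / lam x * c (x, y)" if "(x, y) \<in> E" for x y
    using that by (simp add: ct_inner c_restrict)
  show "ct (Some x, None) > 0" if "(Some x, None) \<in> Eo" for x
    using that by (intro ct_boundary_pos) (auto simp: Eo_def cone_edges_def)
  fix x assume x: "x \<in> V"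
  have lam0: "lam x \<noteq> 0" using lam_pos[OF V_sub[OF x]] by simp
  have "total_cond Eo ct (Some x) =
    (\<Sum>y\<in>E `` {x}. lam y / lam x * ci (x, y)) + (\<Sum>y\<in>Ei `` {x} - V. lam y / lam x * ci (x, y))"
    unfolding Eo_def total_cond_cone_edges[OF E_fin[OF x]]
  proof (intro arg_cong2[of _ _ _ _ "(+)"] sum.cong refl)
    show "(if x \<in> {x \<in> V. Ei `` {x} - V \<noteq> {}} then ct (Some x, None) else 0) =
      (\<Sum>y\<in>Ei `` {x} - V. lam y / lam x * ci (x, y))"
    proof (cases "Ei `` {x} - V = {}")
      case True
      then have "x \<notin> {x \<in> V. Ei `` {x} - V \<noteq> {}}" by simp
      then show ?thesis by (simp only: True if_False sum.empty)
    next
      case False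
      then show ?thesis using x ct_boundary[OF x] by simp
    qed
  qed (simp add: ct_inner)
  also have "\<dots> = total_cond Ei ci x + mi x"
    unfolding total_cond_split[OF x, symmetric] by (rule harmonic_total_cond[OF lam_harmonic[OF x] lam0])
  \<comment> \<open>The conductances of edges leaving \<open>V\<close> pass from the total
    conductance to the wired mass, so the killed total is unchanged.\<close>
  also have "total_cond Ei ci x = total_cond E c x + (\<Sum>y\<in>Ei `` {x} - V. ci (x, y))"
    unfolding total_cond_def total_cond_split[OF x] by (auto intro!: sum.cong simp: c_restrict)
  finally show "total_cond Eo ct (Some x) = killed_cond E c m x"
    by (simp add: killed_cond_def m_wired[OF x])
qed (use V_connected lam_pos V_sub in auto)

end

theorem theorem1p1:
  fixes V :: "'a set" and E :: "('a \<times> 'a) set"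
    and c :: "'a \<times> 'a \<Rightarrow> real" and m lam :: "'a \<Rightarrow> real"
    and Vo :: "'a option set" and Eo :: "('a option \<times> 'a option) set"
    and ct :: "'a option \<times> 'a option \<Rightarrow> real"
    and en :: "nat \<Rightarrow> 'a"
  assumes setting: "infinite_case V E c m lam Vo Eo ct \<or>
      (\<exists>Vi Ei ci mi. finite_case Vi Ei ci mi V E c m lam Vo Eo ct)"
    and enumeration: "range en = V"
  shows
    "(finite V \<longrightarrow>
        Z_RSF V E c m = Z_RST (V_rho V) (E_rho V E m) (c_rho c m) None \<and>
        Z_RST (V_rho V) (E_rho V E m) (c_rho c m) None = Z_RST Vo Eo ct None) \<and>
     (\<forall>es. distinct es \<and> set es \<subseteq> E_rho V E m \<longrightarrow>
        measure (wilson_measure (V_rho V) (killed_prob E c m) en) {F. set es \<subseteq> F} =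
          Determinant.det (mat (length es) (length es) (\<lambda>(i, j). H_rho V E c m (es ! i) (es ! j)))
          * (\<Prod>e\<leftarrow>es. c_rho c m e)) \<and>
     (\<forall>es. distinct es \<and> set es \<subseteq> Eo \<longrightarrow>
        measure (wilson_measure Vo (conductance_prob Eo ct) en) {F. set es \<subseteq> F} =
          Determinant.det (mat (length es) (length es) (\<lambda>(i, j). H_tilde V E c m lam (es ! i) (es ! j)))
          * (\<Prod>e\<leftarrow>es. ct e))"
proof -
  interpret doob_transform V E c m lam Vo Eo ct
    using setting by (metis infinite_case.doob_transform finite_case.doob_transform)
  have "Vo = V_rho V" if "finite V"
    using setting
  proof (elim disjE exE)
    assume "infinite_case V E c m lam Vo Eo ct"
    then show ?thesis using that infinite_case.infinite_V by blast
  next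
    fix Vi Ei ci mi assume "finite_case Vi Ei ci mi V E c m lam Vo Eo ct"
    then show ?thesis using finite_case.Vo_def by (fastforce simp: V_rho_def)
  qed
  then show ?thesis
    using partition_functions transfer_current_killed[OF enumeration] transfer_current_conductance[OF enumeration]
    by blast
qed

end
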